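(* Let $\xi\in\mathcal D$ and let $N$ be an arbitrary non-negative integer. Let $\nu,\alpha,\beta$ be complex numbers with $\Re(2\nu+\alpha+\beta+1)>N$. Write $\sigma=2\nu+\alpha+\beta$, $X_\pm=\dfrac{e^{\pm\xi}}{\sinh\xi}$, $Y_\pm=\dfrac{e^{\pm\xi}}{\cosh\xi}$ and $G_N=\dfrac{\Gamma(\Re(\sigma)-N+1)}{|\Gamma(\sigma+2)|}$. Define $R_N^{(Q)}=R_N^{(Q)}(\nu,\xi,\alpha,\beta)$ by $$\frac{2^{\sigma+1}}{\pi}B(\nu+1,\nu+\alpha+\beta+1)Q_\nu^{(\alpha,\beta)}(\cosh(2\xi))=X_-^{\alpha+1/2}Y_-^{\beta+1/2}e^{-2\nu\xi}\left(\sum_{n=0}^{N-1}g_n(\xi,\alpha,\beta)\frac{\Gamma(\sigma-n+1)}{\Gamma(\sigma+2)}+R_N^{(Q)}\right).$$ Then: (i) if $|\Re\alpha|<N+\frac12$ and $|\Re\beta|<\frac12$, $$|R_N^{(Q)}|\le\left(\hat a_N(\alpha)\hat a_0(\beta)|X_+|^N+\sum_{\ell=0}^{N-1}|a_\ell(\alpha)|\,\hat a_{N-\ell}(\beta)|X_+|^\ell|Y_+|^{N-\ell}\right)G_N;$$ (ii) if $|\Re\alpha|<\frac12$ and $|\Re\beta|<N+\frac12$, $$|R_N^{(Q)}|\le\left(\hat a_0(\alpha)\hat a_N(\beta)|Y_+|^N+\sum_{\ell=1}^{N}\hat a_\ell(\alpha)|a_{N-\ell}(\beta)|\,|X_+|^\ell|Y_+|^{N-\ell}\right)G_N;$$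 (iii) if $|\Re\alpha|,|\Re\beta|<\frac12$, $$|R_N^{(Q)}|\le\left(\sum_{\ell=0}^{N}\hat a_\ell(\alpha)\hat a_{N-\ell}(\beta)|X_+|^\ell|Y_+|^{N-\ell}\right)G_N;$$ (iv) if $\xi>0$, $\nu,\alpha,\beta$ are real, $|\alpha|,|\beta|<\frac12$ and $2\nu+\alpha+\beta+1>N$, then $R_N^{(Q)}$ is bounded in absolute value by the corresponding first neglected term $g_N(\xi,\alpha,\beta)\Gamma(\sigma-N+1)/\Gamma(\sigma+2)$ and has the same sign as it.
   Context: $\mathbf F\left({a,b\atop c};x\right)$ is the regularised hypergeometric function, $\sum_{n\ge0}\frac{(a)_n(b)_n}{\Gamma(c+n)\,n!}x^n$ for $|x|<1$, continued analytically to $x\in\mathbb C\setminus[1,\infty)$; $(w)_n=w(w+1)\cdots(w+n-1)$, $(w)_0=1$; $B$ is the beta function; $\mathbb Z^-=\{-1,-2,\dots\}$. The Jacobi function of the second kind is $$Q_\nu^{(\alpha,\beta)}(z)=\frac{2^{\nu+\alpha+\beta}\Gamma(\nu+\alpha+1)\Gamma(\nu+\beta+1)}{(z-1)^{\nu+\alpha+1}(z+1)^\beta}\mathbf F\left({\nu+1,\nu+\alpha+1\atop 2\nu+\alpha+\beta+2};\frac{2}{1-z}\right),\quad z\in\mathbb C\setminus(-\infty,1],\ \nu+\alpha,\nu+\beta\notin\mathbb Z^-,$$ with principal powers. Parameters are understood to be such that the functions appearing are defined. $\mathcal D=\{\xi:\Re\xi>0,\ |\Im\xi|<\frac\pi2\}$;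 $\xi\mapsto\cosh(2\xi)$ maps $\mathcal D$ biholomorphically onto $\mathbb C\setminus(-\infty,1]$. Also $$a_n(\mu)=\frac{(\frac12+\mu)_n(\frac12-\mu)_n}{(-2)^n n!},\qquad g_n(\xi,\alpha,\beta)=\sum_{\ell=0}^n a_\ell(\alpha)a_{n-\ell}(\beta)\left(\frac{e^{\xi}}{\sinh\xi}\right)^\ell\left(\frac{e^{\xi}}{\cosh\xi}\right)^{n-\ell},$$ $$\hat a_n(\mu)=\left|\frac{\cos(\pi\mu)}{\cos(\pi\Re\mu)}\,a_n(\Re\mu)\right|,$$ where, if $2\Re\mu$ is an odd integer, $a_n(\Re\mu)/\cos(\pi\Re\mu)$ in $\hat a_n(\mu)$ is replaced by its limiting value $\lim_{x\to\Re\mu}a_n(x)/\cos(\pi x)$ (used only for $|\Re\mu|<n+\frac12$). Fractional powers of $X_-$, $Y_-$ are positive-based (real logarithm of the base) for $\xi>0$ and are defined by continuity elsewhere in $\mathcal D$. *)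

theory Defs
  imports "HOL-Analysis.Analysis"
begin

definition slit_plane :: "complex set" where
  "slit_plane = - (complex_of_real ` {1..})"

text \<open>The regularised hypergeometric function: the unique holomorphic continuation of the power
  series (\<^term>\<open>rGamma\<close> is the entire function \<open>1/\<Gamma>\<close>) to the plane cut along \<open>[1,\<infinity>)\<close>.
  Its values on the cut are unspecified.\<close>

definition hypergeom_reg :: "complex \<Rightarrow> complex \<Rightarrow> complex \<Rightarrow> complex \<Rightarrow> complex" where
  "hypergeom_reg a b c = (SOME f. f holomorphic_on slit_plane \<and>
     (\<forall>x. norm x < 1 \<longrightarrow>
        f x = (\<Sum>n. pochhammer a n * pochhammer b n * rGamma (c + of_nat n) / fact n * x ^ n)))"

text \<open>Jacobi function of the second kind, for \<open>z\<close> off \<open>(-\<infinity>,1]\<close> and \<open>\<nu>+\<alpha>, \<nu>+\<beta> \<notin> {-1,-2,\<dots>}\<close>.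
  Complex \<open>powr\<close> is the principal power.\<close>

definition jacobi_Q :: "complex \<Rightarrow> complex \<Rightarrow> complex \<Rightarrow> complex \<Rightarrow> complex" where
  "jacobi_Q \<nu> \<alpha> \<beta> z =
     2 powr (\<nu> + \<alpha> + \<beta>) * Gamma (\<nu> + \<alpha> + 1) * Gamma (\<nu> + \<beta> + 1)
       / ((z - 1) powr (\<nu> + \<alpha> + 1) * (z + 1) powr \<beta>)
     * hypergeom_reg (\<nu> + 1) (\<nu> + \<alpha> + 1) (2 * \<nu> + \<alpha> + \<beta> + 2) (2 / (1 - z))"

definition domD :: "complex set" where
  "domD = {\<xi>. Re \<xi> > 0 \<and> \<bar>Im \<xi>\<bar> < pi / 2}"

definition Xp :: "complex \<Rightarrow> complex" where "Xp \<xi> = exp \<xi> / sinh \<xi>"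
definition Xm :: "complex \<Rightarrow> complex" where "Xm \<xi> = exp (- \<xi>) / sinh \<xi>"
definition Yp :: "complex \<Rightarrow> complex" where "Yp \<xi> = exp \<xi> / cosh \<xi>"
definition Ym :: "complex \<Rightarrow> complex" where "Ym \<xi> = exp (- \<xi>) / cosh \<xi>"

text \<open>For \<open>f\<close> continuous and zero-free on \<^term>\<open>domD\<close> and positive on the positive reals:
  the continuous branch of \<open>log \<circ> f\<close> on \<^term>\<open>domD\<close> that is the real logarithm for \<open>\<xi> > 0\<close>, and
  the powers of \<open>f\<close> that it determines. It is unique on \<^term>\<open>domD\<close> because \<^term>\<open>domD\<close> is connected.\<close>

definition log_D :: "(complex \<Rightarrow> complex) \<Rightarrow> complex \<Rightarrow> complex" where
  "log_D f = (SOME L. continuous_on domD L \<and> (\<forall>\<xi>\<in>domD. exp (L \<xi>) = f \<xi>) \<and>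
     (\<forall>x::real. x > 0 \<longrightarrow> L (of_real x) = of_real (ln (Re (f (of_real x))))))"

definition pow_D :: "(complex \<Rightarrow> complex) \<Rightarrow> complex \<Rightarrow> complex \<Rightarrow> complex" where
  "pow_D f s \<xi> = exp (s * log_D f \<xi>)"

definition a_coeff :: "nat \<Rightarrow> complex \<Rightarrow> complex" where
  "a_coeff n \<mu> = pochhammer (1/2 + \<mu>) n * pochhammer (1/2 - \<mu>) n / ((-2) ^ n * fact n)"

definition g_coeff :: "nat \<Rightarrow> complex \<Rightarrow> complex \<Rightarrow> complex \<Rightarrow> complex" where
  "g_coeff n \<xi> \<alpha> \<beta> =
     (\<Sum>l\<le>n. a_coeff l \<alpha> * a_coeff (n - l) \<beta> * Xp \<xi> ^ l * Yp \<xi> ^ (n - l))"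

text \<open>If \<open>2 Re \<mu>\<close> is an odd integer, the quotient \<open>a\<^sub>n(Re \<mu>) / cos (\<pi> Re \<mu>)\<close> is read as its limit
  along the reals; the limit exists when \<open>|Re \<mu>| < n + 1/2\<close>.\<close>

definition a_hat :: "nat \<Rightarrow> complex \<Rightarrow> real" where
  "a_hat n \<mu> =
     norm (cos (of_real pi * \<mu>) *
       (if \<exists>k::int. odd k \<and> 2 * Re \<mu> = of_int k
        then Lim (at (Re \<mu>)) (\<lambda>x::real. a_coeff n (of_real x) / of_real (cos (pi * x)))
        else a_coeff n (of_real (Re \<mu>)) / of_real (cos (pi * Re \<mu>))))"

definition G_fac :: "nat \<Rightarrow> complex \<Rightarrow> real" where
  "G_fac N \<sigma> = Gamma (Re \<sigma> - real N + 1) / norm (Gamma (\<sigma> + 2))"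

end

theory Submission
  imports Defs "HOL-Complex_Analysis.Complex_Analysis" "HOL-Probability.Distributions"
begin

text \<open>Put \<open>x = 1/X\<^sub>+\<close>, \<open>y = 1/Y\<^sub>+\<close>, so \<open>x + y = 1\<close>. For \<open>\<xi> > 0\<close> the left-hand side is, up to the
  prefactor, \<open>1/\<Gamma>(\<sigma>+2) \<integral> t\<^sup>\<sigma> e\<^sup>-\<^sup>t F\<^sub>\<alpha>(tx) F\<^sub>\<beta>(ty) dt\<close> over \<open>t > 0\<close>, where
  \<open>F\<^sub>\<alpha>(z) = (2z/\<pi>)\<^sup>1\<^sup>/\<^sup>2 e\<^sup>z K\<^sub>\<alpha>(z)\<close>: linear changes of variables in the triple integral obtained from
  \<open>K\<^sub>\<alpha>(z) = 1/2 \<integral> exp(\<alpha>u - z cosh u) du\<close> turn it into Euler's integral for the hypergeometric function.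
  The remainder of \<open>F\<^sub>\<alpha>\<close> after \<open>k\<close> terms \<open>a\<^sub>l(\<alpha>) z\<^sup>-\<^sup>l\<close> is a Stieltjes integral, bounded by the absolute
  first neglected term with \<open>\<alpha>\<close> replaced by \<open>Re \<alpha>\<close>, because \<open>1/(1 + y\<^sup>2/2z)\<close> has modulus at most 1 for
  \<open>Re z > 0\<close>. Expanding \<open>F\<^sub>\<alpha>\<close> to order \<open>N\<close> and the factor \<open>F\<^sub>\<beta>\<close> of its \<open>l\<close>-th term to order \<open>N - l\<close> (or
  conversely) gives the remainder as an integral that is holomorphic in \<open>\<xi>\<close>, so the formula persists on
  the whole strip. Integrals over \<open>t > 0\<close> are written with \<open>t = e\<^sup>w\<close>, so that
  the multiple integrals need only translations, dilations and Fubini's theorem.\<close>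

section \<open>Integrals depending holomorphically on a parameter\<close>

text \<open>The Stieltjes weight of the remainder is classically
  \<open>exp(-t) K_\<alpha>(t)\<close>. It is kept unintegrated, as a weight in two variables whose
  moments are Gaussian in one and beta in the other, so that no fact about Bessel functions is
  presupposed. These moments explain \<open>a_hat\<close>: moduli replace \<alpha> by Re \<alpha> in
  the gamma factors but leave the prefactor cos(pi \<alpha>), hence a quotient of two cosines. The
  weight of order k is integrable exactly for |Re \<alpha>| < k + 1/2. An order outside the narrow
  strip |Re| < 1/2 has no Stieltjes integral for its unexpanded factor, and its remainder formula
  comes by continuation in the order; the other factor must be bounded unexpanded, which confines it
  to the narrow strip and makes (i) and (ii) mirror images. With a = \<nu> + 1, b = \<nu> + \<alpha>
  + 1, c = \<sigma> + 2 the Bessel orders are b - a and c - a - b, and the four inequalities on real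
  parts that make Euler's and the gamma integrals converge follow from Re(\<sigma> + 1) > N and |Re
  \<alpha>| + |Re \<beta>| < N + 1.\<close>

text \<open>Differentiation under the integral sign. A local majorant of the integrand alone
  suffices, because Cauchy's inequality turns it into a majorant of the difference
  quotients.\<close>

lemma holomorphic_on_lebesgue_integral:
  fixes f :: "complex \<Rightarrow> 'a \<Rightarrow> complex"
  assumes S: "open S"
    and meas: "\<And>z. z \<in> S \<Longrightarrow> f z \<in> borel_measurable M"
    and holo: "\<And>t. t \<in> space M \<Longrightarrow> (\<lambda>z. f z t) holomorphic_on S"
    and dom: "\<And>z. z \<in> S \<Longrightarrow> \<exists>r>0. \<exists>g. integrable M g \<and>
                (\<forall>w\<in>ball z r \<inter> S. \<forall>t\<in>space M. norm (f w t) \<le> g t)"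
  shows "(\<lambda>z. \<integral>t. f z t \<partial>M) holomorphic_on S"
proof (rule holomorphic_onI)
  fix z assume z: "z \<in> S"
  obtain r g where r: "r > 0" and g: "integrable M g"
    and bound: "\<And>w t. w \<in> ball z r \<inter> S \<Longrightarrow> t \<in> space M \<Longrightarrow> norm (f w t) \<le> g t"
    using dom[OF z] by blast
  obtain e where e: "e > 0" "ball z e \<subseteq> S"
    using S z by (meson open_contains_ball)
  define R where "R = min r e"
  have R: "R > 0" "ball z R \<subseteq> S" "ball z R \<subseteq> ball z r"
    using r e by (auto simp: R_def)
  have bR: "norm (f w t) \<le> g t" if "w \<in> ball z R" "t \<in> space M" for w t
    using bound that R by blast
  have int: "integrable M (f w)" if "w \<in> ball z R" for w
    using g meas that bR R
    by (intro Bochner_Integration.integrable_bound[OF g])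
       (auto intro!: AE_I2 order.trans[OF bR abs_ge_self])
  have lip: "norm (f w t - f z t) \<le> (2 * g t / R) * norm (w - z)"
    if w: "w \<in> ball z (R/4)" and t: "t \<in> space M" for w t
  proof (rule field_differentiable_bound[of "ball z (R/4)" "\<lambda>z. f z t" "deriv (\<lambda>z. f z t)"])
    show "convex (ball z (R/4))" by simp
    show "w \<in> ball z (R/4)" "z \<in> ball z (R/4)" using w R by auto
    fix u assume u: "u \<in> ball z (R/4)"
    \<comment> \<open>\<open>u\<close> is within R/4 of \<open>z\<close>, so the disc of radius R/2
      about \<open>u\<close> stays within 3R/4 of \<open>z\<close>, where \<open>g\<close> still
      dominates.\<close>
    have cb: "cball u (R/2) \<subseteq> ball z R"
    proof
      fix x assume "x \<in> cball u (R/2)"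
      then show "x \<in> ball z R"
        using u R dist_triangle[of z x u] by auto
    qed
    have hol: "(\<lambda>z. f z t) holomorphic_on ball z R"
      using holo[OF t] R holomorphic_on_subset by blast
    have "((\<lambda>z. f z t) has_field_derivative deriv (\<lambda>z. f z t) u) (at u)"
      using u R holomorphic_derivI[OF hol open_ball] by auto
    then show "((\<lambda>z. f z t) has_field_derivative deriv (\<lambda>z. f z t) u) (at u within ball z (R/4))"
      by (rule has_field_derivative_at_within)
    have "norm ((deriv ^^ 1) (\<lambda>z. f z t) u) \<le> fact 1 * g t / (R/2) ^ 1"
    proof (rule Cauchy_inequality)
      show "(\<lambda>z. f z t) holomorphic_on ball u (R/2)"
        using hol cb by (meson ball_subset_cball holomorphic_on_subset)
      show "continuous_on (cball u (R/2)) (\<lambda>z. f z t)"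
        using hol cb by (meson holomorphic_on_imp_continuous_on holomorphic_on_subset)
      show "0 < R/2" using R by simp
      fix x assume "norm (u - x) = R/2"
      then show "norm (f x t) \<le> g t"
        using cb t by (intro bR) (auto simp: dist_norm)
    qed
    then show "norm (deriv (\<lambda>z. f z t) u) \<le> 2 * g t / R"
      by (simp add: field_simps)
  qed
  \<comment> \<open>The limit is tested along sequences, so that dominated convergence applies to
    the quotients.\<close>
  have "((\<lambda>w. ((\<integral>t. f w t \<partial>M) - (\<integral>t. f z t \<partial>M)) / (w - z)) \<longlongrightarrow>
          (\<integral>t. deriv (\<lambda>z. f z t) z \<partial>M)) (at z)"
    unfolding tendsto_at_iff_sequentially
  proof (intro allI impI)
    fix X :: "nat \<Rightarrow> complex"
    assume X: "\<forall>i. X i \<in> UNIV - {z}" and lim: "X \<longlonglongrightarrow> z"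
    have ev: "eventually (\<lambda>n. X n \<in> ball z (R/4)) sequentially"
      using topological_tendstoD[OF lim open_ball, of z "R/4"] R by simp
    then obtain n0 where n0: "\<And>n. n \<ge> n0 \<Longrightarrow> X n \<in> ball z (R/4)"
      unfolding eventually_sequentially by blast
    \<comment> \<open>Dropping \<open>n0\<close> terms puts every term into the small ball, so that
      one majorant serves for all \<open>n\<close>; the offset is undone at the end.\<close>
    define Y where "Y n = X (n + n0)" for n
    have Y: "Y n \<in> ball z (R/4)" "Y n \<noteq> z" "Y n \<in> S" "Y n \<in> ball z R" for n
      using n0[of "n + n0"] X R by (auto simp: Y_def)
    have limY: "Y \<longlonglongrightarrow> z"
      unfolding Y_def using lim by (rule LIMSEQ_ignore_initial_segment)
    define q where "q n t = (f (Y n) t - f z t) / (Y n - z)" for n t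
    have qlim: "(\<lambda>n. q n t) \<longlonglongrightarrow> deriv (\<lambda>z. f z t) z" if t: "t \<in> space M" for t
    proof -
      have "((\<lambda>z. f z t) has_field_derivative deriv (\<lambda>z. f z t) z) (at z)"
        using holomorphic_derivI[OF holo[OF t] S z] by auto
      then have "((\<lambda>w. (f w t - f z t) / (w - z)) \<longlongrightarrow> deriv (\<lambda>z. f z t) z) (at z)"
        by (simp add: has_field_derivative_iff)
      then have "((\<lambda>w. (f w t - f z t) / (w - z)) \<circ> Y) \<longlonglongrightarrow> deriv (\<lambda>z. f z t) z"
        using limY Y by (auto simp: tendsto_at_iff_sequentially)
      then show ?thesis by (simp add: q_def[abs_def] o_def)
    qed
    have qm: "q n \<in> borel_measurable M" for n
      unfolding q_def[abs_def] using meas Y z by (intro borel_measurable_divide borel_measurable_diff) auto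
    have "(\<lambda>n. \<integral>t. q n t \<partial>M) \<longlonglongrightarrow> (\<integral>t. deriv (\<lambda>z. f z t) z \<partial>M)"
    proof (rule integral_dominated_convergence[where w="\<lambda>t. 2 * g t / R"])
      show "(\<lambda>t. deriv (\<lambda>z. f z t) z) \<in> borel_measurable M"
        by (rule borel_measurable_LIMSEQ_metric[OF qm qlim])
      show "integrable M (\<lambda>t. 2 * g t / R)" using g by auto
      show "AE t in M. (\<lambda>n. q n t) \<longlonglongrightarrow> deriv (\<lambda>z. f z t) z"
        using qlim by auto
      show "AE t in M. norm (q n t) \<le> 2 * g t / R" for n
        using lip[OF Y(1)] Y(2) by (intro AE_I2) (simp add: q_def norm_divide divide_le_eq)
    qed (use qm in auto)
    moreover have "(\<integral>t. q n t \<partial>M) = ((\<integral>t. f (Y n) t \<partial>M) - (\<integral>t. f z t \<partial>M)) / (Y n - z)" for n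
      unfolding q_def using int[OF Y(4)] int[of z] R by simp
    ultimately have "(\<lambda>n. ((\<integral>t. f (Y n) t \<partial>M) - (\<integral>t. f z t \<partial>M)) / (Y n - z)) \<longlonglongrightarrow>
        (\<integral>t. deriv (\<lambda>z. f z t) z \<partial>M)" by simp
    then have "(\<lambda>n. ((\<integral>t. f (X (n + n0)) t \<partial>M) - (\<integral>t. f z t \<partial>M)) / (X (n + n0) - z)) \<longlonglongrightarrow>
        (\<integral>t. deriv (\<lambda>z. f z t) z \<partial>M)" by (simp add: Y_def)
    then have "(\<lambda>n. ((\<integral>t. f (X n) t \<partial>M) - (\<integral>t. f z t \<partial>M)) / (X n - z)) \<longlonglongrightarrow>
        (\<integral>t. deriv (\<lambda>z. f z t) z \<partial>M)" by (rule LIMSEQ_offset)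
    then show "((\<lambda>w. ((\<integral>t. f w t \<partial>M) - (\<integral>t. f z t \<partial>M)) / (w - z)) \<circ> X) \<longlonglongrightarrow>
        (\<integral>t. deriv (\<lambda>z. f z t) z \<partial>M)" by (simp add: o_def)
  qed
  then show "(\<lambda>z. \<integral>t. f z t \<partial>M) field_differentiable at z within S"
    unfolding field_differentiable_def has_field_derivative_iff
    by (meson tendsto_within_subset subset_UNIV)
qed

section \<open>Translations and the rotation of the plane by 45 degrees\<close>

lemma integrable_translate:
  fixes f :: "real \<Rightarrow> 'a::{banach, second_countable_topology}"
  shows "integrable lborel (\<lambda>x. f (x + t)) \<longleftrightarrow> integrable lborel f"
  using lborel_integrable_real_affine_iff[of 1 f t] by (simp add: add.commute)

lemma integral_translate:
  fixes f :: "real \<Rightarrow> 'a::{banach, second_countable_topology}"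
  shows "(\<integral>x. f (x + t) \<partial>lborel) = (\<integral>x. f x \<partial>lborel)"
  using lborel_integral_real_affine[of 1 f t] by (simp add: add.commute)

text \<open>The map (s, r) to (r + s, r - s) has Jacobian of modulus 2, whence the factor 1/2. It is
  split into a translation of r for fixed s and a dilation of s for fixed r.\<close>

lemma
  fixes F G :: "real \<Rightarrow> complex"
  assumes F: "integrable lborel F" and G: "integrable lborel G"
  shows integrable_mult_rotate: "integrable (lborel \<Otimes>\<^sub>M lborel) (\<lambda>(s, r). F (r + s) * G (r - s))"
    and integral_mult_rotate:
      "(\<integral>s. \<integral>r. F (r + s) * G (r - s) \<partial>lborel \<partial>lborel) = integral\<^sup>L lborel F * integral\<^sup>L lborel G / 2"
proof -
  have [measurable]: "F \<in> borel_measurable borel" "G \<in> borel_measurable borel"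
    using F G by auto
  have Faff: "integrable lborel (\<lambda>s. F (r + 2 * s))" for r
    using lborel_integrable_real_affine[OF F, of 2 r] by simp
  \<comment> \<open>In the sheared coordinates the integral over \<open>s\<close> is half the
    integral of \<open>F\<close>, whatever \<open>r\<close> is, so Fubini's criterion reduces to the
    integrability of \<open>G\<close>.\<close>
  have H: "integrable (lborel \<Otimes>\<^sub>M lborel) (\<lambda>(r, s). F (r + 2 * s) * G r)"
  proof (rule lborel_pair.Fubini_integrable)
    have *: "(\<integral>s. norm (F (r + 2 * s) * G r) \<partial>lborel) = (\<integral>x. norm (F x) \<partial>lborel) / 2 * norm (G r)" for r
    proof -
      have "(\<integral>s. norm (F (r + 2 * s)) \<partial>lborel) = (\<integral>x. norm (F x) \<partial>lborel) / 2"
        using lborel_integral_real_affine[of 2 "\<lambda>x. norm (F x)" r] by simp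
      then show ?thesis by (simp add: norm_mult)
    qed
    show "integrable lborel (\<lambda>r. \<integral>s. norm (case (r, s) of (r, s) \<Rightarrow> F (r + 2 * s) * G r) \<partial>lborel)"
      unfolding case_prod_conv * using G by (auto intro!: integrable_mult_right)
    show "AE r in lborel. integrable lborel (\<lambda>s. case (r, s) of (r, s) \<Rightarrow> F (r + 2 * s) * G r)"
      using Faff by auto
  qed measurable
  have H': "integrable (lborel \<Otimes>\<^sub>M lborel) (\<lambda>(s, r). F (r + 2 * s) * G r)"
    using lborel_pair.integrable_product_swap[OF H] by (simp add: case_prod_unfold)
  have shift: "(\<lambda>r. F (r + 2 * s) * G r) = (\<lambda>r. (\<lambda>r. F (r + s) * G (r - s)) (r + s))" for s
    by (auto simp: algebra_simps)
  have shift': "integrable lborel (\<lambda>r. F (r + 2 * s) * G r) \<longleftrightarrow>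
      integrable lborel (\<lambda>r. F (r + s) * G (r - s))" for s
    unfolding shift by (rule integrable_translate)
  show "integrable (lborel \<Otimes>\<^sub>M lborel) (\<lambda>(s, r). F (r + s) * G (r - s))"
  proof (rule lborel_pair.Fubini_integrable)
    have "(\<integral>r. norm (F (r + s) * G (r - s)) \<partial>lborel) = (\<integral>r. norm (F (r + 2 * s) * G r) \<partial>lborel)" for s
      by (subst integral_translate[symmetric, where t=s]) (simp add: algebra_simps)
    moreover have "integrable lborel (\<lambda>s. \<integral>r. norm (F (r + 2 * s) * G r) \<partial>lborel)"
      using lborel_pair.integrable_fst'[OF integrable_norm[OF H']] by simp
    ultimately show "integrable lborel (\<lambda>s. \<integral>r. norm (case (s, r) of (s, r) \<Rightarrow> F (r + s) * G (r - s)) \<partial>lborel)"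
      by simp
    have "AE s in lborel. integrable lborel (\<lambda>r. F (r + 2 * s) * G r)"
      using lborel_pair.AE_integrable_fst'[OF H'] by simp
    then show "AE s in lborel. integrable lborel (\<lambda>r. case (s, r) of (s, r) \<Rightarrow> F (r + s) * G (r - s))"
      by (simp only: shift' case_prod_conv)
  qed measurable
  have "(\<integral>s. \<integral>r. F (r + s) * G (r - s) \<partial>lborel \<partial>lborel) = (\<integral>s. \<integral>r. F (r + 2 * s) * G r \<partial>lborel \<partial>lborel)"
    unfolding shift by (intro Bochner_Integration.integral_cong refl integral_translate[symmetric])
  also have "\<dots> = (\<integral>r. \<integral>s. F (r + 2 * s) * G r \<partial>lborel \<partial>lborel)"
    by (rule lborel_pair.Fubini_integral[OF H])
  also have "\<dots> = (\<integral>r. integral\<^sup>L lborel F / 2 * G r \<partial>lborel)"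
  proof -
    have "(\<integral>s. F (r + 2 * s) \<partial>lborel) = integral\<^sup>L lborel F / 2" for r
      using lborel_integral_real_affine[of 2 F r] by (simp add: scaleR_conv_of_real)
    then show ?thesis by (simp only: integral_mult_left_zero)
  qed
  finally show "(\<integral>s. \<integral>r. F (r + s) * G (r - s) \<partial>lborel \<partial>lborel) = integral\<^sup>L lborel F * integral\<^sup>L lborel G / 2"
    by simp
qed

text \<open>Euler's gamma integral under t = exp u. The scale c becomes a translation of u by ln c,
  so the power of c with exponent -a appears as an exponential.\<close>

lemma
  assumes a: "Re a > 0" and c: "c > 0"
  shows integrable_Gamma_exp: "integrable lborel (\<lambda>u. exp (a * of_real u - of_real (c * exp u)))"
    and integral_Gamma_exp:
      "(\<integral>u. exp (a * of_real u - of_real (c * exp u)) \<partial>lborel) = Gamma a * exp (- a * of_real (ln c))"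
proof -
  let ?f = "\<lambda>t. of_real t powr (a - 1) / of_real (exp t) :: complex"
  let ?g = "\<lambda>u. exp (a * of_real u - of_real (exp u)) :: complex"
  have eq: "\<bar>exp u\<bar> *\<^sub>R ?f (exp u) = ?g u" for u :: real
    by (simp add: scaleR_conv_of_real powr_def Ln_of_real exp_of_real[symmetric]
        exp_add[symmetric] exp_diff[symmetric] algebra_simps del: exp_of_real)
  have rng: "range (exp :: real \<Rightarrow> real) = {0<..}"
    by (auto simp: image_def intro!: exp_ln[symmetric])
  have "(\<lambda>x. \<bar>exp x\<bar> *\<^sub>R ?f (exp x)) absolutely_integrable_on UNIV \<and>
      integral UNIV (\<lambda>x. \<bar>exp x\<bar> *\<^sub>R ?f (exp x)) = Gamma a"
    using has_absolute_integral_change_of_variables_real[of UNIV exp exp ?f "Gamma a"]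
      absolutely_integrable_Gamma_integral'[OF a] integral_unique[OF Gamma_integral_complex'[OF a]]
    by (auto simp: rng DERIV_exp has_field_derivative_at_within inj_on_def)
  then have ai: "?g absolutely_integrable_on UNIV" and iv: "integral UNIV ?g = Gamma a"
    unfolding eq by auto
  \<comment> \<open>The change of variables yields integrability for the completed measure; Borel
    measurability brings it back to \<open>lborel\<close>.\<close>
  have m: "?g \<in> borel_measurable lborel" by measurable
  have gi: "integrable lborel ?g"
    using ai m by (simp add: set_integrable_def integrable_completion)
  have gv: "(\<integral>u. ?g u \<partial>lborel) = Gamma a"
    using set_lebesgue_integral_eq_integral(2)[OF ai] iv m
    by (simp add: set_lebesgue_integral_def integral_completion)
  have tr: "exp (a * of_real u - of_real (c * exp u)) = exp (- a * of_real (ln c)) * ?g (u + ln c)" for u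
  proof -
    have "a * of_real u - of_real (c * exp u)
        = - a * of_real (ln c) + (a * of_real (u + ln c) - of_real (exp (u + ln c)))"
      using c by (simp add: exp_add algebra_simps)
    then show ?thesis by (simp only: exp_add)
  qed
  have "integrable lborel (\<lambda>u. ?g (u + ln c))"
    by (rule integrable_translate[of ?g "ln c", THEN iffD2, OF gi])
  then show "integrable lborel (\<lambda>u. exp (a * of_real u - of_real (c * exp u)))"
    unfolding tr by (rule integrable_mult_right)
  have "(\<integral>u. ?g (u + ln c) \<partial>lborel) = Gamma a"
    by (rule trans[OF integral_translate[of ?g "ln c"] gv])
  then show "(\<integral>u. exp (a * of_real u - of_real (c * exp u)) \<partial>lborel) = Gamma a * exp (- a * of_real (ln c))"
    unfolding tr by (simp only: integral_mult_right_zero) (simp add: mult.commute)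
qed

section \<open>Gamma and beta integrals in exponential variables\<close>

lemma exp_plus_exp_minus: "exp (r + s) + exp (r - s) = 2 * cosh s * exp (r :: real)"
  by (simp add: cosh_def exp_add exp_diff exp_minus field_simps)

lemma not_nonpos_Ints_Re_pos: "Re z > 0 \<Longrightarrow> z \<notin> \<int>\<^sub>\<le>\<^sub>0"
  by (metis Re_complex_of_real linorder_not_less nonpos_Ints_cases of_int_le_0_iff of_real_of_int_eq)

lemma Gamma_nonzero_Re_pos: "Re z > 0 \<Longrightarrow> Gamma z \<noteq> (0 :: complex)"
  using not_nonpos_Ints_Re_pos Gamma_nonzero by blast

lemma exp_real_le_exp_sum:
  fixes x A u :: real
  assumes "\<bar>x\<bar> \<le> A"
  shows "exp (x * u) \<le> exp (A * u) + exp (- A * u)"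
proof (cases "u \<ge> 0")
  case True
  then have "x * u \<le> A * u" using assms by (intro mult_right_mono) auto
  then have "exp (x * u) \<le> exp (A * u)" by simp
  also have "\<dots> \<le> exp (A * u) + exp (- A * u)" by simp
  finally show ?thesis .
next
  case False
  then have "x * u \<le> - A * u" using assms by (intro mult_right_mono_neg) auto
  then have "exp (x * u) \<le> exp (- A * u)" by simp
  also have "\<dots> \<le> exp (A * u) + exp (- A * u)" by simp
  finally show ?thesis .
qed

text \<open>Multiply two gamma integrals and rotate: since
  \<open>exp (r + s) + exp (r - s) = 2 * cosh s * exp r\<close>, the r-integral is again a gamma
  integral, and the nonzero factor Gamma(a + b) divides out.\<close>

lemma
  assumes a: "Re a > 0" and b: "Re b > 0"
  shows integrable_Beta_cosh:
      "integrable lborel (\<lambda>v. exp ((a - b) * of_real (v / 2) - (a + b) * of_real (ln (2 * cosh (v / 2)))))"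
    and integral_Beta_cosh:
      "(\<integral>v. exp ((a - b) * of_real (v / 2) - (a + b) * of_real (ln (2 * cosh (v / 2)))) \<partial>lborel)
        = Gamma a * Gamma b / Gamma (a + b)"
proof -
  define F where "F u = exp (a * of_real u - of_real (1 * exp u))" for u :: real
  define G where "G u = exp (b * of_real u - of_real (1 * exp u))" for u :: real
  define H where "H s = exp ((a - b) * of_real s - (a + b) * of_real (ln (2 * cosh s)))" for s :: real
  have F: "integrable lborel F" "integral\<^sup>L lborel F = Gamma a"
    unfolding F_def[abs_def] using integrable_Gamma_exp[OF a, of 1] integral_Gamma_exp[OF a, of 1] by auto
  have G: "integrable lborel G" "integral\<^sup>L lborel G = Gamma b"
    unfolding G_def[abs_def] using integrable_Gamma_exp[OF b, of 1] integral_Gamma_exp[OF b, of 1] by auto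
  have inner: "(\<integral>r. F (r + s) * G (r - s) \<partial>lborel) = Gamma (a + b) * H s" for s
  proof -
    have "F (r + s) * G (r - s) = exp ((a - b) * of_real s) *
        exp ((a + b) * of_real r - of_real ((2 * cosh s) * exp r))" for r
    proof -
      have "a * of_real (r + s) - of_real (1 * exp (r + s)) + (b * of_real (r - s) - of_real (1 * exp (r - s)))
         = (a - b) * of_real s + ((a + b) * of_real r - of_real ((2 * cosh s) * exp r))"
        using arg_cong[OF exp_plus_exp_minus[of r s], of complex_of_real] by (simp add: algebra_simps)
      then show ?thesis by (simp only: F_def G_def exp_add[symmetric])
    qed
    then have "(\<integral>r. F (r + s) * G (r - s) \<partial>lborel) =
        exp ((a - b) * of_real s) * (Gamma (a + b) * exp (- (a + b) * of_real (ln (2 * cosh s))))"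
      using integral_Gamma_exp[of "a + b" "2 * cosh s"] a b by simp
    also have "\<dots> = Gamma (a + b) * H s"
      by (simp add: H_def exp_add[symmetric] algebra_simps)
    finally show ?thesis .
  qed
  have nz: "Gamma (a + b) \<noteq> 0"
    using a b by (intro Gamma_nonzero_Re_pos) simp
  have "integrable lborel (\<lambda>s. Gamma (a + b) * H s)"
    using lborel_pair.integrable_fst'[OF integrable_mult_rotate[OF F(1) G(1)]] by (simp add: inner)
  then have "integrable lborel (\<lambda>s. inverse (Gamma (a + b)) * (Gamma (a + b) * H s))"
    by (rule integrable_mult_right)
  then have iH: "integrable lborel H" using nz by (simp add: mult.assoc[symmetric])
  have "Gamma (a + b) * integral\<^sup>L lborel H = Gamma a * Gamma b / 2"
    using integral_mult_rotate[OF F(1) G(1)] F(2) G(2) by (simp add: inner)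
  then have vH: "integral\<^sup>L lborel H = Gamma a * Gamma b / Gamma (a + b) / 2"
    using nz by (simp add: field_simps)
  have "integrable lborel (\<lambda>v. H (0 + (1/2) * v))"
    by (rule lborel_integrable_real_affine[OF iH]) simp
  then show "integrable lborel (\<lambda>v. exp ((a - b) * of_real (v / 2) - (a + b) * of_real (ln (2 * cosh (v / 2)))))"
    by (simp add: H_def)
  have "integral\<^sup>L lborel H = \<bar>1/2\<bar> *\<^sub>R (\<integral>v. H (0 + (1/2) * v) \<partial>lborel)"
    by (rule lborel_integral_real_affine) simp
  then have "(\<integral>v. H (v / 2) \<partial>lborel) = Gamma a * Gamma b / Gamma (a + b)"
    using vH by (simp add: scaleR_conv_of_real field_simps)
  then show "(\<integral>v. exp ((a - b) * of_real (v / 2) - (a + b) * of_real (ln (2 * cosh (v / 2)))) \<partial>lborel)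
        = Gamma a * Gamma b / Gamma (a + b)"
    by (simp add: H_def)
qed

lemma has_bochner_integral_gaussian_moment_scaled:
  fixes c :: real
  assumes c: "c > 0"
  shows "has_bochner_integral lborel (\<lambda>y. y ^ (2 * k) * exp (- (c * y)\<^sup>2))
           (sqrt pi * fact (2 * k) / (2 ^ (2 * k) * fact k) / c ^ (2 * k + 1))"
proof -
  have "has_bochner_integral lborel (\<lambda>x::real. exp (- x\<^sup>2) * x ^ (2 * k))
      (2 * (sqrt pi / 2 * (fact (2 * k) / (2 ^ (2 * k) * fact k))))"
    using has_bochner_integral_even_function[OF gaussian_moment_even_pos[where k=k]] by simp
  then have "has_bochner_integral lborel (\<lambda>x::real. exp (- (0 + c * x)\<^sup>2) * (0 + c * x) ^ (2 * k))
      ((2 * (sqrt pi / 2 * (fact (2 * k) / (2 ^ (2 * k) * fact k)))) /\<^sub>R \<bar>c\<bar>)"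
    using c by (subst lborel_has_bochner_integral_real_affine_iff[symmetric]) auto
  then have "has_bochner_integral lborel (\<lambda>x::real. (1 / c ^ (2 * k)) * (exp (- (0 + c * x)\<^sup>2) * (0 + c * x) ^ (2 * k)))
      ((1 / c ^ (2 * k)) * ((2 * (sqrt pi / 2 * (fact (2 * k) / (2 ^ (2 * k) * fact k)))) /\<^sub>R \<bar>c\<bar>))"
    by (rule has_bochner_integral_mult_right)
  then show ?thesis
    using c by (simp add: power_mult_distrib field_simps)
qed

text \<open>With p = (v, y) and cosh(v/2)^2 = (1 + cosh v)/2, integration over v would give y^(2k)
  times \<open>2 exp(-y^2/2) K_\<alpha>(y^2/2)\<close>, the Stieltjes weight of the Bessel function
  in the variable y^2/2. Using y rather than its square lets the integral run over the whole
  plane.\<close>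

definition K_wt :: "nat \<Rightarrow> complex \<Rightarrow> real \<times> real \<Rightarrow> complex" where
  "K_wt k \<alpha> p = exp (\<alpha> * of_real (fst p)) * of_real (snd p ^ (2 * k) * exp (- (cosh (fst p / 2) * snd p)\<^sup>2))"

lemma measurable_K_wt [measurable]: "K_wt k \<alpha> \<in> borel_measurable (lborel \<Otimes>\<^sub>M lborel)"
  unfolding K_wt_def[abs_def] lborel_prod
  by (auto intro!: borel_measurable_continuous_onI continuous_intros simp: cosh_def)

text \<open>Apart from exp(\<alpha> v) the weight is a non-negative real, the power of y being even.
  Integrals of moduli are therefore moments of the weight at Re \<alpha>.\<close>

lemma norm_K_wt: "norm (K_wt k \<alpha> p) = Re (K_wt k (of_real (Re \<alpha>)) p)"
proof -
  have "exp (of_real (Re \<alpha>) * complex_of_real (fst p)) = of_real (exp (Re \<alpha> * fst p))"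
    by (simp flip: exp_of_real)
  then show ?thesis by (simp add: K_wt_def norm_mult norm_power power_mult)
qed

text \<open>The y-integral is a Gaussian moment and leaves cosh(v/2) to the power -(2k + 1); the
  v-integral is then a beta integral with parameters k + 1/2 + \<alpha> and k + 1/2 - \<alpha>,
  whose sum is 2k + 1.\<close>

lemma
  assumes \<alpha>: "\<bar>Re \<alpha>\<bar> < real k + 1/2"
  shows integrable_K_wt: "integrable (lborel \<Otimes>\<^sub>M lborel) (K_wt k \<alpha>)"
    and integral_K_wt: "integral\<^sup>L (lborel \<Otimes>\<^sub>M lborel) (K_wt k \<alpha>) =
      2 * of_real (sqrt pi) * Gamma (of_nat k + 1/2 + \<alpha>) * Gamma (of_nat k + 1/2 - \<alpha>) / fact k"
proof -
  define C where "C = sqrt pi * fact (2 * k) / (2 ^ (2 * k) * fact k)"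
  define w where "w \<alpha> v = exp (\<alpha> * of_real v) / of_real (cosh (v / 2) ^ (2 * k + 1))" for \<alpha> :: complex and v :: real
  have yint: "has_bochner_integral lborel (\<lambda>y. K_wt k \<alpha> (v, y)) (of_real C * w \<alpha> v)" for v \<alpha>
  proof -
    have "has_bochner_integral lborel (\<lambda>y. exp (\<alpha> * of_real v) *
         complex_of_real (y ^ (2 * k) * exp (- (cosh (v / 2) * y)\<^sup>2)))
         (exp (\<alpha> * of_real v) * complex_of_real (C / cosh (v / 2) ^ (2 * k + 1)))"
      unfolding C_def
      by (intro has_bochner_integral_mult_right has_bochner_integral_of_real
          has_bochner_integral_gaussian_moment_scaled) simp
    then show ?thesis by (simp add: K_wt_def w_def mult_ac)
  qed
  have w: "integrable lborel (w \<alpha>)" "integral\<^sup>L lborel (w \<alpha>) =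
      2 ^ (2 * k + 1) * (Gamma (of_nat k + 1/2 + \<alpha>) * Gamma (of_nat k + 1/2 - \<alpha>) / fact (2 * k))"
    if \<alpha>: "\<bar>Re \<alpha>\<bar> < real k + 1/2" for \<alpha>
  proof -
    define a b where "a = of_nat k + 1/2 + \<alpha>" and "b = of_nat k + 1/2 - \<alpha>"
    have ab: "Re a > 0" "Re b > 0" using \<alpha> by (auto simp: a_def b_def)
    have sum: "a + b = of_nat (2 * k + 1)" by (simp add: a_def b_def)
    have diff: "a - b = 2 * \<alpha>" by (simp add: a_def b_def)
    have "w \<alpha> v = 2 ^ (2 * k + 1) *
      exp ((a - b) * of_real (v / 2) - (a + b) * of_real (ln (2 * cosh (v / 2))))" for v
    proof -
      have "exp (of_real (real (2 * k + 1) * ln (2 * cosh (v / 2)))) = complex_of_real ((2 * cosh (v / 2)) ^ (2 * k + 1))"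
        by (simp only: exp_of_real exp_of_nat_mult) simp
      then show ?thesis
        unfolding sum diff by (simp add: w_def exp_diff power_mult_distrib)
    qed
    note eq = this
    have G: "Gamma (a + b) = fact (2 * k)"
      unfolding sum using Gamma_fact[of "2 * k", where 'a = complex] by (simp add: add.commute)
    show "integrable lborel (w \<alpha>)"
      unfolding eq[abs_def] by (intro integrable_mult_right integrable_Beta_cosh ab)
    show "integral\<^sup>L lborel (w \<alpha>) =
      2 ^ (2 * k + 1) * (Gamma (of_nat k + 1/2 + \<alpha>) * Gamma (of_nat k + 1/2 - \<alpha>) / fact (2 * k))"
      unfolding eq[abs_def] integral_mult_right_zero integral_Beta_cosh[OF ab] G by (simp add: a_def b_def)
  qed
  show int: "integrable (lborel \<Otimes>\<^sub>M lborel) (K_wt k \<alpha>)"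
  proof (rule lborel_pair.Fubini_integrable)
    \<comment> \<open>Absolute integrability is the integrability of the same v-integral at Re
      \<alpha>.\<close>
    have "norm (K_wt k \<alpha> (v, y)) = Re (K_wt k (of_real (Re \<alpha>)) (v, y))" for v y by (rule norm_K_wt)
    moreover have "(\<integral>y. Re (K_wt k (of_real (Re \<alpha>)) (v, y)) \<partial>lborel) = Re (of_real C * w (of_real (Re \<alpha>)) v)" for v
      using yint[of "of_real (Re \<alpha>)" v]
      by (subst integral_Re) (auto simp: has_bochner_integral_iff)
    ultimately have "(\<lambda>v. \<integral>y. norm (K_wt k \<alpha> (v, y)) \<partial>lborel) = (\<lambda>v. Re (of_real C * w (of_real (Re \<alpha>)) v))"
      by simp
    moreover have "integrable lborel (\<lambda>v. Re (of_real C * w (of_real (Re \<alpha>)) v))"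
      using \<alpha> by (intro integrable_Re integrable_mult_right w) auto
    ultimately show "integrable lborel (\<lambda>v. \<integral>y. norm (K_wt k \<alpha> (v, y)) \<partial>lborel)" by simp
    show "AE v in lborel. integrable lborel (\<lambda>y. K_wt k \<alpha> (v, y))"
      using yint by (auto simp: has_bochner_integral_iff)
  qed measurable
  have "integral\<^sup>L (lborel \<Otimes>\<^sub>M lborel) (K_wt k \<alpha>) = (\<integral>v. \<integral>y. K_wt k \<alpha> (v, y) \<partial>lborel \<partial>lborel)"
    by (rule lborel_pair.integral_fst'[OF int, symmetric])
  also have "\<dots> = (\<integral>v. of_real C * w \<alpha> v \<partial>lborel)"
    using yint by (simp add: has_bochner_integral_iff)
  also have "\<dots> = of_real C * (2 ^ (2 * k + 1) * (Gamma (of_nat k + 1/2 + \<alpha>) * Gamma (of_nat k + 1/2 - \<alpha>) / fact (2 * k)))"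
    by (simp only: integral_mult_right_zero w(2)[OF \<alpha>])
  also have "\<dots> = 2 * of_real (sqrt pi) * Gamma (of_nat k + 1/2 + \<alpha>) * Gamma (of_nat k + 1/2 - \<alpha>) / fact k"
  proof -
    have "complex_of_real C * 2 ^ (2 * k + 1) * fact k = 2 * of_real (sqrt pi) * fact (2 * k)"
      by (simp add: C_def)
    then show ?thesis by (simp add: divide_simps mult_ac)
  qed
  finally show "integral\<^sup>L (lborel \<Otimes>\<^sub>M lborel) (K_wt k \<alpha>) =
      2 * of_real (sqrt pi) * Gamma (of_nat k + 1/2 + \<alpha>) * Gamma (of_nat k + 1/2 - \<alpha>) / fact k" .
qed

text \<open>The reflection formula at \<open>d\<close>, whose partner 1 - d is \<open>b\<close>,
  combined with 2k steps of the recurrence from \<open>d\<close> up to \<open>a\<close>. The product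
  form also covers the zeros of the cosine, which lie in the strip as soon as k > 0.\<close>

lemma cos_mult_Gamma_mult_Gamma:
  fixes \<alpha> :: complex
  assumes \<alpha>: "\<bar>Re \<alpha>\<bar> < real k + 1/2"
  shows "cos (of_real pi * \<alpha>) * (Gamma (of_nat k + 1/2 + \<alpha>) * Gamma (of_nat k + 1/2 - \<alpha>)) =
           of_real pi * (pochhammer (1/2 + \<alpha>) k * pochhammer (1/2 - \<alpha>) k)"
proof -
  define a b where "a = of_nat k + 1/2 + \<alpha>" and "b = of_nat k + 1/2 - \<alpha>"
  define d where "d = 1/2 + \<alpha> - of_nat k"
  have ab: "Re a > 0" "Re b > 0" using \<alpha> by (auto simp: a_def b_def)
  have nz: "rGamma a * Gamma a = 1" "rGamma b * Gamma b = 1"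
    using ab by (auto simp: Gamma_def rGamma_eq_zero_iff elim!: nonpos_Ints_cases intro!: right_inverse)
  have bd: "b = 1 - d" by (simp add: b_def d_def)
  have "sin (of_real pi * d) = (-1) ^ k * cos (of_real pi * \<alpha>)"
  proof -
    have "of_real pi * d = (of_real pi * \<alpha> + of_real pi / 2) - of_real pi * of_nat k"
      by (simp add: d_def algebra_simps)
    moreover have "sin (of_real pi * of_nat k :: complex) = 0" "cos (of_real pi * of_nat k :: complex) = (-1) ^ k"
    proof -
      have "complex_of_real pi * of_nat k = of_real (pi * real k)" by simp
      then show "sin (of_real pi * of_nat k :: complex) = 0" "cos (of_real pi * of_nat k :: complex) = (-1) ^ k"
        by (simp_all only: sin_of_real cos_of_real sin_npi2 cos_npi2) simp_all
    qed
    moreover have "sin (of_real pi * \<alpha> + of_real pi / 2) = cos (of_real pi * \<alpha>)"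
    proof -
      have "complex_of_real pi / 2 = of_real (pi / 2)" by simp
      then show ?thesis
        by (simp only: sin_add sin_of_real cos_of_real sin_pi_half cos_pi_half) simp
    qed
    ultimately show ?thesis by (simp add: sin_diff)
  qed
  then have "of_real pi * (rGamma d * rGamma b) = (-1) ^ k * cos (of_real pi * \<alpha>)"
    using rGamma_reflection_complex[of d] by (simp add: bd)
  then have "cos (of_real pi * \<alpha>) = (-1) ^ k * (of_real pi * (rGamma d * rGamma b))"
    by (simp add: mult.assoc[symmetric] power_mult_distrib[symmetric])
  also have "rGamma d = pochhammer d (2 * k) * rGamma a"
  proof -
    have "d + of_nat (2 * k) = a" by (simp add: a_def d_def)
    then show ?thesis using pochhammer_rGamma[of d "2 * k"] by simp
  qed
  \<comment> \<open>Of the 2k factors the last k start at d + k = 1/2 + \<alpha>; the first k are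
    those of \<open>pochhammer (1/2 - \<alpha>) k\<close>, negated and in reverse order.\<close>
  also have "pochhammer d (2 * k) = pochhammer d k * pochhammer (1/2 + \<alpha>) k"
    using pochhammer_product'[of d k k] by (simp add: d_def mult_2)
  also have "pochhammer d k = (-1) ^ k * pochhammer (1/2 - \<alpha>) k"
    using pochhammer_minus'[of "\<alpha> - 1/2" k] by (simp add: d_def algebra_simps)
  finally have "cos (of_real pi * \<alpha>) * (Gamma a * Gamma b) =
     ((-1) ^ k * (-1) ^ k) * of_real pi * (pochhammer (1/2 + \<alpha>) k * pochhammer (1/2 - \<alpha>) k) *
     (rGamma a * Gamma a) * (rGamma b * Gamma b)"
    by (simp add: mult_ac)
  then show ?thesis
    by (simp add: nz power_mult_distrib[symmetric]) (simp add: a_def b_def)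
qed

section \<open>The large-argument remainders of the modified Bessel function\<close>

lemma lborel_integral_substitution:
  fixes f :: "real \<Rightarrow> 'a::euclidean_space"
  assumes g: "\<And>x. (g has_field_derivative g' x) (at x)" and pos: "\<And>x. g' x > 0" and surj: "surj g"
    and f: "integrable lborel f" and g': "g' \<in> borel_measurable borel"
  shows "(\<integral>x. g' x *\<^sub>R f (g x) \<partial>lborel) = (\<integral>x. f x \<partial>lborel)"
proof -
  have "strict_mono g"
  proof (rule strict_monoI)
    fix x y :: real assume "x < y"
    then show "g x < g y"
      by (rule DERIV_pos_imp_increasing) (use g pos in blast)
  qed
  then have inj: "inj g" by (rule strict_mono_imp_inj_on)
  have [measurable]: "f \<in> borel_measurable borel" "g' \<in> borel_measurable borel"
    using f g' by auto
  have "continuous_on UNIV g"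
    using g by (meson DERIV_isCont continuous_at_imp_continuous_on)
  then have [measurable]: "g \<in> borel_measurable borel" by (rule borel_measurable_continuous_onI)
  let ?h = "\<lambda>x. \<bar>g' x\<bar> *\<^sub>R f (g x)"
  have "f absolutely_integrable_on UNIV"
    using f by (simp add: set_integrable_def integrable_completion)
  moreover have "integral UNIV f = (\<integral>x. f x \<partial>lborel)"
    using integral_lborel[OF f] .
  ultimately have "?h absolutely_integrable_on UNIV \<and> integral UNIV ?h = (\<integral>x. f x \<partial>lborel)"
    using has_absolute_integral_change_of_variables_real[of UNIV g g' f "\<integral>x. f x \<partial>lborel"] g inj surj
    by (auto simp: has_field_derivative_at_within)
  then have "integrable lborel ?h" "integral UNIV ?h = (\<integral>x. f x \<partial>lborel)"
    by (auto simp: set_integrable_def integrable_completion)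
  then show ?thesis
    using integral_lborel[of ?h] pos by (simp add: less_imp_le)
qed

text \<open>As cosh u exceeds both exp(u)/2 and exp(-u)/2, the integrand is bounded by a gamma
  integrand in u or in -u. The summand 1 in \<open>A\<close> keeps the gamma parameter positive when
  Re \<alpha> = 0.\<close>

lemma integrable_exp_cosh:
  fixes \<alpha> :: complex and z :: real
  assumes z: "z > 0"
  shows "integrable lborel (\<lambda>u. exp (\<alpha> * of_real u - of_real (z * cosh u)))"
proof -
  define A where "A = \<bar>Re \<alpha>\<bar> + 1"
  define F where "F u = norm (exp (of_real A * of_real u - of_real (z / 2 * exp u) :: complex))" for u :: real
  have iF: "integrable lborel F"
    unfolding F_def[abs_def] by (intro integrable_norm integrable_Gamma_exp) (use z in \<open>auto simp: A_def\<close>)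
  have iF': "integrable lborel (\<lambda>u. F (- u))"
    using lborel_integrable_real_affine[OF iF, of "-1" 0] by simp
  have bound: "norm (exp (\<alpha> * of_real u - of_real (z * cosh u))) \<le> F u + F (- u)" for u
  proof -
    have "z * (exp u / 2) \<le> z * cosh u" "z * (exp (- u) / 2) \<le> z * cosh u"
      using z by (auto intro!: mult_left_mono simp: cosh_def)
    moreover have "Re \<alpha> * u \<le> A * u \<or> Re \<alpha> * u \<le> A * (- u)"
    proof (cases "u \<ge> 0")
      case True
      then show ?thesis by (intro disjI1 mult_right_mono) (simp_all add: A_def)
    next
      case False
      then have "Re \<alpha> * u \<le> (- A) * u" by (intro mult_right_mono_neg) (simp_all add: A_def)
      then show ?thesis by simp
    qed
    ultimately have "Re \<alpha> * u - z * cosh u \<le> A * u - z / 2 * exp u \<or>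
        Re \<alpha> * u - z * cosh u \<le> A * (- u) - z / 2 * exp (- u)"
      by (elim disjE) auto
    then have "exp (Re \<alpha> * u - z * cosh u) \<le> F u \<or> exp (Re \<alpha> * u - z * cosh u) \<le> F (- u)"
      by (simp add: F_def)
    moreover have "F u \<ge> 0" "F (- u) \<ge> 0" by (auto simp: F_def)
    ultimately show ?thesis by auto
  qed
  show ?thesis
  proof (rule Bochner_Integration.integrable_bound[OF Bochner_Integration.integrable_add[OF iF iF']])
    show "(\<lambda>u. exp (\<alpha> * of_real u - of_real (z * cosh u))) \<in> borel_measurable lborel"
      by (auto intro!: borel_measurable_continuous_onI continuous_intros simp: cosh_def)
    show "AE u in lborel. norm (exp (\<alpha> * of_real u - of_real (z * cosh u))) \<le> norm (F u + F (- u))"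
      by (rule AE_I2, simp only: real_norm_def, rule order.trans[OF bound abs_ge_self])
  qed
qed

text \<open>\<open>K_rem k \<alpha> z / z\<^sup>k\<close> is the remainder of the large-argument expansion of \<open>F\<^sub>\<alpha>\<close> after \<open>k\<close> terms.\<close>

definition K_rem :: "nat \<Rightarrow> complex \<Rightarrow> complex \<Rightarrow> complex" where
  "K_rem k \<alpha> z = cos (of_real pi * \<alpha>) / of_real (2 * pi * sqrt pi) * (- 1 / 2) ^ k *
     (\<integral>p. K_wt k \<alpha> p / (1 + of_real ((snd p)\<^sup>2) / (2 * z)) \<partial>(lborel \<Otimes>\<^sub>M lborel))"

lemma norm_Stieltjes_denom_ge_1:
  assumes "Re z > 0" "t \<ge> 0"
  shows "norm (1 + complex_of_real t / (2 * z)) \<ge> 1"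
proof -
  have "Re (complex_of_real t / (2 * z)) \<ge> 0"
    using assms by (simp add: Re_divide)
  then have "1 \<le> Re (1 + complex_of_real t / (2 * z))" by simp
  also have "\<dots> \<le> norm (1 + complex_of_real t / (2 * z))" by (rule complex_Re_le_cmod)
  finally show ?thesis .
qed

lemma norm_K_integrand_le:
  assumes "Re z > 0"
  shows "norm (K_wt k \<alpha> p / (1 + of_real ((snd p)\<^sup>2) / (2 * z))) \<le> norm (K_wt k \<alpha> p)"
proof -
  have "norm (K_wt k \<alpha> p) * 1 \<le> norm (K_wt k \<alpha> p) * norm (1 + of_real ((snd p)\<^sup>2) / (2 * z))"
    using norm_Stieltjes_denom_ge_1[OF assms, of "(snd p)\<^sup>2"] by (intro mult_left_mono) auto
  moreover have "norm (1 + of_real ((snd p)\<^sup>2) / (2 * z)) > 0"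
    using norm_Stieltjes_denom_ge_1[OF assms, of "(snd p)\<^sup>2"] by auto
  ultimately show ?thesis by (simp add: norm_divide divide_le_eq)
qed

lemma integrable_K_integrand:
  assumes "Re z > 0" "\<bar>Re \<alpha>\<bar> < real k + 1/2"
  shows "integrable (lborel \<Otimes>\<^sub>M lborel) (\<lambda>p. K_wt k \<alpha> p / (1 + of_real ((snd p)\<^sup>2) / (2 * z)))"
  by (rule Bochner_Integration.integrable_bound[OF integrable_K_wt[OF assms(2)]])
     (use norm_K_integrand_le[OF assms(1)] in auto)

lemma integral_norm_K_wt:
  assumes \<alpha>: "\<bar>Re \<alpha>\<bar> < real k + 1/2"
  shows "(\<integral>p. norm (K_wt k \<alpha> p) \<partial>(lborel \<Otimes>\<^sub>M lborel)) =
    2 * sqrt pi * Gamma (real k + 1/2 + Re \<alpha>) * Gamma (real k + 1/2 - Re \<alpha>) / fact k"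
proof -
  have \<alpha>': "\<bar>Re (of_real (Re \<alpha>))\<bar> < real k + 1/2" using \<alpha> by simp
  have "(\<integral>p. norm (K_wt k \<alpha> p) \<partial>(lborel \<Otimes>\<^sub>M lborel)) =
      Re (\<integral>p. K_wt k (of_real (Re \<alpha>)) p \<partial>(lborel \<Otimes>\<^sub>M lborel))"
    unfolding norm_K_wt by (rule integral_Re[OF integrable_K_wt[OF \<alpha>']])
  also have "\<dots> = Re (of_real (2 * sqrt pi * Gamma (real k + 1/2 + Re \<alpha>) * Gamma (real k + 1/2 - Re \<alpha>) / fact k))"
  proof -
    have "Gamma (of_nat k + 1/2 + of_real (Re \<alpha>)) = complex_of_real (Gamma (real k + 1/2 + Re \<alpha>))"
      "Gamma (of_nat k + 1/2 - of_real (Re \<alpha>)) = complex_of_real (Gamma (real k + 1/2 - Re \<alpha>))"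
      using Gamma_complex_of_real[of "real k + 1/2 + Re \<alpha>"] Gamma_complex_of_real[of "real k + 1/2 - Re \<alpha>"]
      by simp_all
    then show ?thesis unfolding integral_K_wt[OF \<alpha>'] by simp
  qed
  finally show ?thesis by (simp only: Re_complex_of_real)
qed

text \<open>The bound is the closed form of \<open>a_hat k \<alpha>\<close> (see
  \<open>a_hat_eq\<close>). It does not depend on z, so it also serves as a majorant in the Laplace
  integrals.\<close>

lemma norm_K_rem_le:
  assumes z: "Re z > 0" and \<alpha>: "\<bar>Re \<alpha>\<bar> < real k + 1/2"
  shows "norm (K_rem k \<alpha> z) \<le> norm (cos (of_real pi * \<alpha>)) *
    (Gamma (real k + 1/2 + Re \<alpha>) * Gamma (real k + 1/2 - Re \<alpha>) / (pi * 2 ^ k * fact k))"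
proof -
  have "norm (\<integral>p. K_wt k \<alpha> p / (1 + of_real ((snd p)\<^sup>2) / (2 * z)) \<partial>(lborel \<Otimes>\<^sub>M lborel))
      \<le> (\<integral>p. norm (K_wt k \<alpha> p) \<partial>(lborel \<Otimes>\<^sub>M lborel))"
    using norm_K_integrand_le[OF z] integrable_K_wt[OF \<alpha>]
    by (intro Bochner_Integration.integral_norm_bound_integral integrable_K_integrand assms) auto
  then have "norm (K_rem k \<alpha> z) \<le> norm (cos (of_real pi * \<alpha>)) / (2 * pi * sqrt pi) * (1 / 2) ^ k *
     (2 * sqrt pi * Gamma (real k + 1/2 + Re \<alpha>) * Gamma (real k + 1/2 - Re \<alpha>) / fact k)"
    unfolding K_rem_def integral_norm_K_wt[OF \<alpha>] norm_mult norm_divide norm_power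
    by (intro mult_mono) (simp_all add: norm_mult)
  also have "\<dots> = norm (cos (of_real pi * \<alpha>)) *
    (Gamma (real k + 1/2 + Re \<alpha>) * Gamma (real k + 1/2 - Re \<alpha>) / (pi * 2 ^ k * fact k))"
    by (simp add: power_one_over)
  finally show ?thesis .
qed

lemma K_rem_holomorphic:
  assumes \<alpha>: "\<bar>Re \<alpha>\<bar> < real k + 1/2"
  shows "K_rem k \<alpha> holomorphic_on {z. Re z > 0}"
proof -
  have "(\<lambda>z. \<integral>p. K_wt k \<alpha> p / (1 + of_real ((snd p)\<^sup>2) / (2 * z)) \<partial>(lborel \<Otimes>\<^sub>M lborel))
      holomorphic_on {z. Re z > 0}"
  proof (rule holomorphic_on_lebesgue_integral)
    show "open {z. Re z > 0}" by (rule open_halfspace_Re_gt)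
    show "(\<lambda>z. K_wt k \<alpha> p / (1 + of_real ((snd p)\<^sup>2) / (2 * z))) holomorphic_on {z. Re z > 0}" for p
    proof -
      have "1 + of_real ((snd p)\<^sup>2) / (2 * z) \<noteq> 0" if "Re z > 0" for z
        using norm_Stieltjes_denom_ge_1[OF that, of "(snd p)\<^sup>2"] by (metis norm_zero not_one_le_zero zero_le_power2)
      then show ?thesis by (intro holomorphic_intros) auto
    qed
    show "\<exists>r>0. \<exists>g. integrable (lborel \<Otimes>\<^sub>M lborel) g \<and> (\<forall>w\<in>ball z r \<inter> {z. Re z > 0}.
        \<forall>p\<in>space (lborel \<Otimes>\<^sub>M lborel). norm (K_wt k \<alpha> p / (1 + of_real ((snd p)\<^sup>2) / (2 * w))) \<le> g p)" for z
      using norm_K_integrand_le integrable_norm[OF integrable_K_wt[OF \<alpha>]]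
      by (intro exI[of _ 1] exI[of _ "\<lambda>p. norm (K_wt k \<alpha> p)"]) auto
  qed measurable
  then show ?thesis
    unfolding K_rem_def[abs_def] by (intro holomorphic_intros) simp_all
qed

text \<open>Prepares the identity theorem in the order, which leads out of the strip |Re \<alpha>| <
  1/2.\<close>

lemma K_rem_holomorphic_order:
  assumes z: "Re z > 0"
  shows "(\<lambda>\<alpha>. K_rem k \<alpha> z) holomorphic_on {\<alpha>. \<bar>Re \<alpha>\<bar> < real k + 1/2}"
proof -
  have open_strip: "open {\<alpha>. \<bar>Re \<alpha>\<bar> < real k + 1/2}"
    by (intro open_Collect_less continuous_intros)
  have "(\<lambda>\<alpha>. \<integral>p. K_wt k \<alpha> p / (1 + of_real ((snd p)\<^sup>2) / (2 * z)) \<partial>(lborel \<Otimes>\<^sub>M lborel))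
      holomorphic_on {\<alpha>. \<bar>Re \<alpha>\<bar> < real k + 1/2}"
  proof (rule holomorphic_on_lebesgue_integral[OF open_strip])
    show "(\<lambda>\<alpha>. K_wt k \<alpha> p / (1 + of_real ((snd p)\<^sup>2) / (2 * z))) holomorphic_on {\<alpha>. \<bar>Re \<alpha>\<bar> < real k + 1/2}" for p
      unfolding K_wt_def divide_inverse by (intro holomorphic_intros)
    fix \<alpha>0 :: complex assume "\<alpha>0 \<in> {\<alpha>. \<bar>Re \<alpha>\<bar> < real k + 1/2}"
    then have \<alpha>0: "\<bar>Re \<alpha>0\<bar> < real k + 1/2" by simp
    \<comment> \<open>Halfway from |Re \<alpha>0| to the edge of the strip: the weights at A and -A
      are still integrable, and their sum dominates the weight on the whole ball.\<close>
    define A where "A = (\<bar>Re \<alpha>0\<bar> + (real k + 1/2)) / 2"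
    have A: "\<bar>Re \<alpha>0\<bar> < A" "A < real k + 1/2" "A \<ge> 0" using \<alpha>0 by (auto simp: A_def field_simps)
    define G where "G p = norm (K_wt k (of_real A) p) + norm (K_wt k (of_real (- A)) p)" for p
    have iG: "integrable (lborel \<Otimes>\<^sub>M lborel) G"
      unfolding G_def[abs_def] using A
      by (intro Bochner_Integration.integrable_add integrable_norm integrable_K_wt) auto
    have "norm (K_wt k \<alpha> p / (1 + of_real ((snd p)\<^sup>2) / (2 * z))) \<le> G p" if "\<alpha> \<in> ball \<alpha>0 (A - \<bar>Re \<alpha>0\<bar>)" for \<alpha> p
    proof -
      have "\<bar>Re (\<alpha>0 - \<alpha>)\<bar> \<le> norm (\<alpha>0 - \<alpha>)" by (rule abs_Re_le_cmod)
      then have "\<bar>Re \<alpha>\<bar> \<le> A" using that by (auto simp: dist_norm)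
      then have "exp (Re \<alpha> * fst p) \<le> exp (A * fst p) + exp (- A * fst p)"
        by (rule exp_real_le_exp_sum)
      then have "exp (Re \<alpha> * fst p) * norm (complex_of_real (snd p ^ (2 * k) * exp (- (cosh (fst p / 2) * snd p)\<^sup>2)))
         \<le> (exp (A * fst p) + exp (- A * fst p)) * norm (complex_of_real (snd p ^ (2 * k) * exp (- (cosh (fst p / 2) * snd p)\<^sup>2)))"
        by (rule mult_right_mono) simp
      then have "norm (K_wt k \<alpha> p) \<le> G p"
        by (simp add: G_def K_wt_def norm_mult distrib_right)
      then show ?thesis using norm_K_integrand_le[OF z] order.trans by blast
    qed
    then show "\<exists>r>0. \<exists>g. integrable (lborel \<Otimes>\<^sub>M lborel) g \<and> (\<forall>w\<in>ball \<alpha>0 r \<inter> {\<alpha>. \<bar>Re \<alpha>\<bar> < real k + 1/2}.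
        \<forall>p\<in>space (lborel \<Otimes>\<^sub>M lborel). norm (K_wt k w p / (1 + of_real ((snd p)\<^sup>2) / (2 * z))) \<le> g p)"
      using A iG by (intro exI[of _ "A - \<bar>Re \<alpha>0\<bar>"] exI[of _ G] conjI) auto
  qed measurable
  then show ?thesis
    unfolding K_rem_def[abs_def] by (intro holomorphic_intros) simp_all
qed

text \<open>The geometric step 1/(1 + w) = 1 - w/(1 + w) with w = y^2/(2z): multiplying the weight
  of order k by 2zw gives the weight of order k + 1.\<close>

lemma K_rem_Suc:
  assumes z: "Re z > 0" and \<alpha>: "\<bar>Re \<alpha>\<bar> < real k + 1/2"
  shows "K_rem k \<alpha> z = a_coeff k \<alpha> + K_rem (Suc k) \<alpha> z / z"
proof -
  have \<alpha>': "\<bar>Re \<alpha>\<bar> < real (Suc k) + 1/2" using \<alpha> by simp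
  have nz: "z \<noteq> 0" using z by auto
  have split: "K_wt k \<alpha> p / (1 + of_real ((snd p)\<^sup>2) / (2 * z)) =
     K_wt k \<alpha> p - (1 / (2 * z)) * (K_wt (Suc k) \<alpha> p / (1 + of_real ((snd p)\<^sup>2) / (2 * z)))" for p
  proof -
    define w where "w = of_real ((snd p)\<^sup>2) / (2 * z)"
    have w: "1 + w \<noteq> 0"
      using norm_Stieltjes_denom_ge_1[OF z, of "(snd p)\<^sup>2"] unfolding w_def
      by (metis norm_zero not_one_le_zero zero_le_power2)
    have "K_wt (Suc k) \<alpha> p = 2 * z * (K_wt k \<alpha> p * w)"
      using nz by (simp add: K_wt_def w_def power2_eq_square)
    then have "(1 / (2 * z)) * (K_wt (Suc k) \<alpha> p / (1 + w)) = K_wt k \<alpha> p * w / (1 + w)"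
      using nz by simp
    moreover have "K_wt k \<alpha> p / (1 + w) = K_wt k \<alpha> p - K_wt k \<alpha> p * w / (1 + w)"
      using w by (simp add: field_simps)
    ultimately show ?thesis unfolding w_def[symmetric] by simp
  qed
  let ?I = "\<lambda>k. \<integral>p. K_wt k \<alpha> p / (1 + of_real ((snd p)\<^sup>2) / (2 * z)) \<partial>(lborel \<Otimes>\<^sub>M lborel)"
  have "?I k = integral\<^sup>L (lborel \<Otimes>\<^sub>M lborel) (K_wt k \<alpha>) - (1 / (2 * z)) * ?I (Suc k)"
    unfolding split[abs_def]
    by (simp only: Bochner_Integration.integral_diff[OF integrable_K_wt[OF \<alpha>]
          integrable_mult_right[OF integrable_K_integrand[OF z \<alpha>']]] integral_mult_right_zero)
  \<comment> \<open>This fixes the constant in \<open>K_rem\<close>: it cancels the factor 2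
    sqrt(pi) of the total mass and the pi of the reflection formula.\<close>
  moreover have "cos (of_real pi * \<alpha>) / of_real (2 * pi * sqrt pi) * (- 1 / 2) ^ k *
      integral\<^sup>L (lborel \<Otimes>\<^sub>M lborel) (K_wt k \<alpha>) = a_coeff k \<alpha>"
  proof -
    have "cos (of_real pi * \<alpha>) / of_real (2 * pi * sqrt pi) * (- 1 / 2) ^ k *
      integral\<^sup>L (lborel \<Otimes>\<^sub>M lborel) (K_wt k \<alpha>) =
      (cos (of_real pi * \<alpha>) * (Gamma (of_nat k + 1/2 + \<alpha>) * Gamma (of_nat k + 1/2 - \<alpha>))) / of_real pi *
       (- 1 / 2) ^ k / fact k"
      unfolding integral_K_wt[OF \<alpha>] by (simp add: divide_simps)
    also have "\<dots> = a_coeff k \<alpha>"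
      unfolding cos_mult_Gamma_mult_Gamma[OF \<alpha>] a_coeff_def
      using power_one_over[of "-2::complex" k] by simp
    finally show ?thesis .
  qed
  ultimately show ?thesis
    by (simp add: K_rem_def right_diff_distrib)
qed

lemma K_rem_expand:
  assumes z: "Re z > 0" and \<alpha>: "\<bar>Re \<alpha>\<bar> < 1/2"
  shows "K_rem 0 \<alpha> z = (\<Sum>l<N. a_coeff l \<alpha> / z ^ l) + K_rem N \<alpha> z / z ^ N"
proof (induction N)
  case (Suc N)
  have "\<bar>Re \<alpha>\<bar> < real N + 1/2" using \<alpha> by simp
  from K_rem_Suc[OF z this] Suc show ?case by (simp add: add_divide_distrib)
qed simp

section \<open>The remainder of order zero is the Bessel function itself\<close>

text \<open>The beta integral with a + b = 1, translated by u. It is used backwards, to write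
  exp(\<alpha> u) as a superposition over v of the kernel; this absorbs the cosine in
  \<open>K_rem\<close>.\<close>

lemma Fourier_sech:
  assumes \<alpha>: "\<bar>Re \<alpha>\<bar> < 1/2"
  shows "integrable lborel (\<lambda>v. exp (\<alpha> * of_real v) * of_real (1 / (2 * cosh ((v - u) / 2))))"
    and "cos (of_real pi * \<alpha>) * (\<integral>v. exp (\<alpha> * of_real v) * of_real (1 / (2 * cosh ((v - u) / 2))) \<partial>lborel)
          = of_real pi * exp (\<alpha> * of_real u)"
proof -
  define a b where "a = 1/2 + \<alpha>" and "b = 1/2 - \<alpha>"
  have ab: "Re a > 0" "Re b > 0" using \<alpha> by (auto simp: a_def b_def)
  have sum: "a + b = 1" and diff: "a - b = 2 * \<alpha>" by (auto simp: a_def b_def)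
  define f where "f v = exp (\<alpha> * of_real v) * of_real (1 / (2 * cosh (v / 2)))" for v :: real
  define h where "h v = exp (\<alpha> * of_real v) * of_real (1 / (2 * cosh ((v - u) / 2)))" for v :: real
  have f_eq: "f v = exp ((a - b) * of_real (v / 2) - (a + b) * of_real (ln (2 * cosh (v / 2))))" for v
  proof -
    have "exp (complex_of_real (ln (2 * cosh (v / 2)))) = of_real (2 * cosh (v / 2))"
      by (simp only: exp_of_real) simp
    then show ?thesis unfolding sum diff f_def by (simp add: exp_diff)
  qed
  have f: "integrable lborel f" "integral\<^sup>L lborel f = Gamma a * Gamma b"
    using integrable_Beta_cosh[OF ab] integral_Beta_cosh[OF ab] unfolding f_eq[abs_def] sum by simp_all
  have h_eq: "h v = exp (\<alpha> * of_real u) * f (v + - u)" for v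
  proof -
    have "exp (\<alpha> * of_real u) * exp (\<alpha> * of_real (v + - u)) = exp (\<alpha> * of_real v)"
      by (simp add: exp_add[symmetric] algebra_simps)
    then show ?thesis by (simp add: h_def f_def mult.assoc[symmetric])
  qed
  show "integrable lborel (\<lambda>v. exp (\<alpha> * of_real v) * of_real (1 / (2 * cosh ((v - u) / 2))))"
    unfolding h_def[symmetric] h_eq[abs_def]
    by (intro integrable_mult_right integrable_translate[THEN iffD2] f)
  have "cos (of_real pi * \<alpha>) * (Gamma a * Gamma b) = of_real pi"
    using cos_mult_Gamma_mult_Gamma[of \<alpha> 0] \<alpha> by (simp add: a_def b_def)
  then show "cos (of_real pi * \<alpha>) * (\<integral>v. exp (\<alpha> * of_real v) * of_real (1 / (2 * cosh ((v - u) / 2))) \<partial>lborel)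
          = of_real pi * exp (\<alpha> * of_real u)"
    unfolding h_def[symmetric] h_eq[abs_def] integral_mult_right_zero integral_translate f(2)
    by (simp add: mult_ac)
qed

text \<open>Adds the kernel to its reflection in u. Here cosh((v - u)/2) cosh((v + u)/2) = (cosh u +
  cosh v)/2, and the sum of the two factors is 2 cosh(u/2) cosh(v/2).\<close>

lemma sech_symmetrize:
  fixes u v :: real
  shows "1 / (2 * cosh ((v - u) / 2)) + 1 / (2 * cosh ((v + u) / 2)) =
    2 * (cosh (u / 2) * cosh (v / 2) / (cosh u + cosh v))"
proof -
  define p q where "p = u / 2" and "q = v / 2"
  have uv: "(v - u) / 2 = q - p" "(v + u) / 2 = q + p" "u = 2 * p" "v = 2 * q"
    by (auto simp: p_def q_def diff_divide_distrib add_divide_distrib)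
  have s: "(sinh p)\<^sup>2 = (cosh p)\<^sup>2 - 1" "(sinh q)\<^sup>2 = (cosh q)\<^sup>2 - 1"
    by (auto simp: sinh_square_eq)
  have "cosh (q - p) * cosh (q + p) = (cosh q * cosh p)\<^sup>2 - (sinh q * sinh p)\<^sup>2"
    by (simp add: cosh_add cosh_diff power2_eq_square algebra_simps)
  also have "\<dots> = (cosh p)\<^sup>2 + (cosh q)\<^sup>2 - 1"
    by (simp add: power_mult_distrib s algebra_simps)
  finally have prod: "2 * (cosh (q - p) * cosh (q + p)) = cosh (2 * p) + cosh (2 * q)"
    by (simp add: cosh_double_cosh)
  have sum: "cosh (q - p) + cosh (q + p) = 2 * (cosh p * cosh q)"
    by (simp add: cosh_add cosh_diff)
  have pos: "cosh (q - p) > 0" "cosh (q + p) > 0" by simp_all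
  have "1 / (2 * cosh (q - p)) + 1 / (2 * cosh (q + p)) =
    (cosh (q - p) + cosh (q + p)) / (2 * (cosh (q - p) * cosh (q + p)))"
    using pos by (simp add: field_simps)
  also have "\<dots> = 2 * (cosh p * cosh q / (cosh (2 * p) + cosh (2 * q)))"
    unfolding prod sum by simp
  finally show ?thesis by (simp add: p_def q_def diff_divide_distrib add_divide_distrib)
qed

text \<open>The substitution y = sqrt(2z) sinh(u/2)/cosh(v/2) turns the Gaussian into exp(z - z cosh
  u) and the denominator into (cosh u + cosh v)/(2 cosh(v/2)^2). Since exp(-z cosh u) is even, the
  resulting symmetric kernel may be replaced by a single sech.\<close>

lemma integral_Stieltjes_gaussian:
  fixes v z :: real
  assumes z: "z > 0"
  shows "(\<integral>y. exp (- (cosh (v / 2) * y)\<^sup>2) / (1 + y\<^sup>2 / (2 * z)) \<partial>lborel) =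
    sqrt (2 * z) * exp z * (\<integral>u. exp (- (z * cosh u)) * (1 / (2 * cosh ((v - u) / 2))) \<partial>lborel)"
proof -
  define c where "c = cosh (v / 2)"
  have c: "c > 0" by (simp add: c_def)
  define f where "f y = exp (- (c * y)\<^sup>2) / (1 + y\<^sup>2 / (2 * z))" for y
  define E where "E u = exp (- (z * cosh u))" for u :: real
  define S where "S u = 1 / (2 * cosh ((v - u) / 2))" for u :: real
  have pos: "1 + y\<^sup>2 / (2 * z) \<ge> 1" for y using z by simp
  have "integrable lborel (\<lambda>y. exp (- (c * y)\<^sup>2))"
    using has_bochner_integral_gaussian_moment_scaled[OF c, of 0] by (auto simp: has_bochner_integral_iff)
  then have f: "integrable lborel f"
  proof (rule Bochner_Integration.integrable_bound)
    have "continuous_on UNIV f"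
      unfolding f_def[abs_def] using z by (intro continuous_intros) (auto simp: add_nonneg_eq_0_iff)
    then show "f \<in> borel_measurable lborel" by (simp add: borel_measurable_continuous_onI)
    have "norm (f y) \<le> norm (exp (- (c * y)\<^sup>2))" for y
      using pos[of y] by (auto simp: f_def divide_le_eq)
    then show "AE y in lborel. norm (f y) \<le> norm (exp (- (c * y)\<^sup>2))" by simp
  qed
  define g where "g u = sqrt (2 * z) * sinh (u / 2) / c" for u
  define g' where "g' u = sqrt (2 * z) * cosh (u / 2) / (2 * c)" for u
  have "(\<integral>u. g' u *\<^sub>R f (g u) \<partial>lborel) = (\<integral>y. f y \<partial>lborel)"
  proof (rule lborel_integral_substitution)
    show "(g has_field_derivative g' u) (at u)" for u
      unfolding g_def g'_def using c by (auto intro!: derivative_eq_intros)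
    show "g' u > 0" for u using z c by (simp add: g'_def)
    have "g (2 * arsinh (c * y / sqrt (2 * z))) = y" for y
      using z c by (simp add: g_def)
    then show "surj g" by (metis surj_def)
    have "continuous_on UNIV g'"
      unfolding g'_def[abs_def] using c by (intro continuous_intros) auto
    then show "g' \<in> borel_measurable borel" by (rule borel_measurable_continuous_onI)
  qed (rule f)
  moreover have "g' u *\<^sub>R f (g u) = sqrt (2 * z) * exp z * (E u * (cosh (u / 2) * cosh (v / 2) / (cosh u + cosh v)))" for u
  proof -
    have sq: "(sqrt (2 * z))\<^sup>2 = 2 * z" using z by simp
    have ch: "cosh u = 2 * (sinh (u / 2))\<^sup>2 + 1" "cosh v = 2 * c\<^sup>2 - 1"
      using cosh_double_cosh[of "u / 2"] cosh_double_cosh[of "v / 2"] by (simp_all add: c_def sinh_square_eq)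
    have "- (c * g u)\<^sup>2 = z - z * cosh u"
      using c z by (simp add: g_def power_mult_distrib sq ch(1) algebra_simps)
    then have 1: "exp (- (c * g u)\<^sup>2) = exp z * E u"
      by (simp add: E_def exp_diff exp_minus divide_inverse)
    have "1 + (g u)\<^sup>2 / (2 * z) = (cosh u + cosh v) / (2 * c\<^sup>2)"
      using c z by (simp add: g_def power_mult_distrib power_divide sq ch) (simp add: field_simps)
    then have "f (g u) = exp z * E u / ((cosh u + cosh v) / (2 * c\<^sup>2))"
      by (simp only: f_def 1)
    then have "f (g u) = exp z * E u * (2 * c\<^sup>2) / (cosh u + cosh v)" by simp
    then show ?thesis
      using c by (simp only: g'_def c_def[symmetric] real_scaleR_def) (simp add: power2_eq_square)
  qed
  ultimately have sub: "(\<integral>y. f y \<partial>lborel) = sqrt (2 * z) * exp z *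
     (\<integral>u. E u * (cosh (u / 2) * cosh (v / 2) / (cosh u + cosh v)) \<partial>lborel)"
    by (simp only: integral_mult_right_zero)
  have ES: "integrable lborel (\<lambda>u. E u * S u)"
  proof (rule Bochner_Integration.integrable_bound)
    have "integrable lborel (\<lambda>u. norm (exp (0 * of_real u - complex_of_real (z * cosh u))))"
      by (intro integrable_norm integrable_exp_cosh z)
    then show "integrable lborel E" by (simp add: E_def[abs_def])
    have "continuous_on UNIV (\<lambda>u. E u * S u)"
      unfolding E_def S_def by (intro continuous_intros) (auto simp: less_imp_neq[symmetric])
    then show "(\<lambda>u. E u * S u) \<in> borel_measurable lborel" by (simp add: borel_measurable_continuous_onI)
    have "norm (E u * S u) \<le> norm (E u)" for u
    proof -
      have "\<bar>S u\<bar> \<le> 1" using cosh_real_ge_1[of "(v - u) / 2"] by (simp add: S_def)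
      then show ?thesis by (simp add: abs_mult mult_left_le)
    qed
    then show "AE u in lborel. norm (E u * S u) \<le> norm (E u)" by simp
  qed
  have E_even: "E (- u) = E u" for u by (simp add: E_def)
  have ES': "integrable lborel (\<lambda>u. E u * S (- u))"
    using lborel_integrable_real_affine[OF ES, of "-1" 0] by (simp add: E_even)
  have "(\<integral>u. E u * S (- u) \<partial>lborel) = (\<integral>u. E u * S u \<partial>lborel)"
    using lborel_integral_real_affine[of "-1" "\<lambda>u. E u * S u" 0] by (simp add: E_even)
  then have "2 * (\<integral>u. E u * S u \<partial>lborel) = (\<integral>u. E u * S u + E u * S (- u) \<partial>lborel)"
    using ES ES' by simp
  also have "\<dots> = (\<integral>u. 2 * (E u * (cosh (u / 2) * cosh (v / 2) / (cosh u + cosh v))) \<partial>lborel)"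
  proof (rule Bochner_Integration.integral_cong[OF refl])
    fix u
    have "E u * S u + E u * S (- u) = E u * (1 / (2 * cosh ((v - u) / 2)) + 1 / (2 * cosh ((v + u) / 2)))"
      by (simp add: S_def distrib_left)
    then show "E u * S u + E u * S (- u) = 2 * (E u * (cosh (u / 2) * cosh (v / 2) / (cosh u + cosh v)))"
      unfolding sech_symmetrize by simp
  qed
  also have "\<dots> = 2 * (\<integral>u. E u * (cosh (u / 2) * cosh (v / 2) / (cosh u + cosh v)) \<partial>lborel)"
    by (rule integral_mult_right_zero)
  finally show ?thesis
    using sub unfolding f_def E_def S_def c_def by simp
qed

text \<open>Twice the modified Bessel function \<open>K_\<alpha>(z)\<close>; the doubling is why the
  prefactor below is sqrt(z/(2 pi)) and not sqrt(2z/pi).\<close>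

definition K_int :: "complex \<Rightarrow> real \<Rightarrow> complex" where
  "K_int \<alpha> z = (\<integral>u. exp (\<alpha> * of_real u - of_real (z * cosh u)) \<partial>lborel)"

text \<open>\<open>integral_Stieltjes_gaussian\<close> rewrites the y-integral as one over u; after
  exchanging u and v, \<open>Fourier_sech\<close> evaluates the v-integral and the cosine
  disappears.\<close>

lemma K_rem_0_eq:
  fixes z :: real
  assumes z: "z > 0" and \<alpha>: "\<bar>Re \<alpha>\<bar> < 1/2"
  shows "K_rem 0 \<alpha> (of_real z) = of_real (sqrt (z / (2 * pi)) * exp z) * K_int \<alpha> z"
proof -
  have \<alpha>0: "\<bar>Re \<alpha>\<bar> < real 0 + 1/2" using \<alpha> by simp
  have z': "Re (complex_of_real z) > 0" using z by simp
  define E where "E u = exp (- (z * cosh u))" for u :: real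
  define S where "S v u = 1 / (2 * cosh ((v - u) / 2))" for v u :: real
  define P where "P \<alpha> u = (\<integral>v. exp (\<alpha> * of_real v) * of_real (S v u) \<partial>lborel)" for \<alpha> :: complex and u
  have Pc: "cos (of_real pi * \<alpha>) * P \<alpha> u = of_real pi * exp (\<alpha> * of_real u)" if "\<bar>Re \<alpha>\<bar> < 1/2" for \<alpha> u
    unfolding P_def S_def by (rule Fourier_sech[OF that])
  \<comment> \<open>At u = 0 the right-hand side of \<open>Pc\<close> is pi, so the cosine cannot
    vanish.\<close>
  have cosnz: "cos (of_real pi * \<alpha>) \<noteq> 0" if "\<bar>Re \<alpha>\<bar> < 1/2" for \<alpha>
    using Pc[OF that, of 0] by auto
  define f where "f u v = exp (\<alpha> * of_real v) * of_real (E u * S v u)" for u v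
  have kint: "integrable lborel (\<lambda>u. exp (\<alpha> * of_real u) * of_real (E u))" for \<alpha> :: complex
  proof -
    have "exp (\<alpha> * of_real u - of_real (z * cosh u)) = exp (\<alpha> * of_real u) * complex_of_real (E u)" for u
      by (simp add: E_def exp_diff exp_minus exp_of_real[symmetric] divide_inverse)
    then show ?thesis using integrable_exp_cosh[OF z, of \<alpha>] by simp
  qed
  have kval: "(\<integral>u. exp (\<alpha> * of_real u) * of_real (E u) \<partial>lborel) = K_int \<alpha> z"
  proof -
    have "exp (\<alpha> * of_real u - of_real (z * cosh u)) = exp (\<alpha> * of_real u) * complex_of_real (E u)" for u
      by (simp add: E_def exp_diff exp_minus exp_of_real[symmetric] divide_inverse)
    then show ?thesis by (simp add: K_int_def)
  qed
  have finner: "(\<integral>v. f u v \<partial>lborel) = of_real (E u) * P \<alpha> u" for u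
  proof -
    have "f u v = of_real (E u) * (exp (\<alpha> * of_real v) * of_real (S v u))" for v
      by (simp add: f_def)
    then show ?thesis by (simp add: P_def)
  qed
  have pair: "integrable (lborel \<Otimes>\<^sub>M lborel) (case_prod f)"
  proof (rule lborel_pair.Fubini_integrable)
    have "continuous_on UNIV (case_prod f)"
      unfolding f_def E_def S_def case_prod_unfold cosh_def
      by (intro continuous_intros) (auto simp: add_pos_pos less_imp_neq[symmetric])
    then show "case_prod f \<in> borel_measurable (lborel \<Otimes>\<^sub>M lborel)"
      by (simp add: lborel_prod borel_measurable_continuous_onI)
    have r: "\<bar>Re (of_real (Re \<alpha>))\<bar> < 1/2" using \<alpha> by simp
    \<comment> \<open>The modulus of \<open>f\<close> is \<open>f\<close> at Re \<alpha>, whose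
      v-integral is pi/D times an exponential in u and \<open>E u\<close>; hence the need for D to
      be nonzero.\<close>
    define D where "D = cos (of_real pi * complex_of_real (Re \<alpha>))"
    have D: "D \<noteq> 0" unfolding D_def by (rule cosnz[OF r])
    have "complex_of_real (\<integral>v. norm (f u v) \<partial>lborel) = of_real pi / D * (exp (of_real (Re \<alpha>) * of_real u) * of_real (E u))" for u
    proof -
      have "complex_of_real (\<integral>v. norm (f u v) \<partial>lborel) = (\<integral>v. of_real (norm (f u v)) \<partial>lborel)"
        by (rule integral_complex_of_real[symmetric])
      also have "\<dots> = (\<integral>v. of_real (E u) * (exp (of_real (Re \<alpha>) * of_real v) * of_real (S v u)) \<partial>lborel)"
      proof (rule Bochner_Integration.integral_cong[OF refl])
        fix v
        have "norm (f u v) = exp (Re \<alpha> * v) * (E u * S v u)"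
          by (simp add: f_def norm_mult norm_divide E_def S_def)
        then show "complex_of_real (norm (f u v)) = of_real (E u) * (exp (of_real (Re \<alpha>) * of_real v) * of_real (S v u))"
          by (simp add: exp_of_real[symmetric])
      qed
      also have "\<dots> = of_real (E u) * P (of_real (Re \<alpha>)) u"
        by (simp only: integral_mult_right_zero P_def)
      finally show ?thesis using Pc[OF r, of u] D by (simp add: D_def[symmetric] field_simps)
    qed
    then have "integrable lborel (\<lambda>u. complex_of_real (\<integral>v. norm (f u v) \<partial>lborel))"
      by (simp only:) (intro integrable_mult_right kint)
    then have "integrable lborel (\<lambda>u. Re (complex_of_real (\<integral>v. norm (f u v) \<partial>lborel)))"
      by (rule integrable_Re)
    then show "integrable lborel (\<lambda>u. \<integral>v. norm (case (u, v) of (x, xa) \<Rightarrow> f x xa) \<partial>lborel)"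
      by (simp only: Re_complex_of_real case_prod_conv)
    have "integrable lborel (\<lambda>v. f u v)" for u
    proof -
      have "f u v = of_real (E u) * (exp (\<alpha> * of_real v) * of_real (1 / (2 * cosh ((v - u) / 2))))" for v
        by (simp add: f_def S_def)
      then show ?thesis by (simp only:) (intro integrable_mult_right Fourier_sech[OF \<alpha>])
    qed
    then show "AE u in lborel. integrable lborel (\<lambda>v. case (u, v) of (x, xa) \<Rightarrow> f x xa)" by simp
  qed
  have "(\<integral>p. K_wt 0 \<alpha> p / (1 + of_real ((snd p)\<^sup>2) / (2 * of_real z)) \<partial>(lborel \<Otimes>\<^sub>M lborel)) =
     (\<integral>v. \<integral>y. K_wt 0 \<alpha> (v, y) / (1 + of_real (y\<^sup>2) / (2 * of_real z)) \<partial>lborel \<partial>lborel)"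
    using lborel_pair.integral_fst'[OF integrable_K_integrand[OF z' \<alpha>0]] by simp
  also have "\<dots> = (\<integral>v. of_real (sqrt (2 * z) * exp z) * (\<integral>u. f u v \<partial>lborel) \<partial>lborel)"
  proof (rule Bochner_Integration.integral_cong[OF refl])
    fix v :: real
    have "K_wt 0 \<alpha> (v, y) / (1 + of_real (y\<^sup>2) / (2 * of_real z)) =
       exp (\<alpha> * of_real v) * of_real (exp (- (cosh (v / 2) * y)\<^sup>2) / (1 + y\<^sup>2 / (2 * z)))" for y
      by (simp add: K_wt_def)
    then have "(\<integral>y. K_wt 0 \<alpha> (v, y) / (1 + of_real (y\<^sup>2) / (2 * of_real z)) \<partial>lborel) =
       exp (\<alpha> * of_real v) * of_real (sqrt (2 * z) * exp z * (\<integral>u. E u * S v u \<partial>lborel))"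
      unfolding E_def S_def integral_Stieltjes_gaussian[OF z, symmetric]
      by (simp only: integral_mult_right_zero integral_complex_of_real)
    also have "\<dots> = of_real (sqrt (2 * z) * exp z) * (\<integral>u. f u v \<partial>lborel)"
      unfolding f_def by (simp only: integral_mult_right_zero integral_complex_of_real) simp
    finally show "(\<integral>y. K_wt 0 \<alpha> (v, y) / (1 + of_real (y\<^sup>2) / (2 * of_real z)) \<partial>lborel) =
       of_real (sqrt (2 * z) * exp z) * (\<integral>u. f u v \<partial>lborel)" .
  qed
  also have "\<dots> = of_real (sqrt (2 * z) * exp z) * (\<integral>u. \<integral>v. f u v \<partial>lborel \<partial>lborel)"
    by (simp only: integral_mult_right_zero lborel_pair.Fubini_integral[OF pair])
  finally have int: "(\<integral>p. K_wt 0 \<alpha> p / (1 + of_real ((snd p)\<^sup>2) / (2 * of_real z)) \<partial>(lborel \<Otimes>\<^sub>M lborel)) =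
     of_real (sqrt (2 * z) * exp z) * (\<integral>u. of_real (E u) * P \<alpha> u \<partial>lborel)"
    by (simp only: finner)
  have "cos (of_real pi * \<alpha>) * (\<integral>u. of_real (E u) * P \<alpha> u \<partial>lborel) =
      (\<integral>u. cos (of_real pi * \<alpha>) * (of_real (E u) * P \<alpha> u) \<partial>lborel)"
    by (simp only: integral_mult_right_zero)
  also have "\<dots> = (\<integral>u. of_real pi * (exp (\<alpha> * of_real u) * of_real (E u)) \<partial>lborel)"
  proof (rule Bochner_Integration.integral_cong[OF refl])
    fix u
    have "cos (of_real pi * \<alpha>) * (of_real (E u) * P \<alpha> u) = of_real (E u) * (cos (of_real pi * \<alpha>) * P \<alpha> u)"
      by simp
    then show "cos (of_real pi * \<alpha>) * (of_real (E u) * P \<alpha> u) = of_real pi * (exp (\<alpha> * of_real u) * of_real (E u))"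
      unfolding Pc[OF \<alpha>] by simp
  qed
  also have "\<dots> = of_real pi * K_int \<alpha> z"
    by (simp only: integral_mult_right_zero kval)
  finally have c: "cos (of_real pi * \<alpha>) * (\<integral>u. of_real (E u) * P \<alpha> u \<partial>lborel) = of_real pi * K_int \<alpha> z" .
  have "K_rem 0 \<alpha> (of_real z) = of_real (sqrt (2 * z) * exp z / (2 * pi * sqrt pi)) *
     (cos (of_real pi * \<alpha>) * (\<integral>u. of_real (E u) * P \<alpha> u \<partial>lborel))"
    unfolding K_rem_def int by simp
  also have "\<dots> = of_real (sqrt (2 * z) * exp z / (2 * pi * sqrt pi) * pi) * K_int \<alpha> z"
    unfolding c by simp
  also have "sqrt (2 * z) * exp z / (2 * pi * sqrt pi) * pi = sqrt (z / (2 * pi)) * exp z"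
    using z by (simp add: real_sqrt_divide real_sqrt_mult field_simps)
  finally show ?thesis .
qed

lemma K_int_holomorphic:
  assumes z: "z > 0"
  shows "(\<lambda>\<alpha>. K_int \<alpha> z) holomorphic_on UNIV"
  unfolding K_int_def
proof (rule holomorphic_on_lebesgue_integral)
  show "(\<lambda>u. exp (\<alpha> * of_real u - of_real (z * cosh u))) \<in> borel_measurable lborel" for \<alpha> :: complex
    using integrable_exp_cosh[OF z, of \<alpha>] by simp
  show "(\<lambda>\<alpha>. exp (\<alpha> * of_real u - of_real (z * cosh u))) holomorphic_on UNIV" for u :: real
    by (intro holomorphic_intros)
  fix \<alpha>0 :: complex
  define A where "A = \<bar>Re \<alpha>0\<bar> + 1"
  define G where "G u = norm (exp (complex_of_real A * of_real u - of_real (z * cosh u))) +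
     norm (exp (complex_of_real (- A) * of_real u - of_real (z * cosh u)))" for u
  have iG: "integrable lborel G"
    unfolding G_def[abs_def] by (intro Bochner_Integration.integrable_add integrable_norm integrable_exp_cosh z)
  have "norm (exp (\<alpha> * of_real u - of_real (z * cosh u))) \<le> G u" if "\<alpha> \<in> ball \<alpha>0 1" for \<alpha> u
  proof -
    have "\<bar>Re (\<alpha>0 - \<alpha>)\<bar> \<le> norm (\<alpha>0 - \<alpha>)" by (rule abs_Re_le_cmod)
    then have "\<bar>Re \<alpha>\<bar> \<le> A" using that by (auto simp: dist_norm A_def)
    then have "exp (Re \<alpha> * u) \<le> exp (A * u) + exp (- A * u)"
      by (rule exp_real_le_exp_sum)
    then have "exp (Re \<alpha> * u) / exp (z * cosh u) \<le> (exp (A * u) + exp (- A * u)) / exp (z * cosh u)"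
      by (rule divide_right_mono) simp
    then show ?thesis by (simp add: G_def exp_diff add_divide_distrib norm_divide)
  qed
  then show "\<exists>r>0. \<exists>g. integrable lborel g \<and> (\<forall>\<alpha>\<in>ball \<alpha>0 r \<inter> UNIV. \<forall>u\<in>space lborel.
      norm (exp (\<alpha> * of_real u - of_real (z * cosh u))) \<le> g u)"
    using iG by (intro exI[of _ 1] exI[of _ G]) auto
qed simp

text \<open>For \<open>|Re \<alpha>| < 1/2\<close> the Stieltjes representation of \<open>F\<^sub>\<alpha>\<close> gives the expansion; both sides are
  holomorphic in \<open>\<alpha>\<close> on the wider strip.\<close>

lemma K_int_expand:
  fixes z :: real
  assumes z: "z > 0" and \<alpha>: "\<bar>Re \<alpha>\<bar> < real N + 1/2"
  shows "of_real (sqrt (z / (2 * pi)) * exp z) * K_int \<alpha> z =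
    (\<Sum>l<N. a_coeff l \<alpha> / of_real z ^ l) + K_rem N \<alpha> (of_real z) / of_real z ^ N"
proof -
  have z': "Re (complex_of_real z) > 0" using z by simp
  have strip: "{\<alpha>. \<bar>Re \<alpha>\<bar> < r} = {\<alpha>. Re \<alpha> < r} \<inter> {\<alpha>. Re \<alpha> > - r}" for r :: real
    by auto
  have "open {\<alpha>. \<bar>Re \<alpha>\<bar> < r}" "connected {\<alpha>. \<bar>Re \<alpha>\<bar> < r}" for r :: real
    unfolding strip by (auto intro!: open_Int open_halfspace_Re_gt open_halfspace_Re_lt
        convex_connected convex_Int convex_halfspace_Re_gt convex_halfspace_Re_lt)
  note strip_props = this
  show ?thesis
  proof (rule analytic_continuation_open[where s="{\<alpha>. \<bar>Re \<alpha>\<bar> < 1/2}" and s'="{\<alpha>. \<bar>Re \<alpha>\<bar> < real N + 1/2}"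
        and f="\<lambda>\<alpha>. of_real (sqrt (z / (2 * pi)) * exp z) * K_int \<alpha> z" and z=\<alpha>
        and g="\<lambda>\<alpha>. (\<Sum>l<N. a_coeff l \<alpha> / of_real z ^ l) + K_rem N \<alpha> (of_real z) / of_real z ^ N"])
    show "open {\<alpha>. \<bar>Re \<alpha>\<bar> < 1/2}" by (rule strip_props)
    show "{\<alpha>. \<bar>Re \<alpha>\<bar> < 1/2} \<noteq> {}" by (auto intro!: exI[of _ 0])
    show "(\<lambda>\<alpha>. of_real (sqrt (z / (2 * pi)) * exp z) * K_int \<alpha> z) holomorphic_on {\<alpha>. \<bar>Re \<alpha>\<bar> < real N + 1/2}"
      by (intro holomorphic_intros holomorphic_on_subset[OF K_int_holomorphic[OF z]]) auto
    show "(\<lambda>\<alpha>. (\<Sum>l<N. a_coeff l \<alpha> / of_real z ^ l) + K_rem N \<alpha> (of_real z) / of_real z ^ N)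
       holomorphic_on {\<alpha>. \<bar>Re \<alpha>\<bar> < real N + 1/2}"
    proof -
      have "(\<lambda>\<alpha>. a_coeff l \<alpha>) holomorphic_on A" for l A
        unfolding a_coeff_def pochhammer_prod by (intro holomorphic_intros) auto
      then show ?thesis
        using z by (intro holomorphic_intros K_rem_holomorphic_order[OF z']) auto
    qed
    show "of_real (sqrt (z / (2 * pi)) * exp z) * K_int \<alpha> z =
      (\<Sum>l<N. a_coeff l \<alpha> / of_real z ^ l) + K_rem N \<alpha> (of_real z) / of_real z ^ N"
      if "\<alpha> \<in> {\<alpha>. \<bar>Re \<alpha>\<bar> < 1/2}" for \<alpha>
      using K_rem_0_eq[OF z, of \<alpha>] K_rem_expand[OF z', of \<alpha> N] that by simp
  qed (use \<alpha> strip_props in auto)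
qed

section \<open>The product integral as an Euler integral\<close>

text \<open>Euler's integral of p^(b-1) (1-p)^(c-b-1) (1-xp)^(-a) over 0 < p < 1, with p = exp t/(1
  + exp t). The differential dp = p(1-p) dt absorbs both exponents -1.\<close>

definition hyp_int :: "complex \<Rightarrow> complex \<Rightarrow> complex \<Rightarrow> complex \<Rightarrow> complex" where
  "hyp_int a b c x = (\<integral>t. exp (b * of_real t - c * of_real (ln (1 + exp t))) *
     (1 - x * of_real (exp t / (1 + exp t))) powr (- a) \<partial>lborel)"

lemma integrable_Beta_cosh':
  assumes "Re b > 0" "Re (c - b) > 0"
  shows "integrable lborel (\<lambda>s. exp ((2 * b - c) * of_real s - c * of_real (ln (2 * cosh s))))"
  using lborel_integrable_real_affine[OF integrable_Beta_cosh[OF assms], of 2 0]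
  by (simp add: algebra_simps)

text \<open>The rotation once more, now in (w, r). The version with moduli supplies the majorant for
  Fubini's theorem in the triple integral.\<close>

lemma
  fixes a d :: complex and P Q :: real
  assumes a: "Re a > 0" and d: "Re d > 0" and P: "P > 0" and Q: "Q > 0"
  defines "A \<equiv> \<lambda>u. exp (d * of_real u - of_real (P * exp u))"
    and "B \<equiv> \<lambda>u. exp (a * of_real u - of_real (Q * exp u))"
  shows integrable_Gamma_rotate: "integrable (lborel \<Otimes>\<^sub>M lborel) (\<lambda>(w, r). A (w + r) * B (w - r))"
    and integral_Gamma_rotate: "(\<integral>w. \<integral>r. A (w + r) * B (w - r) \<partial>lborel \<partial>lborel) =
      Gamma d * Gamma a * exp (- d * of_real (ln P) - a * of_real (ln Q)) / 2"
    and integral_norm_Gamma_rotate: "(\<integral>w. \<integral>r. norm (A (w + r) * B (w - r)) \<partial>lborel \<partial>lborel) =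
      Gamma (Re d) * Gamma (Re a) * exp (- Re d * ln P - Re a * ln Q) / 2"
proof -
  \<comment> \<open>With \<open>w\<close> in the role of \<open>s\<close>, reflecting
    \<open>G\<close> turns its argument r - w into w - r.\<close>
  have key: "integrable (lborel \<Otimes>\<^sub>M lborel) (\<lambda>(w, r). F (w + r) * G (w - r))"
    "(\<integral>w. \<integral>r. F (w + r) * G (w - r) \<partial>lborel \<partial>lborel) = integral\<^sup>L lborel F * integral\<^sup>L lborel G / 2"
    if F: "integrable lborel F" and G: "integrable lborel G" for F G :: "real \<Rightarrow> complex"
  proof -
    have G': "integrable lborel (\<lambda>u. G (- u))" "(\<integral>u. G (- u) \<partial>lborel) = integral\<^sup>L lborel G"
      using lborel_integrable_real_affine[OF G, of "-1" 0] lborel_integral_real_affine[of "-1" G 0] by simp_all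
    show "integrable (lborel \<Otimes>\<^sub>M lborel) (\<lambda>(w, r). F (w + r) * G (w - r))"
      using integrable_mult_rotate[OF F G'(1)] by (simp add: add.commute)
    show "(\<integral>w. \<integral>r. F (w + r) * G (w - r) \<partial>lborel \<partial>lborel) = integral\<^sup>L lborel F * integral\<^sup>L lborel G / 2"
      using integral_mult_rotate[OF F G'(1)] G'(2) by (simp add: add.commute)
  qed
  have A: "integrable lborel A" "integral\<^sup>L lborel A = Gamma d * exp (- d * of_real (ln P))"
    unfolding A_def using integrable_Gamma_exp[OF d P] integral_Gamma_exp[OF d P] by auto
  have B: "integrable lborel B" "integral\<^sup>L lborel B = Gamma a * exp (- a * of_real (ln Q))"
    unfolding B_def using integrable_Gamma_exp[OF a Q] integral_Gamma_exp[OF a Q] by auto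
  show "integrable (lborel \<Otimes>\<^sub>M lborel) (\<lambda>(w, r). A (w + r) * B (w - r))"
    by (rule key[OF A(1) B(1)])
  show "(\<integral>w. \<integral>r. A (w + r) * B (w - r) \<partial>lborel \<partial>lborel) =
      Gamma d * Gamma a * exp (- d * of_real (ln P) - a * of_real (ln Q)) / 2"
  proof -
    have "exp (- d * of_real (ln P) - a * of_real (ln Q)) = exp (- d * of_real (ln P)) * exp (- a * complex_of_real (ln Q))"
      by (simp flip: exp_add)
    then show ?thesis unfolding key(2)[OF A(1) B(1)] A(2) B(2) by (simp only: mult_ac)
  qed
  have norm_exp: "complex_of_real (norm (exp (e * of_real u - of_real (R * exp u)))) =
      exp (of_real (Re e) * of_real u - of_real (R * exp u))" for e :: complex and u R :: real
  proof -
    have "of_real (Re e) * of_real u - of_real (R * exp u) = complex_of_real (Re e * u - R * exp u)" by simp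
    then show ?thesis by (simp only: exp_of_real) simp
  qed
  have Gr: "(\<integral>u. complex_of_real (norm (exp (e * of_real u - of_real (R * exp u)))) \<partial>lborel) =
      of_real (Gamma (Re e) * exp (- Re e * ln R))" if "Re e > 0" "R > 0" for e :: complex and R :: real
  proof -
    have "exp (- of_real (Re e) * of_real (ln R)) = complex_of_real (exp (- Re e * ln R))"
      by (simp flip: exp_of_real)
    then show ?thesis
      unfolding norm_exp using that by (subst integral_Gamma_exp) (simp_all add: Gamma_complex_of_real)
  qed
  have "complex_of_real (\<integral>w. \<integral>r. norm (A (w + r) * B (w - r)) \<partial>lborel \<partial>lborel) =
    (\<integral>w. \<integral>r. complex_of_real (norm (A (w + r))) * complex_of_real (norm (B (w - r))) \<partial>lborel \<partial>lborel)"
    by (simp add: norm_mult integral_complex_of_real[symmetric] del: integral_complex_of_real)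
  also have "\<dots> = of_real (Gamma (Re d) * exp (- Re d * ln P)) * of_real (Gamma (Re a) * exp (- Re a * ln Q)) / 2"
    using A(1) B(1) by (subst key(2)) (simp_all only: A_def B_def Gr[OF d P] Gr[OF a Q] integrable_norm integrable_of_real)
  also have "\<dots> = of_real (Gamma (Re d) * Gamma (Re a) * exp (- Re d * ln P - Re a * ln Q) / 2)"
  proof -
    have "exp (- Re d * ln P - Re a * ln Q) = exp (- Re d * ln P) * exp (- Re a * ln Q)"
      by (simp flip: exp_add)
    then show ?thesis by (simp only: of_real_mult of_real_divide mult_ac) simp
  qed
  finally show "(\<integral>w. \<integral>r. norm (A (w + r) * B (w - r)) \<partial>lborel \<partial>lborel) =
      Gamma (Re d) * Gamma (Re a) * exp (- Re d * ln P - Re a * ln Q) / 2"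
    by (simp only: of_real_eq_iff)
qed

text \<open>Two rotations. The first acts on the two Bessel variables and makes the exponent P
  exp(w+r)/2 + Q exp(w-r)/2; the second acts on (w, r) and splits that double integral into two
  gamma integrals, so that only s survives. The linear terms match because c w + (b-a)(r+s) +
  (c-a-b)(r-s) = (2b-c) s + (c-a)(w+r) + a (w-r).\<close>

lemma integral_K_int_K_int:
  fixes a b c :: complex and x y :: real
  assumes a: "Re a > 0" "Re (c - a) > 0" and b: "Re b > 0" "Re (c - b) > 0" and xy: "x > 0" "y > 0"
  defines "P \<equiv> \<lambda>s. x * exp s + y * exp (- s)" and "Q \<equiv> \<lambda>s. x * exp (- s) + y * exp s"
  shows "(\<integral>w. exp (c * of_real w) * (K_int (b - a) (exp w * x) * K_int (c - a - b) (exp w * y)) \<partial>lborel) =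
     Gamma (c - a) * Gamma a *
     (\<integral>s. exp ((2 * b - c) * of_real s - (c - a) * of_real (ln (P s / 2)) - a * of_real (ln (Q s / 2))) \<partial>lborel)"
proof -
  define d where "d = c - a"
  have d: "Re d > 0" using a by (simp add: d_def)
  have PQ: "P s > 0" "Q s > 0" for s using xy by (auto simp: P_def Q_def add_pos_pos)
  define A where "A s u = exp (d * of_real u - of_real (P s / 2 * exp u))" for s u
  define B where "B s u = exp (a * of_real u - of_real (Q s / 2 * exp u))" for s u
  define T where "T s = exp ((2 * b - c) * of_real s)" for s :: real
  define h where "h s w = (\<integral>r. T s * (A s (w + r) * B s (w - r)) \<partial>lborel)" for s w
  define W where "W s = Gamma (Re d) * Gamma (Re a) * exp (- Re d * ln (P s / 2) - Re a * ln (Q s / 2)) / 2" for s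
  have step_A: "exp (c * of_real w) * (K_int (b - a) (exp w * x) * K_int (c - a - b) (exp w * y)) =
      2 * (\<integral>s. h s w \<partial>lborel)" for w
  proof -
    define F where "F u = exp ((b - a) * of_real u - of_real (exp w * x * cosh u))" for u
    define G where "G u = exp ((c - a - b) * of_real u - of_real (exp w * y * cosh u))" for u
    have F: "integrable lborel F" and G: "integrable lborel G"
      unfolding F_def[abs_def] G_def[abs_def] by (rule integrable_exp_cosh, use xy in simp)+
    have "exp (c * of_real w) * (F (r + s) * G (r - s)) = T s * (A s (w + r) * B s (w - r))" for r s
    proof -
      have ch: "exp w * x * cosh (r + s) + exp w * y * cosh (r - s) =
          P s / 2 * exp (w + r) + Q s / 2 * exp (w - r)"
      proof -
        have "exp w * x * cosh (r + s) + exp w * y * cosh (r - s) =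
          x / 2 * (exp (w + (r + s)) + exp (w - (r + s))) + y / 2 * (exp (w + (r - s)) + exp (w - (r - s)))"
          by (simp add: exp_plus_exp_minus)
        also have "\<dots> = (x * exp s + y * exp (- s)) / 2 * exp (w + r) + (x * exp (- s) + y * exp s) / 2 * exp (w - r)"
          by (simp add: distrib_left distrib_right add_divide_distrib mult_exp_exp mult.assoc algebra_simps)
        finally show ?thesis by (simp only: P_def Q_def)
      qed
      have "c * of_real w + (((b - a) * of_real (r + s) - of_real (exp w * x * cosh (r + s))) +
           ((c - a - b) * of_real (r - s) - of_real (exp w * y * cosh (r - s)))) =
        (c * of_real w + (b - a) * of_real (r + s) + (c - a - b) * of_real (r - s)) -
        of_real (exp w * x * cosh (r + s) + exp w * y * cosh (r - s))"
        by (simp only: of_real_add) (simp add: algebra_simps)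
      also have "\<dots> = (c * of_real w + (b - a) * of_real (r + s) + (c - a - b) * of_real (r - s)) -
        of_real (P s / 2 * exp (w + r) + Q s / 2 * exp (w - r))"
        by (simp only: ch)
      also have "\<dots> = (2 * b - c) * of_real s + ((d * of_real (w + r) - of_real (P s / 2 * exp (w + r))) +
         (a * of_real (w - r) - of_real (Q s / 2 * exp (w - r))))"
        by (simp only: of_real_add of_real_diff d_def) (simp only: algebra_simps, simp)
      finally show ?thesis by (simp only: F_def G_def T_def A_def B_def exp_add[symmetric])
    qed
    note eq = this
    have "exp (c * of_real w) * (K_int (b - a) (exp w * x) * K_int (c - a - b) (exp w * y)) =
       exp (c * of_real w) * (2 * (\<integral>s. \<integral>r. F (r + s) * G (r - s) \<partial>lborel \<partial>lborel))"
    proof -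
      have "K_int (b - a) (exp w * x) = integral\<^sup>L lborel F" "K_int (c - a - b) (exp w * y) = integral\<^sup>L lborel G"
        by (simp_all only: K_int_def F_def[abs_def] G_def[abs_def])
      then show ?thesis unfolding integral_mult_rotate[OF F G] by simp
    qed
    also have "\<dots> = 2 * (\<integral>s. \<integral>r. exp (c * of_real w) * (F (r + s) * G (r - s)) \<partial>lborel \<partial>lborel)"
      by (simp only: integral_mult_right_zero) simp
    finally show ?thesis unfolding eq h_def .
  qed
  have half: "P s / 2 > 0" "Q s / 2 > 0" for s using PQ by simp_all
  have step_C: "(\<integral>w. h s w \<partial>lborel) = Gamma d * Gamma a *
      exp ((2 * b - c) * of_real s - d * of_real (ln (P s / 2)) - a * of_real (ln (Q s / 2))) / 2" for s
  proof -
    have "(\<integral>w. h s w \<partial>lborel) = T s * (Gamma d * Gamma a *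
        exp (- d * of_real (ln (P s / 2)) - a * of_real (ln (Q s / 2))) / 2)"
      unfolding h_def A_def B_def integral_mult_right_zero integral_Gamma_rotate[OF a(1) d half] ..
    moreover have "exp ((2 * b - c) * of_real s - d * of_real (ln (P s / 2)) - a * of_real (ln (Q s / 2))) =
       T s * exp (- d * of_real (ln (P s / 2)) - a * of_real (ln (Q s / 2)))"
      unfolding T_def exp_add[symmetric] by (simp add: algebra_simps)
    ultimately show ?thesis by simp
  qed
  have ABint: "integrable (lborel \<Otimes>\<^sub>M lborel) (\<lambda>(w, r). T s * (A s (w + r) * B s (w - r)))" for s
    using integrable_mult_right[OF integrable_Gamma_rotate[OF a(1) d half], of "T s"]
    unfolding A_def B_def case_prod_unfold .
  \<comment> \<open>The w-integral of the modulus of \<open>h\<close> is at most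
    \<open>norm (T s) * W s\<close>; the lower bound on \<open>P\<close> and \<open>Q\<close> turns
    this into a beta integrand in s.\<close>
  have pair: "integrable (lborel \<Otimes>\<^sub>M lborel) (\<lambda>(s, w). h s w)"
  proof (rule lborel_pair.Fubini_integrable)
    have "continuous_on UNIV (\<lambda>p. T (fst (fst p)) * (A (fst (fst p)) (snd (fst p) + snd p) * B (fst (fst p)) (snd (fst p) - snd p)))"
      unfolding T_def A_def B_def P_def Q_def by (intro continuous_intros) auto
    then have "(\<lambda>p. T (fst (fst p)) * (A (fst (fst p)) (snd (fst p) + snd p) * B (fst (fst p)) (snd (fst p) - snd p)))
        \<in> borel_measurable ((lborel \<Otimes>\<^sub>M lborel) \<Otimes>\<^sub>M lborel)"
      by (simp add: lborel_prod borel_measurable_continuous_onI)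
    then have m: "(\<lambda>p. h (fst p) (snd p)) \<in> borel_measurable (lborel \<Otimes>\<^sub>M lborel)"
      unfolding h_def by (intro lborel.borel_measurable_lebesgue_integral) (simp add: case_prod_unfold)
    then show m': "(\<lambda>(s, w). h s w) \<in> borel_measurable (lborel \<Otimes>\<^sub>M lborel)"
      by (simp add: case_prod_unfold)
    have hint: "integrable lborel (h s)" for s
      unfolding h_def[abs_def] using lborel_pair.integrable_fst'[OF ABint] by simp
    then show "AE s in lborel. integrable lborel (\<lambda>w. case (s, w) of (s, w) \<Rightarrow> h s w)" by simp
    have bound: "(\<integral>w. norm (h s w) \<partial>lborel) \<le> norm (T s) * W s" for s
    proof -
      have "(\<integral>w. norm (h s w) \<partial>lborel) \<le> (\<integral>w. \<integral>r. norm (T s * (A s (w + r) * B s (w - r))) \<partial>lborel \<partial>lborel)"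
      proof (rule integral_mono)
        show "integrable lborel (\<lambda>w. norm (h s w))" using hint by simp
        show "integrable lborel (\<lambda>w. \<integral>r. norm (T s * (A s (w + r) * B s (w - r))) \<partial>lborel)"
          using lborel_pair.integrable_fst'[OF integrable_norm[OF ABint]] by simp
        show "norm (h s w) \<le> (\<integral>r. norm (T s * (A s (w + r) * B s (w - r))) \<partial>lborel)" for w
          unfolding h_def by (rule integral_norm_bound)
      qed
      also have "\<dots> = norm (T s) * (\<integral>w. \<integral>r. norm (A s (w + r) * B s (w - r)) \<partial>lborel \<partial>lborel)"
        by (simp only: norm_mult[of "T s"] integral_mult_right_zero)
      also have "\<dots> = norm (T s) * W s"
        unfolding A_def B_def W_def integral_norm_Gamma_rotate[OF a(1) d half] ..
      finally show ?thesis .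
    qed
    \<comment> \<open>Both \<open>P s\<close> and \<open>Q s\<close> are at least 2 m cosh s, and
      the exponents Re d and Re a add up to Re c.\<close>
    define m where "m = min x y"
    have m0: "m > 0" using xy by (simp add: m_def)
    have mP: "ln (P s / 2) \<ge> ln (m / 2) + ln (2 * cosh s)" "ln (Q s / 2) \<ge> ln (m / 2) + ln (2 * cosh s)" for s
    proof -
      have eq: "m / 2 * (2 * cosh s) = (m * exp s + m * exp (- s)) / 2"
        by (simp add: cosh_def field_simps)
      have "m * exp s + m * exp (- s) \<le> P s" "m * exp (- s) + m * exp s \<le> Q s"
        unfolding P_def Q_def by (intro add_mono mult_right_mono; simp add: m_def)+
      then have "m / 2 * (2 * cosh s) \<le> P s / 2" "m / 2 * (2 * cosh s) \<le> Q s / 2"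
        unfolding eq by (auto simp: add.commute)
      moreover have pos: "m / 2 * (2 * cosh s) > 0" using m0 by simp
      ultimately have "ln (m / 2 * (2 * cosh s)) \<le> ln (P s / 2)" "ln (m / 2 * (2 * cosh s)) \<le> ln (Q s / 2)"
        by (simp_all only: ln_le_cancel_iff[OF pos half(1)] ln_le_cancel_iff[OF pos half(2)])
      moreover have "ln (m / 2 * (2 * cosh s)) = ln (m / 2) + ln (2 * cosh s)"
        using m0 by (intro ln_mult_pos) simp_all
      ultimately show "ln (P s / 2) \<ge> ln (m / 2) + ln (2 * cosh s)" "ln (Q s / 2) \<ge> ln (m / 2) + ln (2 * cosh s)"
        by simp_all
    qed
    define E where "E s = norm (exp ((2 * b - c) * of_real s - c * of_real (ln (2 * cosh s))))" for s
    have Eint: "integrable lborel E"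
      unfolding E_def[abs_def] by (intro integrable_norm integrable_Beta_cosh' b)
    define C where "C = Gamma (Re d) * Gamma (Re a) / 2 * exp (- Re c * ln (m / 2))"
    have Cb: "norm (T s) * W s \<le> C * E s" for s
    proof -
      have "Re d * (ln (m / 2) + ln (2 * cosh s)) \<le> Re d * ln (P s / 2)"
        "Re a * (ln (m / 2) + ln (2 * cosh s)) \<le> Re a * ln (Q s / 2)"
        using mP d a by (auto intro!: mult_left_mono)
      then have "- Re d * ln (P s / 2) - Re a * ln (Q s / 2) \<le> - Re c * ln (m / 2) - Re c * ln (2 * cosh s)"
        by (simp add: d_def algebra_simps)
      then have "exp (- Re d * ln (P s / 2) - Re a * ln (Q s / 2)) \<le> exp (- Re c * ln (m / 2) - Re c * ln (2 * cosh s))"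
        by simp
      moreover have "Gamma (Re d) * Gamma (Re a) / 2 > 0" using a d by simp
      ultimately have "norm (T s) * W s \<le> norm (T s) * (Gamma (Re d) * Gamma (Re a) / 2 * exp (- Re c * ln (m / 2) - Re c * ln (2 * cosh s)))"
        unfolding W_def by (intro mult_left_mono) (simp_all add: mult_left_mono)
      also have "\<dots> = C * E s"
      proof -
        have "E s = norm (T s) * exp (- Re c * ln (2 * cosh s))"
          by (simp add: E_def T_def exp_add[symmetric])
        moreover have "exp (- Re c * ln (m / 2) - Re c * ln (2 * cosh s)) = exp (- Re c * ln (m / 2)) * exp (- Re c * ln (2 * cosh s))"
          by (simp flip: exp_add)
        ultimately show ?thesis unfolding C_def by (simp only: mult_ac)
      qed
      finally show ?thesis .
    qed
    show "integrable lborel (\<lambda>s. \<integral>w. norm (case (s, w) of (s, w) \<Rightarrow> h s w) \<partial>lborel)"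
    proof (rule Bochner_Integration.integrable_bound)
      show "integrable lborel (\<lambda>s. C * E s)" using Eint by simp
      show "(\<lambda>s. \<integral>w. norm (case (s, w) of (s, w) \<Rightarrow> h s w) \<partial>lborel) \<in> borel_measurable lborel"
        using m by (intro lborel.borel_measurable_lebesgue_integral) (simp add: case_prod_unfold)
      have "0 \<le> (\<integral>w. norm (h s w) \<partial>lborel)" for s by simp
      then show "AE s in lborel. norm (\<integral>w. norm (case (s, w) of (s, w) \<Rightarrow> h s w) \<partial>lborel) \<le> norm (C * E s)"
        using order.trans[OF order.trans[OF bound Cb] abs_ge_self] by (intro AE_I2) simp
    qed
  qed
  have "(\<integral>w. exp (c * of_real w) * (K_int (b - a) (exp w * x) * K_int (c - a - b) (exp w * y)) \<partial>lborel) =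
      2 * (\<integral>w. \<integral>s. h s w \<partial>lborel \<partial>lborel)"
    unfolding step_A by (rule integral_mult_right_zero)
  also have "\<dots> = 2 * (\<integral>s. \<integral>w. h s w \<partial>lborel \<partial>lborel)"
    by (simp only: lborel_pair.Fubini_integral[OF pair])
  also have "\<dots> = 2 * (\<integral>s. (Gamma d * Gamma a / 2) *
      exp ((2 * b - c) * of_real s - d * of_real (ln (P s / 2)) - a * of_real (ln (Q s / 2))) \<partial>lborel)"
    unfolding step_C by simp
  finally show ?thesis
    unfolding integral_mult_right_zero d_def by simp
qed

text \<open>Centring s at L/2 with L = ln(y/x) makes P proportional to 1 + exp t and Q to v = 1 +
  (y/x)^2 exp t, with the same factor exp(-s). With p = exp t/(1 + exp t) the quotient v/(1 + exp t)
  equals 1 - (1 - (y/x)^2) p, as in Euler's integrand.\<close>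

lemma integral_eq_hyp_int:
  fixes a b c :: complex and x y :: real
  assumes xy: "x > 0" "y > 0"
  defines "P \<equiv> \<lambda>s. x * exp s + y * exp (- s)" and "Q \<equiv> \<lambda>s. x * exp (- s) + y * exp s"
  shows "(\<integral>s. exp ((2 * b - c) * of_real s - (c - a) * of_real (ln (P s / 2)) - a * of_real (ln (Q s / 2))) \<partial>lborel) =
     exp (c * of_real (ln 2) + b * of_real (ln (y / x)) - (c - a) * of_real (ln y) - a * of_real (ln x)) / 2 *
     hyp_int a b c (of_real (1 - (y / x)\<^sup>2))"
proof -
  define L where "L = ln (y / x)"
  have expL: "exp L = y / x" using xy by (simp add: L_def)
  define F where "F s = exp ((2 * b - c) * of_real s - (c - a) * of_real (ln (P s / 2)) - a * of_real (ln (Q s / 2)))" for s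
  define C where "C = exp (c * of_real (ln 2) + b * of_real (ln (y / x)) - (c - a) * of_real (ln y) - a * of_real (ln x))"
  have "F (L / 2 + 1 / 2 * t) = C * (exp (b * of_real t - c * of_real (ln (1 + exp t))) *
     (1 - of_real (1 - (y / x)\<^sup>2) * of_real (exp t / (1 + exp t))) powr (- a))" for t
  proof -
    define s where "s = L / 2 + 1 / 2 * t"
    define v where "v = 1 + (y / x)\<^sup>2 * exp t"
    have v: "v > 0" using xy by (simp add: v_def add_pos_nonneg)
    have e1: "1 + exp t > 0" by (simp add: add_pos_pos)
    have e2s: "exp s * exp s = exp t * (y / x)"
      by (simp add: s_def exp_add[symmetric] expL[symmetric] mult_exp_exp)
    have "P s = exp (- s) * (y + x * (exp s * exp s))"
      by (simp add: P_def algebra_simps exp_minus)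
    also have "\<dots> = exp (- s) * (y * (1 + exp t))"
      using xy by (simp add: e2s) (simp add: algebra_simps)
    finally have P: "ln (P s / 2) = - s + ln y + ln (1 + exp t) - ln 2"
      using xy e1 by (simp add: ln_div ln_mult)
    have "Q s = exp (- s) * (x + y * (exp s * exp s))"
      by (simp add: Q_def algebra_simps exp_minus)
    also have "\<dots> = exp (- s) * (x * v)"
      using xy by (simp add: e2s v_def power2_eq_square) (simp add: field_simps)
    finally have Q: "ln (Q s / 2) = - s + ln x + ln v - ln 2"
      using xy v by (simp add: ln_div ln_mult)
    have quot: "1 - of_real (1 - (y / x)\<^sup>2) * complex_of_real (exp t / (1 + exp t)) = of_real (v / (1 + exp t))"
    proof -
      have "1 - (1 - (y / x)\<^sup>2) * (exp t / (1 + exp t)) = v / (1 + exp t)"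
        using e1 by (simp add: v_def field_simps)
      then have "complex_of_real (1 - (1 - (y / x)\<^sup>2) * (exp t / (1 + exp t))) = of_real (v / (1 + exp t))"
        by (rule arg_cong)
      then show ?thesis by (simp only: of_real_diff of_real_mult of_real_1)
    qed
    have pw: "(1 - of_real (1 - (y / x)\<^sup>2) * of_real (exp t / (1 + exp t))) powr (- a) =
       exp (- a * (of_real (ln v) - of_real (ln (1 + exp t))))"
    proof -
      have "complex_of_real q powr (- a) = exp (- a * of_real (ln q))" if "q > 0" for q
        using that by (simp add: powr_def Ln_of_real)
      moreover have "ln (v / (1 + exp t)) = ln v - ln (1 + exp t)" using v e1 by (simp add: ln_div)
      moreover have "v / (1 + exp t) > 0" using v e1 by simp
      ultimately show ?thesis unfolding quot by (simp only: of_real_diff)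
    qed
    have "(2 * b - c) * of_real s - (c - a) * of_real (ln (P s / 2)) - a * of_real (ln (Q s / 2)) =
      (c * of_real (ln 2) + b * of_real L - (c - a) * of_real (ln y) - a * of_real (ln x)) +
      ((b * of_real t - c * of_real (ln (1 + exp t))) + - a * (of_real (ln v) - of_real (ln (1 + exp t))))"
    proof -
      \<comment> \<open>Opaque names for the logarithms leave a polynomial identity.\<close>
      define p q r l where "p = complex_of_real (ln y)" and "q = complex_of_real (ln x)"
        and "r = complex_of_real (ln (1 + exp t))" and "l = complex_of_real (ln v)"
      define k where "k = complex_of_real (ln 2)"
      have ls: "complex_of_real L = 2 * of_real s - of_real t" by (simp add: s_def)
      show ?thesis
        unfolding P Q ls of_real_add of_real_diff of_real_minus
        unfolding p_def[symmetric] q_def[symmetric] r_def[symmetric] l_def[symmetric] k_def[symmetric]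
        by (simp add: algebra_simps)
    qed
    then show ?thesis
      unfolding s_def[symmetric] F_def C_def pw L_def[symmetric] by (simp only: exp_add)
  qed
  then have "integral\<^sup>L lborel F = C / 2 * hyp_int a b c (of_real (1 - (y / x)\<^sup>2))"
    using lborel_integral_real_affine[of "1/2" F "L / 2"]
    by (simp only: integral_mult_right_zero hyp_int_def) (simp add: scaleR_conv_of_real)
  then show ?thesis unfolding F_def C_def .
qed

section \<open>Analytic continuation of the hypergeometric series\<close>

lemma
  assumes b: "Re b > 0" "Re (c - b) > 0"
  shows integrable_Beta_logistic: "integrable lborel (\<lambda>t. exp (b * of_real t - c * of_real (ln (1 + exp t))))"
    and integral_Beta_logistic: "(\<integral>t. exp (b * of_real t - c * of_real (ln (1 + exp t))) \<partial>lborel)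
      = Gamma b * Gamma (c - b) * rGamma c"
proof -
  have eq: "exp ((b - (c - b)) * of_real (t / 2) - (b + (c - b)) * of_real (ln (2 * cosh (t / 2)))) =
     exp (b * of_real t - c * of_real (ln (1 + exp t)))" for t :: real
  proof -
    have "1 + exp t = exp (t / 2) * (2 * cosh (t / 2))"
      by (simp add: cosh_def distrib_left mult_exp_exp)
    then have "ln (1 + exp t) = t / 2 + ln (2 * cosh (t / 2))"
      by (simp add: ln_mult_pos)
    then have l: "complex_of_real (ln (1 + exp t)) = of_real (t / 2) + of_real (ln (2 * cosh (t / 2)))"
      by (metis of_real_add)
    have t: "complex_of_real t = 2 * of_real (t / 2)" by simp
    show ?thesis unfolding l t by (rule arg_cong[of _ _ exp]) (simp add: algebra_simps)
  qed
  show "integrable lborel (\<lambda>t. exp (b * of_real t - c * of_real (ln (1 + exp t))))"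
    using integrable_Beta_cosh[OF b] unfolding eq .
  have "b + (c - b) = c" by simp
  then show "(\<integral>t. exp (b * of_real t - c * of_real (ln (1 + exp t))) \<partial>lborel) = Gamma b * Gamma (c - b) * rGamma c"
    using integral_Beta_cosh[OF b] unfolding eq by (simp only: rGamma_inverse_Gamma divide_inverse)
qed

section \<open>The cut plane and Euler's integral on it\<close>

lemma slit_plane_iff: "z \<in> slit_plane \<longleftrightarrow> \<not> (Im z = 0 \<and> Re z \<ge> 1)"
  unfolding slit_plane_def by (auto simp: image_iff complex_eq_iff)

lemma open_slit_plane: "open slit_plane"
proof -
  have "closed {z. Im z = 0 \<and> Re z \<ge> 1}"
    by (intro closed_Collect_conj closed_Collect_eq closed_Collect_le continuous_intros)
  moreover have "slit_plane = - {z. Im z = 0 \<and> Re z \<ge> 1}"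
    by (auto simp: slit_plane_iff)
  ultimately show ?thesis by (metis open_Compl)
qed

lemma mult_unit_interval_slit_plane:
  assumes "x \<in> slit_plane" "0 \<le> p" "p \<le> 1"
  shows "x * of_real p \<in> slit_plane"
proof -
  have "Re x \<ge> 1" if "Re x * p \<ge> 1"
  proof (rule ccontr)
    assume "\<not> Re x \<ge> 1"
    then have "Re x < 1" by simp
    have "Re x * p < 1"
    proof (cases "Re x \<le> 0")
      case True
      then show ?thesis using mult_nonpos_nonneg[of "Re x" p] assms by linarith
    next
      case False
      then show ?thesis using mult_left_le[of p "Re x"] assms \<open>Re x < 1\<close> by linarith
    qed
    then show False using that by simp
  qed
  moreover have "p \<noteq> 0" if "Re x * p \<ge> 1" using that by auto
  ultimately show ?thesis using assms by (auto simp: slit_plane_iff)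
qed

lemma connected_slit_plane: "connected slit_plane"
proof (rule starlike_imp_connected)
  have "0 \<in> slit_plane" by (simp add: slit_plane_iff)
  moreover have "closed_segment 0 x \<subseteq> slit_plane" if "x \<in> slit_plane" for x
    using mult_unit_interval_slit_plane[OF that]
    by (auto simp: in_segment scaleR_conv_of_real mult.commute)
  ultimately show "starlike slit_plane" unfolding starlike_def by blast
qed

lemma one_minus_slit_plane: "x \<in> slit_plane \<Longrightarrow> 1 - x \<notin> \<real>\<^sub>\<le>\<^sub>0"
  by (auto simp: slit_plane_iff complex_nonpos_Reals_iff)

lemma exp_over_one_plus_exp_bounds:
  fixes t :: real
  shows "0 \<le> exp t / (1 + exp t)" "exp t / (1 + exp t) \<le> 1"
  by (simp_all add: add_nonneg_nonneg divide_le_eq add_pos_pos)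

lemma one_plus_exp_nonzero: "1 + exp t \<noteq> (0 :: real)" "1 + complex_of_real (exp t) \<noteq> 0"
proof -
  show "1 + exp t \<noteq> (0 :: real)" by (smt (verit) exp_gt_zero)
  then show "1 + complex_of_real (exp t) \<noteq> 0" by (metis of_real_1 of_real_add of_real_eq_0_iff)
qed

lemma continuous_on_powr_const:
  assumes f: "continuous_on A f" and "\<And>z. z \<in> A \<Longrightarrow> f z \<notin> \<real>\<^sub>\<le>\<^sub>0"
  shows "continuous_on A (\<lambda>z. f z powr (s :: complex))"
proof -
  have "continuous_on A (\<lambda>z. exp (s * Ln (f z)))"
    using assms by (intro continuous_intros) auto
  moreover have "f z powr s = exp (s * Ln (f z))" if "z \<in> A" for z
    using assms(2)[OF that] by (auto simp: powr_def)
  ultimately show ?thesis by (simp cong: continuous_on_cong)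
qed

text \<open>With p = exp t/(1 + exp t) in [0, 1], the point xp remains in the cut plane and 1 - xp
  off the cut of the power; a beta integrand times a constant is then a local majorant.\<close>

lemma hyp_int_holomorphic:
  assumes b: "Re b > 0" "Re (c - b) > 0"
  shows "hyp_int a b c holomorphic_on slit_plane"
proof -
  note p = exp_over_one_plus_exp_bounds
  define F where "F x t = exp (b * of_real t - c * of_real (ln (1 + exp t))) *
     (1 - x * of_real (exp t / (1 + exp t))) powr (- a)" for x and t :: real
  have "(\<lambda>x. \<integral>t. F x t \<partial>lborel) holomorphic_on slit_plane"
  proof (rule holomorphic_on_lebesgue_integral[OF open_slit_plane])
    fix x :: complex assume x: "x \<in> slit_plane"
    have c1: "continuous_on UNIV (\<lambda>t::real. (1 - x * of_real (exp t / (1 + exp t))) powr (- a))"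
    proof (rule continuous_on_powr_const)
      show "continuous_on UNIV (\<lambda>t::real. 1 - x * of_real (exp t / (1 + exp t)))"
        by (intro continuous_intros ballI) (rule one_plus_exp_nonzero)
      show "1 - x * complex_of_real (exp t / (1 + exp t)) \<notin> \<real>\<^sub>\<le>\<^sub>0" for t
        by (rule one_minus_slit_plane[OF mult_unit_interval_slit_plane[OF x p]])
    qed
    have c2: "continuous_on UNIV (\<lambda>t::real. exp (b * of_real t - c * of_real (ln (1 + exp t))))"
      by (intro continuous_intros ballI) (rule one_plus_exp_nonzero(1))
    show "F x \<in> borel_measurable lborel"
      unfolding measurable_lborel2 F_def[abs_def]
      by (rule borel_measurable_continuous_onI[OF continuous_on_mult[OF c2 c1]])
  next
    show "(\<lambda>x. F x t) holomorphic_on slit_plane" for t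
      unfolding F_def
      by (intro holomorphic_intros one_minus_slit_plane mult_unit_interval_slit_plane p) assumption
  next
    fix x0 :: complex assume "x0 \<in> slit_plane"
    then obtain r where r: "r > 0" "cball x0 r \<subseteq> slit_plane"
      using open_slit_plane open_contains_cball by blast
    \<comment> \<open>As a function of (x, p) the power is continuous on a compact set, the
      endpoints p = 0 and p = 1 included, which bounds it uniformly in t.\<close>
    define h where "h q = (1 - fst q * complex_of_real (snd q)) powr (- a)" for q
    have cont: "continuous_on (cball x0 r \<times> {0..1}) h"
      unfolding h_def[abs_def]
    proof (rule continuous_on_powr_const)
      show "continuous_on (cball x0 r \<times> {0..1}) (\<lambda>q. 1 - fst q * complex_of_real (snd q))"
        by (intro continuous_intros)
      show "1 - fst q * complex_of_real (snd q) \<notin> \<real>\<^sub>\<le>\<^sub>0" if "q \<in> cball x0 r \<times> {0..1}" for q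
        using that r by (intro one_minus_slit_plane mult_unit_interval_slit_plane) auto
    qed
    have "compact (cball x0 r \<times> {0..1::real})" by (intro compact_Times) auto
    then have "bounded (h ` (cball x0 r \<times> {0..1}))"
      by (rule compact_imp_bounded[OF compact_continuous_image[OF cont]])
    then obtain C where "\<forall>y\<in>h ` (cball x0 r \<times> {0..1}). norm y \<le> C"
      unfolding bounded_iff ..
    then have C: "norm (h q) \<le> C" if "q \<in> cball x0 r \<times> {0..1}" for q
      using that by blast
    define g where "g t = norm (exp (b * of_real t - c * of_real (ln (1 + exp t)))) * C" for t :: real
    have "integrable lborel g"
      unfolding g_def[abs_def] by (intro integrable_mult_left integrable_norm integrable_Beta_logistic b)
    moreover have "norm (F x t) \<le> g t" if x: "x \<in> ball x0 r" for x t
    proof -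
      have "(x, exp t / (1 + exp t)) \<in> cball x0 r \<times> {0..1}"
        using x p[of t] by auto
      from C[OF this] show ?thesis
        unfolding F_def g_def norm_mult h_def fst_conv snd_conv by (rule mult_left_mono) simp
    qed
    ultimately show "\<exists>r>0. \<exists>g. integrable lborel g \<and>
        (\<forall>x\<in>ball x0 r \<inter> slit_plane. \<forall>t\<in>space lborel. norm (F x t) \<le> g t)"
      using r(1) by blast
  qed
  then show ?thesis unfolding hyp_int_def[abs_def] F_def .
qed

lemma binomial_series_pochhammer:
  fixes a w :: complex
  assumes w: "norm w < 1"
  shows "(\<lambda>n. pochhammer a n / fact n * w ^ n) sums ((1 - w) powr (- a))"
    and "summable (\<lambda>n. norm (pochhammer a n / fact n * w ^ n))"
proof -
  have eq: "(- a gchoose n) * (- u) ^ n = pochhammer a n / fact n * u ^ n" for n and u :: complex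
  proof -
    have "(- 1) ^ n * (- u) ^ n = ((- 1) * (- u)) ^ n" by (rule power_mult_distrib[symmetric])
    then have sgn: "(- 1) ^ n * (- u) ^ n = u ^ n" by (simp only: mult_minus_left mult_minus_right minus_minus mult_1_left)
    have "(- a gchoose n) * (- u) ^ n = pochhammer a n / fact n * ((- 1) ^ n * (- u) ^ n)"
      unfolding gbinomial_pochhammer minus_minus by (simp only: divide_inverse mult_ac)
    then show ?thesis unfolding sgn .
  qed
  show "(\<lambda>n. pochhammer a n / fact n * w ^ n) sums ((1 - w) powr (- a))"
    using gen_binomial_complex[of "- w" "- a"] w by (simp add: eq)
  \<comment> \<open>A point of modulus strictly between |w| and 1: convergence there gives absolute
    convergence at w.\<close>
  define u where "u = complex_of_real ((norm w + 1) / 2)"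
  have u: "norm u = (norm w + 1) / 2"
    unfolding u_def norm_of_real by simp
  then have "norm u < 1" "norm w < norm u" using w by auto
  then have "summable (\<lambda>n. pochhammer a n / fact n * u ^ n)"
    using gen_binomial_complex[of "- u" "- a"] by (simp add: eq sums_iff)
  then show "summable (\<lambda>n. norm (pochhammer a n / fact n * w ^ n))"
    by (rule powser_insidea) fact
qed

text \<open>Binomial expansion and termwise integration: the factor p^n raises b and c by n and
  leaves c - b alone, so each term is a beta integral. As 0 <= p <= 1, the absolutely convergent
  series at x itself dominates.\<close>

lemma hyp_int_series:
  assumes b: "Re b > 0" "Re (c - b) > 0" and x: "norm x < 1"
  shows "hyp_int a b c x = Gamma b * Gamma (c - b) *
    (\<Sum>n. pochhammer a n * pochhammer b n * rGamma (c + of_nat n) / fact n * x ^ n)"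
proof -
  define g where "g t = exp (b * of_real t - c * of_real (ln (1 + exp t)))" for t :: real
  define p where "p t = exp t / (1 + exp t)" for t :: real
  have p: "0 \<le> p t" "p t \<le> 1" for t
    unfolding p_def by (rule exp_over_one_plus_exp_bounds)+
  define A where "A n = pochhammer a n / fact n * x ^ n" for n
  define f where "f n t = A n * (g t * of_real (p t) ^ n)" for n t
  have gp: "g t * of_real (p t) ^ n = exp ((b + of_nat n) * of_real t - (c + of_nat n) * of_real (ln (1 + exp t)))" for n t
  proof -
    have e: "1 + exp t > 0" by (simp add: add_pos_pos)
    have "p t = exp (t - ln (1 + exp t))" using e by (simp add: p_def exp_diff)
    then have "complex_of_real (p t) ^ n = exp (of_nat n * of_real (t - ln (1 + exp t)))"
      by (simp only: exp_of_nat_mult exp_of_real)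
    then show ?thesis unfolding g_def by (simp add: exp_add[symmetric] algebra_simps)
  qed
  have bn: "Re (b + of_nat n) > 0" "Re (c + of_nat n - (b + of_nat n)) > 0" for n using b by auto
  have fi: "integrable lborel (f n)" for n
    unfolding f_def[abs_def] gp by (intro integrable_mult_right integrable_Beta_logistic bn)
  have fv: "(\<integral>t. f n t \<partial>lborel) = Gamma b * Gamma (c - b) *
      (pochhammer a n * pochhammer b n * rGamma (c + of_nat n) / fact n * x ^ n)" for n
  proof -
    have "Gamma (b + of_nat n) = pochhammer b n * Gamma b"
      using pochhammer_Gamma[OF not_nonpos_Ints_Re_pos[OF b(1)], of n] Gamma_nonzero_Re_pos[OF b(1)] by simp
    then show ?thesis
      unfolding f_def gp integral_mult_right_zero integral_Beta_logistic[OF bn] A_def by simp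
  qed
  have gi: "integrable lborel g"
    unfolding g_def[abs_def] by (rule integrable_Beta_logistic[OF b])
  have nf: "norm (f n t) \<le> norm (A n) * norm (g t)" for n t
  proof -
    have "p t ^ n \<le> 1" using p by (simp add: power_le_one)
    then have "norm (g t) * norm (of_real (p t) ^ n :: complex) \<le> norm (g t)"
      using p[of t] by (simp add: norm_power mult_left_le)
    then show ?thesis by (simp add: f_def norm_mult mult_left_mono)
  qed
  have sA: "summable (\<lambda>n. norm (A n))"
    unfolding A_def by (rule binomial_series_pochhammer[OF x])
  have sums: "(\<lambda>n. f n t) sums (g t * (1 - x * of_real (p t)) powr (- a))" for t
  proof -
    have "norm (x * of_real (p t)) < 1"
      using p[of t] x by (simp add: norm_mult) (metis mult_left_le norm_ge_zero order_le_less_trans)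
    from sums_mult[OF binomial_series_pochhammer(1)[OF this, of a], of "g t"] show ?thesis
      by (simp add: f_def A_def power_mult_distrib mult_ac)
  qed
  have "(\<lambda>n. \<integral>t. f n t \<partial>lborel) sums (\<integral>t. (\<Sum>n. f n t) \<partial>lborel)"
  proof (rule sums_integral[OF fi])
    show "AE t in lborel. summable (\<lambda>n. norm (f n t))"
      using nf by (intro AE_I2 summable_comparison_test[OF _ summable_mult2[OF sA]]) auto
    show "summable (\<lambda>n. \<integral>t. norm (f n t) \<partial>lborel)"
    proof (rule summable_comparison_test[OF _ summable_mult2[OF sA]], intro exI[of _ 0] allI impI)
      fix n
      have "(\<integral>t. norm (f n t) \<partial>lborel) \<le> (\<integral>t. norm (A n) * norm (g t) \<partial>lborel)"
        using fi gi nf by (intro integral_mono) auto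
      then show "norm (\<integral>t. norm (f n t) \<partial>lborel) \<le> norm (A n) * (\<integral>t. norm (g t) \<partial>lborel)"
        by simp
    qed
  qed
  also have "(\<integral>t. (\<Sum>n. f n t) \<partial>lborel) = hyp_int a b c x"
    unfolding hyp_int_def using sums by (simp add: sums_iff g_def p_def)
  finally have "(\<lambda>n. Gamma b * Gamma (c - b) *
      (pochhammer a n * pochhammer b n * rGamma (c + of_nat n) / fact n * x ^ n)) sums hyp_int a b c x"
    by (simp only: fv)
  then have eq: "(\<Sum>n. Gamma b * Gamma (c - b) *
      (pochhammer a n * pochhammer b n * rGamma (c + of_nat n) / fact n * x ^ n)) = hyp_int a b c x"
    and s: "summable (\<lambda>n. Gamma b * Gamma (c - b) *
      (pochhammer a n * pochhammer b n * rGamma (c + of_nat n) / fact n * x ^ n))"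
    by (simp_all only: sums_iff)
  have "Gamma b * Gamma (c - b) \<noteq> 0"
    using Gamma_nonzero_Re_pos b by simp
  then have "summable (\<lambda>n. pochhammer a n * pochhammer b n * rGamma (c + of_nat n) / fact n * x ^ n)"
    by (rule summable_mult_D[OF s])
  from suminf_mult[OF this, of "Gamma b * Gamma (c - b)"] eq show ?thesis by (simp only:)
qed

text \<open>\<open>hypergeom_reg\<close> is a choice, so nothing is known of it until some function
  has the defining property. Euler's integral is such a function, and the identity theorem from the
  unit disc shows that the choice agrees with it on the cut plane.\<close>

lemma
  assumes b: "Re b > 0" "Re (c - b) > 0"
  shows hypergeom_reg_eq_hyp_int: "\<And>x. x \<in> slit_plane \<Longrightarrow>
          hypergeom_reg a b c x = hyp_int a b c x / (Gamma b * Gamma (c - b))"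
    and hypergeom_reg_holomorphic: "hypergeom_reg a b c holomorphic_on slit_plane"
proof -
  define E where "E x = hyp_int a b c x / (Gamma b * Gamma (c - b))" for x
  define \<Phi> where "\<Phi> f \<longleftrightarrow> f holomorphic_on slit_plane \<and>
     (\<forall>x. norm x < 1 \<longrightarrow>
        f x = (\<Sum>n. pochhammer a n * pochhammer b n * rGamma (c + of_nat n) / fact n * x ^ n))" for f
  have nz: "Gamma b \<noteq> 0" "Gamma (c - b) \<noteq> 0"
    using Gamma_nonzero_Re_pos b by auto
  have E: "\<Phi> E"
    unfolding \<Phi>_def
  proof (intro conjI allI impI)
    show "E holomorphic_on slit_plane"
      unfolding E_def[abs_def] by (intro holomorphic_intros hyp_int_holomorphic[OF b]) (use nz in simp)
    show "E x = (\<Sum>n. pochhammer a n * pochhammer b n * rGamma (c + of_nat n) / fact n * x ^ n)" if "norm x < 1" for x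
      unfolding E_def hyp_int_series[OF b that] using nz by simp
  qed
  have "\<Phi> (hypergeom_reg a b c)"
    unfolding hypergeom_reg_def \<Phi>_def[symmetric] by (rule someI[of \<Phi>, OF E])
  then show hol: "hypergeom_reg a b c holomorphic_on slit_plane" unfolding \<Phi>_def by blast
  show "hypergeom_reg a b c x = hyp_int a b c x / (Gamma b * Gamma (c - b))" if "x \<in> slit_plane" for x
  proof (rule analytic_continuation_open[where s="ball 0 1" and s'=slit_plane and f="hypergeom_reg a b c" and z=x
        and g="\<lambda>x. hyp_int a b c x / (Gamma b * Gamma (c - b))"])
    show "ball 0 1 \<subseteq> slit_plane"
      by (auto simp: slit_plane_iff) (smt (verit) complex_Re_le_cmod)
    show "(\<lambda>x. hyp_int a b c x / (Gamma b * Gamma (c - b))) holomorphic_on slit_plane"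
      using E unfolding \<Phi>_def E_def by blast
    show "hypergeom_reg a b c z = hyp_int a b c z / (Gamma b * Gamma (c - b))" if "z \<in> ball 0 1" for z
      using E \<open>\<Phi> (hypergeom_reg a b c)\<close> that unfolding \<Phi>_def E_def by simp
  qed (use that hol open_slit_plane connected_slit_plane in auto)
qed

section \<open>Laplace integrals of the remainders\<close>

lemma holomorphic_on_compose_lambda:
  assumes f: "f holomorphic_on B" and g: "g holomorphic_on A" and sub: "\<And>z. z \<in> A \<Longrightarrow> g z \<in> B"
  shows "(\<lambda>z. f (g z)) holomorphic_on A"
proof -
  have "g ` A \<subseteq> B" using sub by blast
  from holomorphic_on_compose_gen[OF g f this] show ?thesis by (simp only: o_def)
qed

text \<open>The integral of t^(s-1) exp(-t) \<phi>(tx) \<psi>(ty) over t > 0, with t = exp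
  w.\<close>

definition Laplace_exp :: "complex \<Rightarrow> (complex \<Rightarrow> complex) \<Rightarrow> (complex \<Rightarrow> complex) \<Rightarrow> complex \<Rightarrow> complex \<Rightarrow> complex" where
  "Laplace_exp s \<phi> \<psi> x y = (\<integral>w. exp (s * of_real w - of_real (exp w)) * (\<phi> (of_real (exp w) * x) * \<psi> (of_real (exp w) * y)) \<partial>lborel)"

text \<open>For positive t the points tx and ty stay in the right half-plane, where \<phi> and
  \<psi> are bounded. The majorant is independent of x and y, which is what holomorphy in \<xi>
  rests on.\<close>

lemma
  assumes s: "Re s > 0"
    and \<phi>: "\<phi> holomorphic_on {z. Re z > 0}" "\<And>z. Re z > 0 \<Longrightarrow> norm (\<phi> z) \<le> A"
    and \<psi>: "\<psi> holomorphic_on {z. Re z > 0}" "\<And>z. Re z > 0 \<Longrightarrow> norm (\<psi> z) \<le> B"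
    and xy: "Re x > 0" "Re y > 0"
  shows Laplace_exp_measurable: "(\<lambda>w. exp (s * of_real w - of_real (exp w)) * (\<phi> (of_real (exp w) * x) * \<psi> (of_real (exp w) * y))) \<in> borel_measurable lborel" (is ?meas)
    and Laplace_exp_dominated: "norm (exp (s * of_real w - of_real (exp w)) * (\<phi> (of_real (exp w) * x) * \<psi> (of_real (exp w) * y)))
        \<le> norm (exp (s * of_real w - of_real (1 * exp w))) * (A * B)" (is ?dom)
    and Laplace_exp_integrable: "integrable lborel (\<lambda>w. exp (s * of_real w - of_real (exp w)) * (\<phi> (of_real (exp w) * x) * \<psi> (of_real (exp w) * y)))" (is ?int)
    and norm_Laplace_exp_le: "norm (Laplace_exp s \<phi> \<psi> x y) \<le> A * B * Gamma (Re s)" (is ?bound)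
proof -
  have pos: "Re (of_real (exp w) * z) > 0" if "Re z > 0" for w :: real and z
    using that by simp
  have cont: "continuous_on UNIV (\<lambda>w::real. f (of_real (exp w) * z))"
    if f: "f holomorphic_on {z. Re z > 0}" and z: "Re z > 0" for f z
    by (rule continuous_on_compose2[OF holomorphic_on_imp_continuous_on[OF f]])
       (use pos[OF z] in \<open>auto intro!: continuous_intros\<close>)
  have "continuous_on UNIV (\<lambda>w::real. exp (s * of_real w - of_real (exp w)))"
    by (intro continuous_intros)
  from continuous_on_mult[OF this continuous_on_mult[OF cont[OF \<phi>(1) xy(1)] cont[OF \<psi>(1) xy(2)]]]
  show meas: ?meas unfolding measurable_lborel2 by (rule borel_measurable_continuous_onI)
  have dom: "norm (exp (s * of_real w - of_real (exp w)) * (\<phi> (of_real (exp w) * x) * \<psi> (of_real (exp w) * y)))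
        \<le> norm (exp (s * of_real w - of_real (1 * exp w))) * (A * B)" for w :: real
    unfolding norm_mult mult_1_left
    using order.trans[OF norm_ge_zero \<phi>(2)[OF xy(1)]]
    by (intro mult_left_mono mult_mono \<phi>(2) \<psi>(2) pos xy norm_ge_zero)
  then show ?dom .
  have gi: "integrable lborel (\<lambda>w. norm (exp (s * of_real w - of_real (1 * exp w))) * (A * B))"
    by (intro integrable_mult_left integrable_norm integrable_Gamma_exp s) simp
  show int: ?int
    by (rule Bochner_Integration.integrable_bound[OF gi meas]) (rule AE_I2, rule order.trans[OF dom], simp only: real_norm_def abs_ge_self)
  have "norm (Laplace_exp s \<phi> \<psi> x y) \<le> (\<integral>w. norm (exp (s * of_real w - of_real (1 * exp w))) * (A * B) \<partial>lborel)"
    unfolding Laplace_exp_def by (rule Bochner_Integration.integral_norm_bound_integral[OF int gi dom])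
  also have "\<dots> = (\<integral>w. norm (exp (s * of_real w - of_real (1 * exp w))) \<partial>lborel) * (A * B)"
    by (rule integral_mult_left_zero)
  also have "(\<integral>w. norm (exp (s * of_real w - of_real (1 * exp w))) \<partial>lborel) = Gamma (Re s)"
  proof -
    have e: "complex_of_real (norm (exp (s * of_real w - of_real (1 * exp w)))) =
        exp (of_real (Re s) * of_real w - of_real (1 * exp w))" for w :: real
    proof -
      have "of_real (Re s) * of_real w - of_real (1 * exp w) = complex_of_real (Re s * w - 1 * exp w)" by simp
      then show ?thesis by (simp only: exp_of_real) simp
    qed
    have "complex_of_real (\<integral>w. norm (exp (s * of_real w - of_real (1 * exp w))) \<partial>lborel) = Gamma (of_real (Re s))"
      unfolding integral_complex_of_real[symmetric] e using s by (subst integral_Gamma_exp) simp_all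
    then show ?thesis by (simp only: Gamma_complex_of_real of_real_eq_iff)
  qed
  finally show ?bound by (simp only: mult.commute)
qed

lemma Laplace_exp_holomorphic:
  assumes s: "Re s > 0"
    and \<phi>: "\<phi> holomorphic_on {z. Re z > 0}" "\<And>z. Re z > 0 \<Longrightarrow> norm (\<phi> z) \<le> A"
    and \<psi>: "\<psi> holomorphic_on {z. Re z > 0}" "\<And>z. Re z > 0 \<Longrightarrow> norm (\<psi> z) \<le> B"
    and D: "open D" and x: "x holomorphic_on D" "\<And>\<xi>. \<xi> \<in> D \<Longrightarrow> Re (x \<xi>) > 0"
    and y: "y holomorphic_on D" "\<And>\<xi>. \<xi> \<in> D \<Longrightarrow> Re (y \<xi>) > 0"
  shows "(\<lambda>\<xi>. Laplace_exp s \<phi> \<psi> (x \<xi>) (y \<xi>)) holomorphic_on D"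
  unfolding Laplace_exp_def
proof (rule holomorphic_on_lebesgue_integral[OF D, where f="\<lambda>\<xi> w. exp (s * of_real w - of_real (exp w)) *
      (\<phi> (of_real (exp w) * x \<xi>) * \<psi> (of_real (exp w) * y \<xi>))"])
  show "(\<lambda>w. exp (s * of_real w - of_real (exp w)) * (\<phi> (of_real (exp w) * x \<xi>) * \<psi> (of_real (exp w) * y \<xi>)))
      \<in> borel_measurable lborel" if "\<xi> \<in> D" for \<xi>
    by (rule Laplace_exp_measurable[OF s \<phi> \<psi> x(2)[OF that] y(2)[OF that]])
  show "(\<lambda>\<xi>. exp (s * of_real w - of_real (exp w)) * (\<phi> (of_real (exp w) * x \<xi>) * \<psi> (of_real (exp w) * y \<xi>)))
      holomorphic_on D" for w :: real
  proof -
    have comp: "(\<lambda>\<xi>. f (of_real (exp w) * z \<xi>)) holomorphic_on D"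
      if f: "f holomorphic_on {z. Re z > 0}" and z: "z holomorphic_on D" "\<And>\<xi>. \<xi> \<in> D \<Longrightarrow> Re (z \<xi>) > 0" for f z
    proof -
      have "(\<lambda>\<xi>. of_real (exp w) * z \<xi>) holomorphic_on D" by (intro holomorphic_intros z(1))
      then show ?thesis
        by (rule holomorphic_on_compose_lambda[OF f]) (use z(2) in simp)
    qed
    show ?thesis by (intro holomorphic_intros comp \<phi> \<psi> x y)
  qed
  have gi: "integrable lborel (\<lambda>w. norm (exp (s * of_real w - of_real (1 * exp w))) * (A * B))"
    by (intro integrable_mult_left integrable_norm integrable_Gamma_exp s) simp
  have dom: "norm (exp (s * of_real w - of_real (exp w)) * (\<phi> (of_real (exp w) * x \<xi>) * \<psi> (of_real (exp w) * y \<xi>)))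
      \<le> norm (exp (s * of_real w - of_real (1 * exp w))) * (A * B)" if "\<xi> \<in> D" for \<xi> and w :: real
    by (rule Laplace_exp_dominated[OF s \<phi> \<psi> x(2)[OF that] y(2)[OF that]])
  show "\<exists>r>0. \<exists>g. integrable lborel g \<and> (\<forall>\<xi>'\<in>ball \<xi> r \<inter> D. \<forall>w\<in>space lborel.
      norm (exp (s * of_real w - of_real (exp w)) * (\<phi> (of_real (exp w) * x \<xi>') * \<psi> (of_real (exp w) * y \<xi>'))) \<le> g w)" for \<xi>
    by (intro exI[of _ 1] exI[of _ "\<lambda>w. norm (exp (s * of_real w - of_real (1 * exp w))) * (A * B)"] conjI ballI gi dom) simp_all
qed

section \<open>Coefficients and remainder in the variables x and y\<close>

definition g_xy :: "nat \<Rightarrow> complex \<Rightarrow> complex \<Rightarrow> complex \<Rightarrow> complex \<Rightarrow> complex" where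
  "g_xy n \<alpha> \<beta> x y = (\<Sum>l\<le>n. a_coeff l \<alpha> * a_coeff (n - l) \<beta> / (x ^ l * y ^ (n - l)))"

text \<open>Each summand carries the same power of t: t^(-l) from the l-th term in \<alpha> and
  t^(-(N-l)) from its remainder in \<beta>, or t^(-N) from the remainder in \<alpha> next to the
  unexpanded factor \<open>K_rem 0 \<beta>\<close>. Hence the single Laplace parameter \<sigma> - N
  + 1.\<close>

definition R_xy :: "nat \<Rightarrow> complex \<Rightarrow> complex \<Rightarrow> complex \<Rightarrow> complex \<Rightarrow> complex \<Rightarrow> complex" where
  "R_xy N \<sigma> \<alpha> \<beta> x y =
     (\<Sum>l<N. a_coeff l \<alpha> / (x ^ l * y ^ (N - l)) * Laplace_exp (\<sigma> - of_nat N + 1) (\<lambda>_. 1) (K_rem (N - l) \<beta>) x y)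
     + Laplace_exp (\<sigma> - of_nat N + 1) (K_rem N \<alpha>) (K_rem 0 \<beta>) x y / x ^ N"

lemma g_xy_swap: "g_xy n \<alpha> \<beta> x y = g_xy n \<beta> \<alpha> y x"
  unfolding g_xy_def
  by (rule sum.reindex_bij_witness[of _ "\<lambda>l. n - l" "\<lambda>l. n - l"]) (auto simp: mult.commute)

text \<open>Because the second factor is expanded to an order depending on the term of the first,
  exactly the products with l + m < N appear explicitly; grouped by n = l + m they are the
  coefficients \<open>g_xy n\<close>.\<close>

lemma integral_K_product_expand:
  fixes x y :: real
  assumes xy: "x > 0" "y > 0" and \<alpha>: "\<bar>Re \<alpha>\<bar> < real N + 1/2" and \<beta>: "\<bar>Re \<beta>\<bar> < 1/2"
    and \<sigma>: "Re \<sigma> + 1 > real N"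
  defines "F \<equiv> \<lambda>\<alpha> z. complex_of_real (sqrt (z / (2 * pi)) * exp z) * K_int \<alpha> z"
  shows "(\<integral>w. exp ((\<sigma> + 1) * of_real w - of_real (exp w)) * (F \<alpha> (exp w * x) * F \<beta> (exp w * y)) \<partial>lborel) =
     (\<Sum>n<N. g_xy n \<alpha> \<beta> (of_real x) (of_real y) * Gamma (\<sigma> - of_nat n + 1)) + R_xy N \<sigma> \<alpha> \<beta> (of_real x) (of_real y)"
proof -
  let ?x = "complex_of_real x" and ?y = "complex_of_real y"
  have xy': "Re ?x > 0" "Re ?y > 0" "?x \<noteq> 0" "?y \<noteq> 0" using xy by auto
  define A where "A n w = exp ((\<sigma> - of_nat n + 1) * of_real w - of_real (exp w))" for n and w :: real
  define r1 where "r1 l w = A N w * (1 * K_rem (N - l) \<beta> (of_real (exp w) * ?y))" for l w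
  define r2 where "r2 w = A N w * (K_rem N \<alpha> (of_real (exp w) * ?x) * K_rem 0 \<beta> (of_real (exp w) * ?y))" for w
  have \<beta>k: "\<bar>Re \<beta>\<bar> < real k + 1/2" for k using \<beta> by simp
  have Aexp: "exp ((\<sigma> + 1) * of_real w - of_real (exp w)) / of_real (exp w) ^ n = A n w" for n w
  proof -
    have "complex_of_real (exp w) ^ n = exp (of_nat n * of_real w)"
      by (simp only: exp_of_nat_mult exp_of_real)
    then show ?thesis unfolding A_def by (simp add: exp_diff[symmetric] algebra_simps)
  qed
  have expand: "exp ((\<sigma> + 1) * of_real w - of_real (exp w)) * (F \<alpha> (exp w * x) * F \<beta> (exp w * y)) =
    (\<Sum>n<N. g_xy n \<alpha> \<beta> ?x ?y * A n w) + ((\<Sum>l<N. a_coeff l \<alpha> / (?x ^ l * ?y ^ (N - l)) * r1 l w) + r2 w / ?x ^ N)" for w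
  proof -
    define t where "t = complex_of_real (exp w)"
    have t: "t \<noteq> 0" by (simp add: t_def)
    define E where "E = exp ((\<sigma> + 1) * of_real w - of_real (exp w))"
    have EA: "E / t ^ n = A n w" for n unfolding E_def t_def by (rule Aexp)
    have pos: "exp w * x > 0" "exp w * y > 0" using xy by auto
    have F\<alpha>: "F \<alpha> (exp w * x) = (\<Sum>l<N. a_coeff l \<alpha> / (t * ?x) ^ l) + K_rem N \<alpha> (t * ?x) / (t * ?x) ^ N"
      using K_int_expand[OF pos(1) \<alpha>] unfolding F_def t_def by simp
    \<comment> \<open>Stated for every order k: the l-th term uses k = N - l, the last summand k =
      0.\<close>
    have F\<beta>: "F \<beta> (exp w * y) = (\<Sum>m<k. a_coeff m \<beta> / (t * ?y) ^ m) + K_rem k \<beta> (t * ?y) / (t * ?y) ^ k" for k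
      using K_int_expand[OF pos(2) \<beta>k[of k]] unfolding F_def t_def by simp
    have "F \<alpha> (exp w * x) * F \<beta> (exp w * y) =
      (\<Sum>l<N. a_coeff l \<alpha> / (t * ?x) ^ l * F \<beta> (exp w * y)) + K_rem N \<alpha> (t * ?x) / (t * ?x) ^ N * F \<beta> (exp w * y)"
      unfolding F\<alpha> by (simp only: distrib_right sum_distrib_right)
    also have "(\<Sum>l<N. a_coeff l \<alpha> / (t * ?x) ^ l * F \<beta> (exp w * y)) =
       (\<Sum>l<N. (\<Sum>m<N-l. a_coeff l \<alpha> / (t * ?x) ^ l * (a_coeff m \<beta> / (t * ?y) ^ m)) +
          a_coeff l \<alpha> / (t * ?x) ^ l * (K_rem (N - l) \<beta> (t * ?y) / (t * ?y) ^ (N - l)))"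
      by (rule sum.cong[OF refl], subst F\<beta>, rule trans[OF distrib_left]) (simp only: sum_distrib_left)
    also have "\<dots> = (\<Sum>l<N. \<Sum>m<N-l. a_coeff l \<alpha> / (t * ?x) ^ l * (a_coeff m \<beta> / (t * ?y) ^ m)) +
          (\<Sum>l<N. a_coeff l \<alpha> / (t * ?x) ^ l * (K_rem (N - l) \<beta> (t * ?y) / (t * ?y) ^ (N - l)))"
      by (rule sum.distrib)
    also have "(\<Sum>l<N. \<Sum>m<N-l. a_coeff l \<alpha> / (t * ?x) ^ l * (a_coeff m \<beta> / (t * ?y) ^ m)) =
       (\<Sum>n<N. g_xy n \<alpha> \<beta> ?x ?y / t ^ n)"
    proof -
      let ?f = "\<lambda>l m. a_coeff l \<alpha> / (t * ?x) ^ l * (a_coeff m \<beta> / (t * ?y) ^ m)"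
      have "(\<Sum>l<N. \<Sum>m<N-l. ?f l m) = (\<Sum>(l,m)\<in>{(l,m). l + m < N}. ?f l m)"
        by (subst sum.Sigma) (auto intro!: sum.cong)
      also have "\<dots> = (\<Sum>n<N. \<Sum>l\<le>n. ?f l (n - l))"
        by (rule sum.triangle_reindex)
      also have "\<dots> = (\<Sum>n<N. g_xy n \<alpha> \<beta> ?x ?y / t ^ n)"
      proof (rule sum.cong[OF refl])
        fix n
        have "?f l (n - l) = a_coeff l \<alpha> * a_coeff (n - l) \<beta> / (?x ^ l * ?y ^ (n - l)) / t ^ n" if "l \<le> n" for l
        proof -
          have "t ^ n = t ^ l * t ^ (n - l)" using that by (simp add: power_add[symmetric])
          then show ?thesis by (simp add: power_mult_distrib)
        qed
        then show "(\<Sum>l\<le>n. ?f l (n - l)) = g_xy n \<alpha> \<beta> ?x ?y / t ^ n"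
          unfolding g_xy_def sum_divide_distrib by (intro sum.cong) auto
      qed
      finally show ?thesis .
    qed
    finally have prod: "F \<alpha> (exp w * x) * F \<beta> (exp w * y) = (\<Sum>n<N. g_xy n \<alpha> \<beta> ?x ?y / t ^ n) +
       (\<Sum>l<N. a_coeff l \<alpha> / (t * ?x) ^ l * (K_rem (N - l) \<beta> (t * ?y) / (t * ?y) ^ (N - l))) +
       K_rem N \<alpha> (t * ?x) / (t * ?x) ^ N * K_rem 0 \<beta> (t * ?y)"
      using F\<beta>[of 0] by simp
    have 1: "E * (\<Sum>n<N. g_xy n \<alpha> \<beta> ?x ?y / t ^ n) = (\<Sum>n<N. g_xy n \<alpha> \<beta> ?x ?y * A n w)"
      unfolding EA[symmetric] sum_distrib_left by (rule sum.cong) simp_all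
    have 2: "E * (\<Sum>l<N. a_coeff l \<alpha> / (t * ?x) ^ l * (K_rem (N - l) \<beta> (t * ?y) / (t * ?y) ^ (N - l))) =
      (\<Sum>l<N. a_coeff l \<alpha> / (?x ^ l * ?y ^ (N - l)) * r1 l w)"
      unfolding sum_distrib_left
    proof (rule sum.cong[OF refl])
      fix l assume "l \<in> {..<N}"
      then have "t ^ N = t ^ l * t ^ (N - l)" by (simp add: power_add[symmetric])
      then show "E * (a_coeff l \<alpha> / (t * ?x) ^ l * (K_rem (N - l) \<beta> (t * ?y) / (t * ?y) ^ (N - l))) =
         a_coeff l \<alpha> / (?x ^ l * ?y ^ (N - l)) * r1 l w"
        unfolding r1_def EA[symmetric] t_def[symmetric] by (simp add: power_mult_distrib mult_ac)
    qed
    have 3: "E * (K_rem N \<alpha> (t * ?x) / (t * ?x) ^ N * K_rem 0 \<beta> (t * ?y)) = r2 w / ?x ^ N"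
      unfolding r2_def EA[symmetric] t_def[symmetric] by (simp add: power_mult_distrib mult_ac)
    show ?thesis unfolding prod E_def[symmetric] distrib_left 1 2 3 by (rule add.assoc)
  qed
  have Aint: "integrable lborel (A n)" "integral\<^sup>L lborel (A n) = Gamma (\<sigma> - of_nat n + 1)" if "n < N" for n
  proof -
    have "Re (\<sigma> - of_nat n + 1) > 0" using that \<sigma> by simp
    from integrable_Gamma_exp[OF this, of 1] integral_Gamma_exp[OF this, of 1]
    show "integrable lborel (A n)" "integral\<^sup>L lborel (A n) = Gamma (\<sigma> - of_nat n + 1)"
      unfolding A_def[abs_def] by simp_all
  qed
  have s: "Re (\<sigma> - of_nat N + 1) > 0" using \<sigma> by simp
  have one: "(\<lambda>_. 1 :: complex) holomorphic_on {z. Re z > 0}" "\<And>z. Re z > 0 \<Longrightarrow> norm (1::complex) \<le> 1" by simp_all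
  have r1: "integrable lborel (r1 l)" for l
    unfolding r1_def[abs_def] A_def
    by (rule Laplace_exp_integrable[OF s one K_rem_holomorphic[OF \<beta>k] norm_K_rem_le[OF _ \<beta>k] xy'(1,2)])
  have r1': "integral\<^sup>L lborel (r1 l) = Laplace_exp (\<sigma> - of_nat N + 1) (\<lambda>_. 1) (K_rem (N - l) \<beta>) ?x ?y" for l
    unfolding r1_def[abs_def] A_def Laplace_exp_def ..
  have r2: "integrable lborel r2"
    unfolding r2_def[abs_def] A_def
    by (rule Laplace_exp_integrable[OF s K_rem_holomorphic[OF \<alpha>] norm_K_rem_le[OF _ \<alpha>]
          K_rem_holomorphic[OF \<beta>k] norm_K_rem_le[OF _ \<beta>k] xy'(1,2)])
  have r2': "integral\<^sup>L lborel r2 = Laplace_exp (\<sigma> - of_nat N + 1) (K_rem N \<alpha>) (K_rem 0 \<beta>) ?x ?y"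
    unfolding r2_def[abs_def] A_def Laplace_exp_def ..
  have "(\<integral>w. (\<Sum>n<N. g_xy n \<alpha> \<beta> ?x ?y * A n w) + ((\<Sum>l<N. a_coeff l \<alpha> / (?x ^ l * ?y ^ (N - l)) * r1 l w) + r2 w / ?x ^ N) \<partial>lborel) =
    (\<Sum>n<N. g_xy n \<alpha> \<beta> ?x ?y * Gamma (\<sigma> - of_nat n + 1)) + R_xy N \<sigma> \<alpha> \<beta> ?x ?y"
  proof -
    have i1: "integrable lborel (\<lambda>w. \<Sum>n<N. g_xy n \<alpha> \<beta> ?x ?y * A n w)"
      by (intro Bochner_Integration.integrable_sum integrable_mult_right Aint) simp
    have i2: "integrable lborel (\<lambda>w. \<Sum>l<N. a_coeff l \<alpha> / (?x ^ l * ?y ^ (N - l)) * r1 l w)"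
      by (intro Bochner_Integration.integrable_sum integrable_mult_right r1)
    have i3: "integrable lborel (\<lambda>w. r2 w / ?x ^ N)" by (intro integrable_divide r2)
    have v1: "(\<integral>w. (\<Sum>n<N. g_xy n \<alpha> \<beta> ?x ?y * A n w) \<partial>lborel) = (\<Sum>n<N. g_xy n \<alpha> \<beta> ?x ?y * Gamma (\<sigma> - of_nat n + 1))"
      using Aint by (subst Bochner_Integration.integral_sum) (auto intro!: sum.cong integrable_mult_right)
    have v2: "(\<integral>w. (\<Sum>l<N. a_coeff l \<alpha> / (?x ^ l * ?y ^ (N - l)) * r1 l w) \<partial>lborel) =
        (\<Sum>l<N. a_coeff l \<alpha> / (?x ^ l * ?y ^ (N - l)) * Laplace_exp (\<sigma> - of_nat N + 1) (\<lambda>_. 1) (K_rem (N - l) \<beta>) ?x ?y)"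
      by (subst Bochner_Integration.integral_sum) (intro integrable_mult_right r1, simp only: integral_mult_right_zero r1')
    have v3: "(\<integral>w. r2 w / ?x ^ N \<partial>lborel) = Laplace_exp (\<sigma> - of_nat N + 1) (K_rem N \<alpha>) (K_rem 0 \<beta>) ?x ?y / ?x ^ N"
      by (simp only: integral_divide_zero r2')
    show ?thesis
      unfolding Bochner_Integration.integral_add[OF i1 Bochner_Integration.integrable_add[OF i2 i3]]
        Bochner_Integration.integral_add[OF i2 i3] v1 v2 v3 R_xy_def ..
  qed
  then show ?thesis unfolding expand .
qed

lemma R_xy_holomorphic:
  assumes \<alpha>: "\<bar>Re \<alpha>\<bar> < real N + 1/2" and \<beta>: "\<bar>Re \<beta>\<bar> < 1/2" and \<sigma>: "Re \<sigma> + 1 > real N"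
    and D: "open D" and x: "x holomorphic_on D" "\<And>\<xi>. \<xi> \<in> D \<Longrightarrow> Re (x \<xi>) > 0"
    and y: "y holomorphic_on D" "\<And>\<xi>. \<xi> \<in> D \<Longrightarrow> Re (y \<xi>) > 0"
  shows "(\<lambda>\<xi>. R_xy N \<sigma> \<alpha> \<beta> (x \<xi>) (y \<xi>)) holomorphic_on D"
proof -
  have s: "Re (\<sigma> - of_nat N + 1) > 0" using \<sigma> by simp
  have \<beta>k: "\<bar>Re \<beta>\<bar> < real k + 1/2" for k using \<beta> by simp
  have one: "(\<lambda>_. 1 :: complex) holomorphic_on {z. Re z > 0}" "\<And>z. Re z > 0 \<Longrightarrow> norm (1::complex) \<le> 1" by simp_all
  have L1: "(\<lambda>\<xi>. Laplace_exp (\<sigma> - of_nat N + 1) (\<lambda>_. 1) (K_rem (N - l) \<beta>) (x \<xi>) (y \<xi>)) holomorphic_on D" for l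
    by (rule Laplace_exp_holomorphic[OF s one K_rem_holomorphic[OF \<beta>k] norm_K_rem_le[OF _ \<beta>k] D x y])
  have L2: "(\<lambda>\<xi>. Laplace_exp (\<sigma> - of_nat N + 1) (K_rem N \<alpha>) (K_rem 0 \<beta>) (x \<xi>) (y \<xi>)) holomorphic_on D"
    by (rule Laplace_exp_holomorphic[OF s K_rem_holomorphic[OF \<alpha>] norm_K_rem_le[OF _ \<alpha>] K_rem_holomorphic[OF \<beta>k] norm_K_rem_le[OF _ \<beta>k] D x y])
  have nz: "x \<xi> \<noteq> 0" "y \<xi> \<noteq> 0" if "\<xi> \<in> D" for \<xi> using x(2)[OF that] y(2)[OF that] by auto
  show ?thesis
    unfolding R_xy_def by (intro holomorphic_intros L1 L2 x(1) y(1)) (simp_all add: nz)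
qed

section \<open>The identity on the strip\<close>

lemma open_domD: "open domD" and convex_domD: "convex domD"
proof -
  have D: "domD = {\<xi>. Re \<xi> > 0} \<inter> ({\<xi>. Im \<xi> < pi / 2} \<inter> {\<xi>. Im \<xi> > - (pi / 2)})"
    by (auto simp: domD_def)
  show "open domD"
    unfolding D by (intro open_Int open_halfspace_Re_gt open_halfspace_Im_lt open_halfspace_Im_gt)
  show "convex domD"
    unfolding D by (intro convex_Int convex_halfspace_Re_gt convex_halfspace_Im_lt convex_halfspace_Im_gt)
qed

lemma of_real_in_domD: "t > 0 \<Longrightarrow> of_real t \<in> domD"
  by (simp add: domD_def)

text \<open>The real parts are sinh(Re \<xi>) cos(Im \<xi>) and cosh(Re \<xi>) cos(Im \<xi>).
  Positivity makes the principal logarithms of sinh and cosh holomorphic on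
  \<open>domD\<close>.\<close>

lemma
  assumes "\<xi> \<in> domD"
  shows Re_sinh_pos: "Re (sinh \<xi>) > 0" and Re_cosh_pos: "Re (cosh \<xi>) > 0"
proof -
  have c: "cos (Im \<xi>) > 0" using assms by (intro cos_gt_zero_pi) (auto simp: domD_def)
  have e: "exp (Re \<xi>) > exp (- Re \<xi>)" using assms by (simp add: domD_def)
  have "Re (sinh \<xi>) = (exp (Re \<xi>) - exp (- Re \<xi>)) / 2 * cos (Im \<xi>)"
    unfolding sinh_field_def by (simp add: Re_exp algebra_simps)
  also have "\<dots> > 0" using c e by (intro mult_pos_pos) auto
  finally show "Re (sinh \<xi>) > 0" .
  have "Re (cosh \<xi>) = (exp (Re \<xi>) + exp (- Re \<xi>)) / 2 * cos (Im \<xi>)"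
    unfolding cosh_field_def by (simp add: Re_exp algebra_simps)
  also have "\<dots> > 0" using c by (intro mult_pos_pos) (auto simp: add_pos_pos)
  finally show "Re (cosh \<xi>) > 0" .
qed

lemma holomorphic_on_sinh_cosh:
  "sinh holomorphic_on (A :: complex set)" "cosh holomorphic_on (A :: complex set)"
  unfolding sinh_field_def[abs_def] cosh_field_def[abs_def] by (intro holomorphic_intros; simp)+

text \<open>Two continuous logarithms of one function differ by integer multiples of 2 pi i, hence
  by a constant on a connected set; it is 0 at \<xi> = 1. So any explicit branch determines the
  chosen one.\<close>

lemma log_D_eq:
  assumes L: "continuous_on domD L" "\<And>\<xi>. \<xi> \<in> domD \<Longrightarrow> exp (L \<xi>) = f \<xi>"
    "\<And>x::real. x > 0 \<Longrightarrow> L (of_real x) = of_real (ln (Re (f (of_real x))))"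
    and \<xi>: "\<xi> \<in> domD"
  shows "log_D f \<xi> = L \<xi>"
proof -
  have "continuous_on domD (log_D f) \<and> (\<forall>\<xi>\<in>domD. exp (log_D f \<xi>) = f \<xi>) \<and>
     (\<forall>x::real. x > 0 \<longrightarrow> log_D f (of_real x) = of_real (ln (Re (f (of_real x)))))"
    unfolding log_D_def
    by (rule someI[of "\<lambda>L. continuous_on domD L \<and> (\<forall>\<xi>\<in>domD. exp (L \<xi>) = f \<xi>) \<and>
     (\<forall>x::real. x > 0 \<longrightarrow> L (of_real x) = of_real (ln (Re (f (of_real x)))))" L]) (use L in blast)
  then have L': "continuous_on domD (log_D f)" "\<And>\<xi>. \<xi> \<in> domD \<Longrightarrow> exp (log_D f \<xi>) = f \<xi>"
    "\<And>x::real. x > 0 \<Longrightarrow> log_D f (of_real x) = of_real (ln (Re (f (of_real x))))"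
    by auto
  define d where "d z = log_D f z - L z" for z
  have "d constant_on domD"
  proof (rule continuous_discrete_range_constant)
    show "connected domD" by (rule convex_connected[OF convex_domD])
    show "continuous_on domD d" unfolding d_def[abs_def] by (intro continuous_intros L(1) L'(1))
    fix x assume x: "x \<in> domD"
    \<comment> \<open>Distinct values are at least 2 pi apart; the gap 1 is enough for a discrete
      range.\<close>
    have "1 \<le> norm (d y - d x)" if y: "y \<in> domD" "d y \<noteq> d x" for y
    proof -
      have "exp (log_D f z) = exp (L z)" if "z \<in> domD" for z
        using L(2)[OF that] L'(2)[OF that] by simp
      then have "exp (d z) = 1" if "z \<in> domD" for z
        using that by (simp add: d_def exp_diff)
      then have "exp (d y) = exp (d x)" using x y by simp
      then obtain n :: int where n: "d y = d x + (of_int (2 * n) * pi) * \<i>"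
        unfolding exp_eq by blast
      then have "n \<noteq> 0" using y by auto
      then have "1 * 1 \<le> (2 * \<bar>of_int n\<bar>) * pi"
        using pi_ge_two by (intro mult_mono) auto
      then show ?thesis by (simp add: n norm_mult)
    qed
    then show "\<exists>e>0. \<forall>y. y \<in> domD \<and> d y \<noteq> d x \<longrightarrow> e \<le> norm (d y - d x)"
      by (intro exI[of _ 1]) auto
  qed
  then obtain c where c: "\<And>z. z \<in> domD \<Longrightarrow> d z = c" unfolding constant_on_def by blast
  have "d (of_real 1) = 0" unfolding d_def using L(3)[of 1] L'(3)[of 1] by simp
  then have "d \<xi> = 0" using c[OF \<xi>] c[OF of_real_in_domD[of 1]] by simp
  then show ?thesis by (simp add: d_def)
qed

lemma sinh_cosh_of_real:
  "sinh (complex_of_real t) = of_real (sinh t)" "cosh (complex_of_real t) = of_real (cosh t)"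
  unfolding sinh_field_def cosh_field_def by (simp_all flip: exp_of_real)

lemma holomorphic_log_branch:
  assumes f: "f holomorphic_on domD" "\<And>\<xi>. \<xi> \<in> domD \<Longrightarrow> Re (f \<xi>) > 0"
  shows "(\<lambda>\<xi>. - \<xi> - Ln (f \<xi>)) holomorphic_on domD"
  by (intro holomorphic_intros f(1)) (auto simp: complex_nonpos_Reals_iff dest!: f(2))

lemma
  assumes \<xi>: "\<xi> \<in> domD"
  shows pow_D_Xm: "pow_D Xm s \<xi> = exp (s * (- \<xi> - Ln (sinh \<xi>)))"
    and pow_D_Ym: "pow_D Ym s \<xi> = exp (s * (- \<xi> - Ln (cosh \<xi>)))"
proof -
  have key: "log_D (\<lambda>\<xi>. exp (- \<xi>) / f \<xi>) \<xi> = - \<xi> - Ln (f \<xi>)"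
    if f: "f holomorphic_on domD" "\<And>\<xi>. \<xi> \<in> domD \<Longrightarrow> Re (f \<xi>) > 0"
      and r: "\<And>t. f (of_real t) = of_real (r t)" for f and r :: "real \<Rightarrow> real"
  proof (rule log_D_eq[OF _ _ _ \<xi>])
    show "continuous_on domD (\<lambda>\<xi>. - \<xi> - Ln (f \<xi>))"
      by (rule holomorphic_on_imp_continuous_on[OF holomorphic_log_branch[OF f]])
    show "exp (- \<xi> - Ln (f \<xi>)) = exp (- \<xi>) / f \<xi>" if "\<xi> \<in> domD" for \<xi>
    proof -
      have "f \<xi> \<noteq> 0" using f(2)[OF that] by auto
      then show ?thesis by (simp add: exp_diff exp_Ln)
    qed
    fix t :: real assume t: "t > 0"
    have rt: "r t > 0" using f(2)[OF of_real_in_domD[OF t]] by (simp add: r)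
    have "exp (- of_real t) / f (of_real t) = complex_of_real (exp (- t) / r t)"
      by (simp add: r flip: exp_of_real)
    moreover have "ln (exp (- t) / r t) = - t - ln (r t)" using rt by (simp add: ln_div)
    ultimately show "- of_real t - Ln (f (of_real t)) = of_real (ln (Re (exp (- of_real t) / f (of_real t))))"
      using rt by (simp add: r Ln_of_real)
  qed
  show "pow_D Xm s \<xi> = exp (s * (- \<xi> - Ln (sinh \<xi>)))"
    unfolding pow_D_def Xm_def[abs_def]
    by (subst key[OF holomorphic_on_sinh_cosh(1) Re_sinh_pos sinh_cosh_of_real(1)]) simp_all
  show "pow_D Ym s \<xi> = exp (s * (- \<xi> - Ln (cosh \<xi>)))"
    unfolding pow_D_def Ym_def[abs_def]
    by (subst key[OF holomorphic_on_sinh_cosh(2) Re_cosh_pos sinh_cosh_of_real(2)]) simp_all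
qed

text \<open>The reciprocal of \<open>Xp\<close>, written as a product so that it is visibly entire.
  It equals (1 - exp(-2 \<xi>))/2, and it adds up to 1 with the corresponding
  \<open>y_of\<close>.\<close>

definition x_of :: "complex \<Rightarrow> complex" where "x_of \<xi> = sinh \<xi> * exp (- \<xi>)"
definition y_of :: "complex \<Rightarrow> complex" where "y_of \<xi> = cosh \<xi> * exp (- \<xi>)"

lemma
  assumes "\<xi> \<in> domD"
  shows Re_x_of_pos: "Re (x_of \<xi>) > 0" and Re_y_of_pos: "Re (y_of \<xi>) > 0"
proof -
  have x: "x_of \<xi> = (1 - exp (- 2 * \<xi>)) / 2" and y: "y_of \<xi> = (1 + exp (- 2 * \<xi>)) / 2"
    by (simp_all add: x_of_def y_of_def sinh_field_def cosh_field_def algebra_simps mult_exp_exp)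
  have "norm (exp (- 2 * \<xi>)) < 1" using assms by (simp add: domD_def)
  then have "\<bar>Re (exp (- 2 * \<xi>))\<bar> < 1" using abs_Re_le_cmod order_le_less_trans by blast
  then show "Re (x_of \<xi>) > 0" "Re (y_of \<xi>) > 0"
    unfolding x y by (simp_all add: abs_less_iff)
qed

lemma x_of_y_of_holomorphic: "x_of holomorphic_on A" "y_of holomorphic_on A"
  unfolding x_of_def[abs_def] y_of_def[abs_def] by (intro holomorphic_intros holomorphic_on_sinh_cosh)+

lemma Xp_Yp_eq: "Xp \<xi> = 1 / x_of \<xi>" "Yp \<xi> = 1 / y_of \<xi>"
  unfolding Xp_def Yp_def x_of_def y_of_def by (simp_all add: exp_minus divide_inverse mult.commute)

lemma g_coeff_eq: "g_coeff n \<xi> \<alpha> \<beta> = g_xy n \<alpha> \<beta> (x_of \<xi>) (y_of \<xi>)"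
  unfolding g_coeff_def g_xy_def Xp_Yp_eq by (simp add: power_one_over)

section \<open>Holomorphy of both sides of the identity\<close>

text \<open>Serves for cosh(2 \<xi>) - 1 and cosh(2 \<xi>) + 1, which are twice the squares of sinh
  \<xi> and cosh \<xi>: their principal powers are holomorphic on \<open>domD\<close>.\<close>

lemma square_Re_pos:
  assumes "Re s > 0"
  shows "s\<^sup>2 \<notin> \<real>\<^sub>\<le>\<^sub>0" "2 * s\<^sup>2 \<notin> \<real>\<^sub>\<le>\<^sub>0"
  using assms by (auto simp: complex_nonpos_Reals_iff power2_eq_square mult_le_0_iff)

lemma cosh_double_complex:
  "cosh (2 * \<xi>) - 1 = 2 * (sinh \<xi>)\<^sup>2" "cosh (2 * \<xi>) + 1 = 2 * (cosh \<xi>)\<^sup>2" for \<xi> :: complex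
  by (simp_all add: cosh_double_cosh sinh_square_eq)

text \<open>The argument is -1/sinh(\<xi>)^2; a real value of at least 1 would make sinh(\<xi>)^2
  negative.\<close>

lemma hypergeom_arg_in_slit_plane:
  assumes "\<xi> \<in> domD"
  shows "2 / (1 - cosh (2 * \<xi>)) \<in> slit_plane"
proof (rule ccontr)
  assume "2 / (1 - cosh (2 * \<xi>)) \<notin> slit_plane"
  then obtain r :: real where r: "2 / (1 - cosh (2 * \<xi>)) = of_real r" "r \<ge> 1"
    unfolding slit_plane_def by auto
  define q where "q = 2 * (sinh \<xi>)\<^sup>2"
  have q: "q \<noteq> 0" unfolding q_def using Re_sinh_pos[OF assms] by auto
  have "1 - cosh (2 * \<xi>) = - q"
    using cosh_double_complex(1)[of \<xi>] by (simp add: q_def algebra_simps)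
  then have "2 / (- q) = of_real r" using r(1) by simp
  then have "q = - 2 / of_real r" using q r(2) by (auto simp: divide_simps mult.commute)
  then have "2 * (sinh \<xi>)\<^sup>2 = of_real (- 2 / r)" by (simp add: q_def)
  moreover have "complex_of_real (- 2 / r) \<in> \<real>\<^sub>\<le>\<^sub>0"
    using r unfolding complex_nonpos_Reals_iff by (simp add: divide_nonpos_pos)
  ultimately show False using square_Re_pos(2)[OF Re_sinh_pos[OF assms]] by simp
qed

definition Q_lhs :: "complex \<Rightarrow> complex \<Rightarrow> complex \<Rightarrow> complex \<Rightarrow> complex" where
  "Q_lhs \<nu> \<alpha> \<beta> \<xi> = 2 powr (2 * \<nu> + \<alpha> + \<beta> + 1) / of_real pi * Beta (\<nu> + 1) (\<nu> + \<alpha> + \<beta> + 1)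
     * jacobi_Q \<nu> \<alpha> \<beta> (cosh (2 * \<xi>))"

definition Q_prefix :: "complex \<Rightarrow> complex \<Rightarrow> complex \<Rightarrow> complex \<Rightarrow> complex" where
  "Q_prefix \<nu> \<alpha> \<beta> \<xi> = pow_D Xm (\<alpha> + 1/2) \<xi> * pow_D Ym (\<beta> + 1/2) \<xi> * exp (- 2 * \<nu> * \<xi>)"

lemma Q_prefix_holomorphic: "Q_prefix \<nu> \<alpha> \<beta> holomorphic_on domD"
proof -
  have "(\<lambda>\<xi>. exp ((\<alpha> + 1/2) * (- \<xi> - Ln (sinh \<xi>))) * exp ((\<beta> + 1/2) * (- \<xi> - Ln (cosh \<xi>))) * exp (- 2 * \<nu> * \<xi>)) holomorphic_on domD"
    by (intro holomorphic_intros holomorphic_log_branch[OF holomorphic_on_sinh_cosh(1) Re_sinh_pos]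
        holomorphic_log_branch[OF holomorphic_on_sinh_cosh(2) Re_cosh_pos])
  then show ?thesis
    by (rule holomorphic_transform) (simp add: Q_prefix_def pow_D_Xm pow_D_Ym)
qed

text \<open>Allows the prefactor to be cancelled, so that the defining equation determines
  R.\<close>

lemma Q_prefix_nonzero: "Q_prefix \<nu> \<alpha> \<beta> \<xi> \<noteq> 0"
  by (simp add: Q_prefix_def pow_D_def)

lemma Q_lhs_holomorphic:
  assumes "Re (\<nu> + \<alpha> + 1) > 0" "Re (\<nu> + \<beta> + 1) > 0"
  shows "Q_lhs \<nu> \<alpha> \<beta> holomorphic_on domD"
proof -
  have c: "(\<lambda>\<xi>. cosh (2 * \<xi>)) holomorphic_on domD"
    by (rule holomorphic_on_compose_lambda[OF holomorphic_on_sinh_cosh(2)[of UNIV]]) (auto intro!: holomorphic_intros)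
  have nz: "1 - cosh (2 * \<xi>) \<noteq> 0" if "\<xi> \<in> domD" for \<xi>
  proof
    assume "1 - cosh (2 * \<xi>) = 0"
    then have "sinh \<xi> = 0" using cosh_double_complex(1)[of \<xi>] by simp
    then show False using Re_sinh_pos[OF that] by simp
  qed
  have h: "(\<lambda>\<xi>. hypergeom_reg (\<nu> + 1) (\<nu> + \<alpha> + 1) (2 * \<nu> + \<alpha> + \<beta> + 2) (2 / (1 - cosh (2 * \<xi>)))) holomorphic_on domD"
  proof (rule holomorphic_on_compose_lambda[OF hypergeom_reg_holomorphic])
    show "(\<lambda>\<xi>. 2 / (1 - cosh (2 * \<xi>))) holomorphic_on domD"
      by (intro holomorphic_intros c nz)
  qed (use assms hypergeom_arg_in_slit_plane in auto)
  have p: "(\<lambda>\<xi>. (cosh (2 * \<xi>) - 1) powr s) holomorphic_on domD" for s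
    using square_Re_pos(2)[OF Re_sinh_pos] by (intro holomorphic_intros c) (simp add: cosh_double_complex)
  have q: "(\<lambda>\<xi>. (cosh (2 * \<xi>) + 1) powr s) holomorphic_on domD" for s
    using square_Re_pos(2)[OF Re_cosh_pos] by (intro holomorphic_intros c) (simp add: cosh_double_complex)
  have nz': "(cosh (2 * \<xi>) - 1) powr s * (cosh (2 * \<xi>) + 1) powr s' \<noteq> 0" if "\<xi> \<in> domD" for \<xi> s s'
    using Re_sinh_pos[OF that] Re_cosh_pos[OF that] by (auto simp: cosh_double_complex)
  show ?thesis
    unfolding Q_lhs_def[abs_def] jacobi_Q_def
    by (rule holomorphic_on_mult[OF holomorphic_on_const holomorphic_on_mult[OF
          holomorphic_on_divide[OF holomorphic_on_const holomorphic_on_mult[OF p q] nz'] h]])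
qed

section \<open>The identity for positive arguments and its continuation\<close>

definition K_product_integral :: "complex \<Rightarrow> complex \<Rightarrow> complex \<Rightarrow> real \<Rightarrow> real \<Rightarrow> complex" where
  "K_product_integral \<sigma> \<alpha> \<beta> x y = (\<integral>w. exp ((\<sigma> + 1) * of_real w - of_real (exp w)) *
     ((of_real (sqrt (exp w * x / (2 * pi)) * exp (exp w * x)) * K_int \<alpha> (exp w * x)) *
      (of_real (sqrt (exp w * y / (2 * pi)) * exp (exp w * y)) * K_int \<beta> (exp w * y))) \<partial>lborel)"

lemma K_product_integral_swap: "K_product_integral \<sigma> \<alpha> \<beta> x y = K_product_integral \<sigma> \<beta> \<alpha> y x"
  unfolding K_product_integral_def by (simp only: mult.commute)

text \<open>With t = exp w, exp(tx) exp(ty) cancels exp(-t) because x + y = 1, and the two square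
  roots contribute t sqrt(xy)/(2 pi), which raises the exponent of t from \<sigma> + 1 = c - 1 to
  c.\<close>

lemma K_product_integral_eq:
  fixes a b c :: complex and x y :: real
  assumes a: "Re a > 0" "Re (c - a) > 0" and b: "Re b > 0" "Re (c - b) > 0"
    and xy: "x > 0" "y > 0" "x + y = 1"
  shows "K_product_integral (c - 2) (b - a) (c - a - b) x y =
    exp ((of_real (ln x) + of_real (ln y)) / 2) / (2 * of_real pi) * (Gamma (c - a) * Gamma a *
     (exp (c * of_real (ln 2) + b * (of_real (ln y) - of_real (ln x)) - (c - a) * of_real (ln y) - a * of_real (ln x)) / 2 *
     hyp_int a b c (of_real (1 - (y / x)\<^sup>2))))"
proof -
  define q where "q = sqrt (x * y) / (2 * pi)"
  have q: "complex_of_real q = exp ((of_real (ln x) + of_real (ln y)) / 2) / (2 * of_real pi)"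
  proof -
    have "sqrt (x * y) = exp ((ln x + ln y) / 2)"
      using xy by (simp add: ln_sqrt[symmetric] ln_mult_pos[symmetric])
    moreover have "complex_of_real (exp ((ln x + ln y) / 2)) = exp ((of_real (ln x) + of_real (ln y)) / 2)"
      by (simp flip: exp_of_real)
    ultimately show ?thesis by (simp add: q_def)
  qed
  have "exp ((c - 2 + 1) * of_real w - of_real (exp w)) *
     ((of_real (sqrt (exp w * x / (2 * pi)) * exp (exp w * x)) * K_int (b - a) (exp w * x)) *
      (of_real (sqrt (exp w * y / (2 * pi)) * exp (exp w * y)) * K_int (c - a - b) (exp w * y))) =
     of_real q * (exp (c * of_real w) * (K_int (b - a) (exp w * x) * K_int (c - a - b) (exp w * y)))" for w
  proof -
    have "sqrt (exp w * x / (2 * pi)) * sqrt (exp w * y / (2 * pi)) = sqrt ((exp w / (2 * pi))\<^sup>2 * (x * y))"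
      unfolding real_sqrt_mult[symmetric] by (simp add: power2_eq_square)
    also have "\<dots> = exp w * q"
      unfolding real_sqrt_mult q_def by simp
    finally have sq: "sqrt (exp w * x / (2 * pi)) * sqrt (exp w * y / (2 * pi)) = exp w * q" .
    have ex: "exp (exp w * x) * exp (exp w * y) = exp (exp w)"
      using xy(3) by (simp add: mult_exp_exp distrib_left[symmetric])
    have eq1: "exp ((c - 2 + 1) * of_real w - of_real (exp w)) * complex_of_real (exp w) * complex_of_real (exp (exp w)) = exp (c * of_real w)"
      by (simp only: exp_of_real[symmetric] exp_add[symmetric]) (simp add: algebra_simps)
    have eq2: "complex_of_real (sqrt (exp w * x / (2 * pi)) * exp (exp w * x)) * of_real (sqrt (exp w * y / (2 * pi)) * exp (exp w * y)) =
       of_real (exp w) * of_real q * of_real (exp (exp w))"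
    proof -
      have "(sqrt (exp w * x / (2 * pi)) * exp (exp w * x)) * (sqrt (exp w * y / (2 * pi)) * exp (exp w * y)) =
        (sqrt (exp w * x / (2 * pi)) * sqrt (exp w * y / (2 * pi))) * (exp (exp w * x) * exp (exp w * y))"
        by (simp only: mult_ac)
      also have "\<dots> = exp w * q * exp (exp w)" by (simp only: sq ex)
      finally show ?thesis by (simp only: of_real_mult[symmetric])
    qed
    have reorder: "E * ((A * k1) * (B * k2)) = E * (A * B) * (k1 * k2)" for E A B k1 k2 :: complex
      by (simp only: mult_ac)
    have reorder': "E * (u * r * v) * l = r * ((E * u * v) * l)" for E u r v l :: complex by (simp only: mult_ac)
    show ?thesis unfolding reorder eq2 reorder' eq1 ..
  qed
  then have "K_product_integral (c - 2) (b - a) (c - a - b) x y =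
     of_real q * (\<integral>w. exp (c * of_real w) * (K_int (b - a) (exp w * x) * K_int (c - a - b) (exp w * y)) \<partial>lborel)"
    unfolding K_product_integral_def by (simp only: integral_mult_right_zero)
  moreover have "complex_of_real (ln (y / x)) = of_real (ln y) - of_real (ln x)"
    using xy by (simp add: ln_div)
  ultimately show ?thesis
    unfolding integral_K_int_K_int[OF a b xy(1,2)] integral_eq_hyp_int[OF xy(1,2)] q by (simp only:)
qed

text \<open>Both sides are brought to the common factor \<open>M\<close> times one exponential whose
  exponent is linear in ln sinh t, ln cosh t, ln 2 and t; then the exponents are compared.\<close>

lemma Q_lhs_real:
  fixes t :: real
  assumes t: "t > 0"
    and a: "Re (\<nu> + 1) > 0" "Re (\<nu> + \<alpha> + \<beta> + 1) > 0"
    and b: "Re (\<nu> + \<alpha> + 1) > 0" "Re (\<nu> + \<beta> + 1) > 0"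
  defines "\<sigma> \<equiv> 2 * \<nu> + \<alpha> + \<beta>"
  shows "Q_lhs \<nu> \<alpha> \<beta> (of_real t) = Q_prefix \<nu> \<alpha> \<beta> (of_real t) *
    (K_product_integral \<sigma> \<alpha> \<beta> (sinh t * exp (- t)) (cosh t * exp (- t)) / Gamma (\<sigma> + 2))"
proof -
  define x y where "x = sinh t * exp (- t)" and "y = cosh t * exp (- t)"
  define S C k where "S = complex_of_real (ln (sinh t))" and "C = complex_of_real (ln (cosh t))"
    and "k = complex_of_real (ln 2)"
  define T where "T = complex_of_real t"
  have sh: "sinh t > 0" "cosh t > 0" using t by auto
  have xy: "x > 0" "y > 0" using sh by (simp_all add: x_def y_def)
  have xy1: "x + y = 1"
    by (auto simp: x_def y_def sinh_field_def cosh_field_def algebra_simps mult_exp_exp add_divide_distrib[symmetric])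
  have lnxy: "complex_of_real (ln x) = S - T" "complex_of_real (ln y) = C - T"
    using sh by (simp_all add: x_def y_def S_def C_def T_def ln_mult_pos)
  define a b c where "a = \<nu> + 1" and "b = \<nu> + \<alpha> + 1" and "c = \<sigma> + 2"
  have abc: "c - a = \<nu> + \<alpha> + \<beta> + 1" "c - b = \<nu> + \<beta> + 1" "b - a = \<alpha>" "c - a - b = \<beta>" "c - 2 = \<sigma>"
    by (simp_all add: a_def b_def c_def \<sigma>_def)
  have a': "Re a > 0" "Re (c - a) > 0" and b': "Re b > 0" "Re (c - b) > 0"
    using assms(2-5) unfolding abc by (simp_all add: a_def b_def)
  have domt: "complex_of_real t \<in> domD" using t by (rule of_real_in_domD)
  define H where "H = hyp_int a b c (of_real (1 - (y / x)\<^sup>2))"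
  define M where "M = Gamma a * Gamma (c - a) * rGamma c * H / of_real pi"
  have z1: "cosh (2 * complex_of_real t) - 1 = of_real (2 * (sinh t)\<^sup>2)"
    "cosh (2 * complex_of_real t) + 1 = of_real (2 * (cosh t)\<^sup>2)"
    by (simp_all add: cosh_double_complex sinh_cosh_of_real)
  \<comment> \<open>Both are 1 - coth(t)^2 = -1/sinh(t)^2, since y/x = coth t.\<close>
  have arg: "2 / (1 - cosh (2 * complex_of_real t)) = of_real (1 - (y / x)\<^sup>2)"
  proof -
    have "1 - cosh (2 * complex_of_real t) = of_real (- (2 * (sinh t)\<^sup>2))"
      using z1(1) by (simp add: algebra_simps)
    then have "2 / (1 - cosh (2 * complex_of_real t)) = of_real (2 / (- (2 * (sinh t)\<^sup>2)))"
      by (simp only: of_real_divide) simp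
    also have "2 / (- (2 * (sinh t)\<^sup>2)) = 1 - (y / x)\<^sup>2"
      using sh by (simp add: x_def y_def power_divide cosh_square_eq divide_simps)
    finally show ?thesis .
  qed
  have hg: "hypergeom_reg (\<nu> + 1) (\<nu> + \<alpha> + 1) (\<sigma> + 2) (2 / (1 - cosh (2 * complex_of_real t))) = H / (Gamma b * Gamma (c - b))"
    using hypergeom_reg_eq_hyp_int[OF b' hypergeom_arg_in_slit_plane[OF domt], of a]
    unfolding arg H_def by (simp only: a_def b_def c_def)
  have pw: "complex_of_real (2 * r\<^sup>2) powr s = exp (s * (k + 2 * of_real (ln r)))" if "r > 0" for r s
  proof -
    have "Ln (complex_of_real (2 * r\<^sup>2)) = of_real (ln (2 * r\<^sup>2))" using that by (intro Ln_of_real) simp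
    also have "ln (2 * r\<^sup>2) = ln 2 + 2 * ln r" using that by (simp add: ln_mult_pos ln_realpow)
    finally have "Ln (complex_of_real (2 * r\<^sup>2)) = k + 2 * of_real (ln r)" by (simp add: k_def)
    moreover have "complex_of_real (2 * r\<^sup>2) \<noteq> 0" using that by simp
    ultimately show ?thesis by (simp only: powr_def if_False)
  qed
  have p2: "2 powr s = exp (s * k)" for s :: complex
  proof -
    have "Ln 2 = k" using Ln_of_real[of 2] by (simp add: k_def)
    then show ?thesis by (simp add: powr_def)
  qed
  have nz: "Gamma b \<noteq> 0" "Gamma (c - b) \<noteq> 0" using b' Gamma_nonzero_Re_pos by auto
  have "Q_lhs \<nu> \<alpha> \<beta> (of_real t) = exp ((\<sigma> + 1) * k) / of_real pi * (Gamma a * Gamma (c - a) * rGamma c) *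
    (exp ((\<nu> + \<alpha> + \<beta>) * k) * Gamma b * Gamma (c - b) /
      (exp ((\<nu> + \<alpha> + 1) * (k + 2 * S)) * exp (\<beta> * (k + 2 * C))) * (H / (Gamma b * Gamma (c - b))))"
  proof -
    have "Beta (\<nu> + 1) (\<nu> + \<alpha> + \<beta> + 1) = Gamma a * Gamma (c - a) * rGamma c"
      unfolding Beta_altdef abc by (simp add: a_def c_def \<sigma>_def algebra_simps)
    then show ?thesis
      unfolding Q_lhs_def jacobi_Q_def hg z1 pw[OF sh(1)] pw[OF sh(2)] p2 S_def[symmetric] C_def[symmetric] \<sigma>_def[symmetric] abc(2)
      by (simp only: b_def)
  qed
  also have "\<dots> = M * (exp ((\<sigma> + 1) * k) * exp ((\<nu> + \<alpha> + \<beta>) * k) /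
      (exp ((\<nu> + \<alpha> + 1) * (k + 2 * S)) * exp (\<beta> * (k + 2 * C))))"
    using nz by (simp add: M_def)
  also have "\<dots> = M * exp ((\<sigma> + 1) * k + (\<nu> + \<alpha> + \<beta>) * k - ((\<nu> + \<alpha> + 1) * (k + 2 * S) + \<beta> * (k + 2 * C)))"
    by (simp only: exp_add exp_diff)
  finally have lhs: "Q_lhs \<nu> \<alpha> \<beta> (of_real t) =
    M * exp ((\<sigma> + 1) * k + (\<nu> + \<alpha> + \<beta>) * k - ((\<nu> + \<alpha> + 1) * (k + 2 * S) + \<beta> * (k + 2 * C)))" .
  have J: "K_product_integral \<sigma> \<alpha> \<beta> x y =
    exp (((S - T) + (C - T)) / 2) / (2 * of_real pi) * (Gamma (c - a) * Gamma a *
     (exp (c * k + b * ((C - T) - (S - T)) - (c - a) * (C - T) - a * (S - T)) / 2 * H))"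
    using K_product_integral_eq[OF a' b' xy xy1] unfolding abc(3,4,5) lnxy H_def[symmetric] k_def[symmetric] .
  have pref: "Q_prefix \<nu> \<alpha> \<beta> (of_real t) = exp ((\<alpha> + 1/2) * (- T - S)) * exp ((\<beta> + 1/2) * (- T - C)) * exp (- 2 * \<nu> * T)"
    unfolding Q_prefix_def pow_D_Xm[OF domt] pow_D_Ym[OF domt] sinh_cosh_of_real
    using sh by (simp only: Ln_of_real S_def C_def T_def)
  \<comment> \<open>The two factors 1/2 in \<open>K_product_integral_eq\<close> give 1/4; written as
    an exponential it joins the other exponents.\<close>
  have quarter: "exp (- 2 * k) = 1 / 4"
  proof -
    have "- 2 * k = complex_of_real (- (2 * ln 2))" by (simp add: k_def)
    moreover have "exp (- (2 * ln 2 :: real)) = 1 / 4" by (simp add: exp_minus exp_double)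
    ultimately show ?thesis by (simp only: exp_of_real) simp
  qed
  have "Q_prefix \<nu> \<alpha> \<beta> (of_real t) * (K_product_integral \<sigma> \<alpha> \<beta> x y / Gamma (\<sigma> + 2)) =
    M * (exp ((\<alpha> + 1/2) * (- T - S)) * exp ((\<beta> + 1/2) * (- T - C)) * exp (- 2 * \<nu> * T) *
      exp (((S - T) + (C - T)) / 2) * exp (c * k + b * ((C - T) - (S - T)) - (c - a) * (C - T) - a * (S - T)) * (1 / 4))"
  proof -
    have reorder: "P * (e / (2 * p) * (G1 * G2 * (f / 2 * h)) / G3) = (G2 * G1 * (1 / G3) * h / p) * (P * e * f * (1 / 4))"
      for P e p G1 G2 f h G3 :: complex
      by (simp add: mult_ac)
    have "rGamma c = 1 / Gamma c" by (simp only: rGamma_inverse_Gamma divide_inverse mult_1_left)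
    then show ?thesis unfolding J pref M_def c_def[symmetric] reorder by (simp only:)
  qed
  also have "\<dots> = M * exp ((\<alpha> + 1/2) * (- T - S) + (\<beta> + 1/2) * (- T - C) + - 2 * \<nu> * T +
      ((S - T) + (C - T)) / 2 + (c * k + b * ((C - T) - (S - T)) - (c - a) * (C - T) - a * (S - T)) + - 2 * k)"
    unfolding quarter[symmetric] by (simp only: exp_add)
  also have "(\<alpha> + 1/2) * (- T - S) + (\<beta> + 1/2) * (- T - C) + - 2 * \<nu> * T +
      ((S - T) + (C - T)) / 2 + (c * k + b * ((C - T) - (S - T)) - (c - a) * (C - T) - a * (S - T)) + - 2 * k =
      (\<sigma> + 1) * k + (\<nu> + \<alpha> + \<beta>) * k - ((\<nu> + \<alpha> + 1) * (k + 2 * S) + \<beta> * (k + 2 * C))"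
    by (simp add: a_def b_def c_def \<sigma>_def algebra_simps) (simp add: field_simps)
  finally show ?thesis unfolding lhs x_def y_def by (rule sym)
qed

text \<open>The remainder function \<open>T\<close> is left open so that the expansions led by
  \<alpha> and by \<beta> can both be inserted. The two sides are holomorphic on the connected
  \<open>domD\<close> and agree on the positive axis.\<close>

lemma Q_lhs_expand:
  assumes a: "Re (\<nu> + 1) > 0" "Re (\<nu> + \<alpha> + \<beta> + 1) > 0"
    and b: "Re (\<nu> + \<alpha> + 1) > 0" "Re (\<nu> + \<beta> + 1) > 0"
    and T: "T holomorphic_on domD"
    and J: "\<And>t::real. t > 0 \<Longrightarrow> K_product_integral \<sigma> \<alpha> \<beta> (sinh t * exp (- t)) (cosh t * exp (- t)) =
       (\<Sum>n<N. g_xy n \<alpha> \<beta> (x_of (of_real t)) (y_of (of_real t)) * Gamma (\<sigma> - of_nat n + 1)) + T (of_real t)"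
    and \<sigma>: "\<sigma> = 2 * \<nu> + \<alpha> + \<beta>" and \<xi>: "\<xi> \<in> domD"
  shows "Q_lhs \<nu> \<alpha> \<beta> \<xi> = Q_prefix \<nu> \<alpha> \<beta> \<xi> *
     ((\<Sum>n<N. g_coeff n \<xi> \<alpha> \<beta> * Gamma (\<sigma> - of_nat n + 1) / Gamma (\<sigma> + 2)) + T \<xi> / Gamma (\<sigma> + 2))"
proof -
  define rhs where "rhs \<xi> = Q_prefix \<nu> \<alpha> \<beta> \<xi> *
     (((\<Sum>n<N. g_xy n \<alpha> \<beta> (x_of \<xi>) (y_of \<xi>) * Gamma (\<sigma> - of_nat n + 1)) + T \<xi>) * (1 / Gamma (\<sigma> + 2)))" for \<xi>
  have nz: "x_of \<xi> \<noteq> 0" "y_of \<xi> \<noteq> 0" if "\<xi> \<in> domD" for \<xi>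
    using Re_x_of_pos[OF that] Re_y_of_pos[OF that] by auto
  have g: "(\<lambda>\<xi>. g_xy n \<alpha> \<beta> (x_of \<xi>) (y_of \<xi>)) holomorphic_on domD" for n
    unfolding g_xy_def
    by (intro holomorphic_intros x_of_y_of_holomorphic) (simp add: nz)
  have hol: "rhs holomorphic_on domD"
    unfolding rhs_def[abs_def] by (intro holomorphic_intros Q_prefix_holomorphic g T)
  have "Q_lhs \<nu> \<alpha> \<beta> \<xi> - rhs \<xi> = 0"
  proof (rule analytic_continuation[of "\<lambda>\<xi>. Q_lhs \<nu> \<alpha> \<beta> \<xi> - rhs \<xi>" domD "complex_of_real ` {0<..}" 1 \<xi>])
    show "(\<lambda>\<xi>. Q_lhs \<nu> \<alpha> \<beta> \<xi> - rhs \<xi>) holomorphic_on domD"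
      by (intro holomorphic_on_diff Q_lhs_holomorphic b hol)
    show "open domD" "connected domD" by (simp_all add: open_domD convex_connected convex_domD)
    show "complex_of_real ` {0<..} \<subseteq> domD" using of_real_in_domD by auto
    show "1 \<in> domD" using of_real_in_domD[of 1] by simp
    show "1 islimpt complex_of_real ` {0<..}"
      unfolding islimpt_approachable
    proof (intro allI impI)
      fix e :: real assume "e > 0"
      show "\<exists>x'\<in>complex_of_real ` {0<..}. x' \<noteq> 1 \<and> dist x' 1 < e"
      proof (rule bexI)
        show "of_real (1 + e / 2) \<noteq> (1 :: complex) \<and> dist (of_real (1 + e / 2)) (1 :: complex) < e"
          using \<open>e > 0\<close> by (auto simp: dist_norm norm_divide)
        show "complex_of_real (1 + e / 2) \<in> complex_of_real ` {0<..}"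
          using \<open>e > 0\<close> by (intro imageI) simp
      qed
    qed
    show "\<xi> \<in> domD" by (rule \<xi>)
    fix z assume "z \<in> complex_of_real ` {0<..}"
    then obtain t where t: "t > 0" "z = of_real t" by auto
    show "Q_lhs \<nu> \<alpha> \<beta> z - rhs z = 0"
      using Q_lhs_real[OF t(1) a b] unfolding t(2) rhs_def \<sigma>[symmetric] J[OF t(1)] by simp
  qed
  then have "Q_lhs \<nu> \<alpha> \<beta> \<xi> = rhs \<xi>" by simp
  also have "\<dots> = Q_prefix \<nu> \<alpha> \<beta> \<xi> *
     ((\<Sum>n<N. g_coeff n \<xi> \<alpha> \<beta> * Gamma (\<sigma> - of_nat n + 1) / Gamma (\<sigma> + 2)) + T \<xi> / Gamma (\<sigma> + 2))"
    unfolding rhs_def g_coeff_eq by (simp only: distrib_right sum_distrib_right) simp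
  finally show ?thesis .
qed

section \<open>Remainder bounds\<close>

text \<open>Twice each quantity is 2\<nu> + \<alpha> + \<beta> + 1 plus 1 plus one of the four sign
  combinations of \<alpha> and \<beta>, so its real part exceeds r + 1 - |Re \<alpha>| - |Re
  \<beta>|.\<close>

lemma Re_order_bounds:
  assumes N: "Re (2 * \<nu> + \<alpha> + \<beta> + 1) > r" and ab: "\<bar>Re \<alpha>\<bar> + \<bar>Re \<beta>\<bar> < r + 1"
  shows "Re (\<nu> + 1) > 0" "Re (\<nu> + \<alpha> + \<beta> + 1) > 0" "Re (\<nu> + \<alpha> + 1) > 0" "Re (\<nu> + \<beta> + 1) > 0"
  using assms by (auto simp: abs_if split: if_splits)

text \<open>By \<open>cos_mult_Gamma_mult_Gamma\<close> at real x the quotient in the definition is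
  \<open>h x\<close> wherever the cosine is nonzero. As \<open>h\<close> is continuous on the strip,
  the limit at a zero of the cosine is again the value of \<open>h\<close>.\<close>

lemma a_hat_eq:
  assumes \<mu>: "\<bar>Re \<mu>\<bar> < real k + 1/2"
  shows "a_hat k \<mu> = norm (cos (of_real pi * \<mu>)) *
    (Gamma (real k + 1/2 + Re \<mu>) * Gamma (real k + 1/2 - Re \<mu>) / (pi * 2 ^ k * fact k))"
proof -
  define h where "h x = Gamma (real k + 1/2 + x) * Gamma (real k + 1/2 - x) / (pi * (-2) ^ k * fact k)" for x :: real
  have ratio: "a_coeff k (of_real x) / of_real (cos (pi * x)) = of_real (h x)"
    if x: "\<bar>x\<bar> < real k + 1/2" and c: "cos (pi * x) \<noteq> 0" for x :: real
  proof -
    have "cos (of_real pi * of_real x) * (Gamma (of_nat k + 1/2 + of_real x) * Gamma (of_nat k + 1/2 - of_real x)) =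
           of_real pi * (pochhammer (1/2 + complex_of_real x) k * pochhammer (1/2 - of_real x) k)"
      using x by (intro cos_mult_Gamma_mult_Gamma) simp
    moreover have "cos (of_real pi * complex_of_real x) = of_real (cos (pi * x))"
      by (simp flip: cos_of_real)
    moreover have "Gamma (of_nat k + 1/2 + of_real x) = complex_of_real (Gamma (real k + 1/2 + x))"
      "Gamma (of_nat k + 1/2 - of_real x) = complex_of_real (Gamma (real k + 1/2 - x))"
      using Gamma_complex_of_real[of "real k + 1/2 + x"] Gamma_complex_of_real[of "real k + 1/2 - x"] by simp_all
    ultimately have pp: "of_real (cos (pi * x)) * (complex_of_real (Gamma (real k + 1/2 + x)) * of_real (Gamma (real k + 1/2 - x))) / of_real pi =
        pochhammer (1/2 + complex_of_real x) k * pochhammer (1/2 - of_real x) k"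
      by simp
    have "a_coeff k (of_real x) = of_real (cos (pi * x)) * of_real (h x)"
      unfolding a_coeff_def h_def pp[symmetric] by (simp add: mult_ac)
    then show ?thesis using c by simp
  qed
  have normh: "norm (complex_of_real (h (Re \<mu>))) =
     Gamma (real k + 1/2 + Re \<mu>) * Gamma (real k + 1/2 - Re \<mu>) / (pi * 2 ^ k * fact k)"
    using \<mu> unfolding norm_of_real h_def by (simp add: abs_mult power_abs abs_le_iff)
  have odd_iff: "(\<exists>j::int. odd j \<and> 2 * x = of_int j) \<longleftrightarrow> cos (pi * x) = 0" for x :: real
  proof -
    have "cos (pi * x) = 0 \<longleftrightarrow> (\<exists>j::int. odd j \<and> pi * x = of_int j * (pi / 2))"
      by (rule cos_zero_iff_int)
    also have "\<dots> \<longleftrightarrow> (\<exists>j::int. odd j \<and> 2 * x = of_int j)"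
      by (intro ex_cong1 conj_cong refl) (auto simp: field_simps)
    finally show ?thesis by simp
  qed
  show ?thesis
  proof (cases "cos (pi * Re \<mu>) = 0")
    case False
    then have "\<not> (\<exists>j::int. odd j \<and> 2 * Re \<mu> = of_int j)" unfolding odd_iff .
    then show ?thesis
      unfolding a_hat_def ratio[OF \<mu> False] by (simp only: if_False norm_mult normh)
  next
    case True
    then have cond: "\<exists>j::int. odd j \<and> 2 * Re \<mu> = of_int j" unfolding odd_iff .
    have "isCont h (Re \<mu>)"
      unfolding h_def using \<mu>
      by (intro continuous_intros) (auto simp: abs_less_iff elim!: nonpos_Ints_cases)
    then have "((\<lambda>x. complex_of_real (h x)) \<longlongrightarrow> of_real (h (Re \<mu>))) (at (Re \<mu>))"
      by (intro tendsto_of_real) (simp add: isCont_def)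
    moreover have "eventually (\<lambda>x. of_real (h x) = a_coeff k (of_real x) / of_real (cos (pi * x))) (at (Re \<mu>))"
    proof -
      \<comment> \<open>Zeros of cos(pi x) are at distance at least 1 from each other, so 1/2
        excludes all others; the first entry keeps x inside the strip.\<close>
      define e where "e = min (real k + 1/2 - \<bar>Re \<mu>\<bar>) (1/2)"
      have e: "e > 0" using \<mu> by (simp add: e_def)
      have "of_real (h x) = a_coeff k (of_real x) / of_real (cos (pi * x))"
        if x: "x \<noteq> Re \<mu>" "dist x (Re \<mu>) < e" for x
      proof -
        have d: "\<bar>x - Re \<mu>\<bar> < 1/2" "\<bar>x - Re \<mu>\<bar> < real k + 1/2 - \<bar>Re \<mu>\<bar>"
          using x(2) by (auto simp: e_def dist_real_def)
        have "cos (pi * x) \<noteq> 0"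
        proof
          assume "cos (pi * x) = 0"
          then obtain i j :: int where "2 * x = of_int i" "2 * Re \<mu> = of_int j"
            using cond unfolding odd_iff[symmetric] by blast
          then have "2 * (x - Re \<mu>) = of_int (i - j)" "i \<noteq> j" using x(1) by auto
          then have "\<bar>2 * (x - Re \<mu>)\<bar> \<ge> 1" by (simp only: of_int_abs[symmetric])
          then show False using d(1) unfolding abs_mult by simp
        qed
        moreover have "\<bar>x\<bar> < real k + 1/2" using d(2) by linarith
        ultimately show ?thesis using ratio by simp
      qed
      then show ?thesis using e unfolding eventually_at by blast
    qed
    ultimately have "((\<lambda>x. a_coeff k (of_real x) / of_real (cos (pi * x))) \<longlongrightarrow> of_real (h (Re \<mu>))) (at (Re \<mu>))"
      by (rule Lim_transform_eventually)
    then have "Lim (at (Re \<mu>)) (\<lambda>x. a_coeff k (of_real x) / of_real (cos (pi * x))) = of_real (h (Re \<mu>))"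
      by (intro tendsto_Lim) simp_all
    then show ?thesis
      unfolding a_hat_def using cond by (simp only: if_True norm_mult normh)
  qed
qed

lemma norm_K_rem_le_a_hat:
  assumes "Re z > 0" "\<bar>Re \<alpha>\<bar> < real k + 1/2"
  shows "norm (K_rem k \<alpha> z) \<le> a_hat k \<alpha>"
  unfolding a_hat_eq[OF assms(2)] by (rule norm_K_rem_le[OF assms])

lemma a_hat_nonneg: "a_hat k \<mu> \<ge> 0"
  by (simp add: a_hat_def)

text \<open>The bound for Laplace integrals with \<phi> = \<psi> = 1.\<close>

lemma norm_Gamma_le:
  assumes "Re z > 0"
  shows "norm (Gamma z) \<le> Gamma (Re z)"
  using norm_Laplace_exp_le[OF assms, of "\<lambda>_. 1" 1 "\<lambda>_. 1" 1 1 1] integral_Gamma_exp[OF assms, of 1]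
  by (simp add: Laplace_exp_def)

text \<open>Through \<open>cos_mult_Gamma_mult_Gamma\<close> this reduces to |Gamma(z)| <= Gamma(Re
  z). It is the passage from (i) to (iii).\<close>

lemma norm_a_coeff_le_a_hat:
  assumes \<mu>: "\<bar>Re \<mu>\<bar> < real k + 1/2"
  shows "norm (a_coeff k \<mu>) \<le> a_hat k \<mu>"
proof -
  have "norm (a_coeff k \<mu>) = norm (pochhammer (1/2 + \<mu>) k * pochhammer (1/2 - \<mu>) k) / (2 ^ k * fact k)"
    by (simp add: a_coeff_def norm_mult norm_divide norm_power)
  also have "norm (pochhammer (1/2 + \<mu>) k * pochhammer (1/2 - \<mu>) k) =
     norm (cos (of_real pi * \<mu>) * (Gamma (of_nat k + 1/2 + \<mu>) * Gamma (of_nat k + 1/2 - \<mu>))) / pi"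
    unfolding cos_mult_Gamma_mult_Gamma[OF \<mu>] by (simp add: norm_mult)
  also have "\<dots> / (2 ^ k * fact k) = norm (cos (of_real pi * \<mu>)) *
      (norm (Gamma (of_nat k + 1/2 + \<mu>)) * norm (Gamma (of_nat k + 1/2 - \<mu>)) / (pi * 2 ^ k * fact k))"
    by (simp add: norm_mult)
  also have "\<dots> \<le> a_hat k \<mu>"
    unfolding a_hat_eq[OF \<mu>]
  proof (intro mult_left_mono divide_right_mono mult_mono norm_ge_zero)
    show "norm (Gamma (of_nat k + 1/2 + \<mu>)) \<le> Gamma (real k + 1/2 + Re \<mu>)"
      using norm_Gamma_le[of "of_nat k + 1/2 + \<mu>"] \<mu> by simp
    show "norm (Gamma (of_nat k + 1/2 - \<mu>)) \<le> Gamma (real k + 1/2 - Re \<mu>)"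
      using norm_Gamma_le[of "of_nat k + 1/2 - \<mu>"] \<mu> by simp
    show "0 \<le> Gamma (real k + 1/2 + Re \<mu>)" using \<mu> by (intro Gamma_real_nonneg) auto
  qed simp
  finally show ?thesis .
qed

lemma norm_R_xy_le:
  assumes \<alpha>: "\<bar>Re \<alpha>\<bar> < real N + 1/2" and \<beta>: "\<bar>Re \<beta>\<bar> < 1/2" and \<sigma>: "Re \<sigma> + 1 > real N"
    and xy: "Re x > 0" "Re y > 0"
  shows "norm (R_xy N \<sigma> \<alpha> \<beta> x y) \<le>
    (a_hat N \<alpha> * a_hat 0 \<beta> * norm (1 / x) ^ N +
     (\<Sum>l<N. norm (a_coeff l \<alpha>) * a_hat (N - l) \<beta> * norm (1 / x) ^ l * norm (1 / y) ^ (N - l))) * Gamma (Re \<sigma> - real N + 1)"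
proof -
  have s: "Re (\<sigma> - of_nat N + 1) > 0" using \<sigma> by simp
  have \<beta>k: "\<bar>Re \<beta>\<bar> < real k + 1/2" for k using \<beta> by simp
  have one: "(\<lambda>_. 1 :: complex) holomorphic_on {z. Re z > 0}" "\<And>z. Re z > 0 \<Longrightarrow> norm (1::complex) \<le> 1" by simp_all
  let ?G = "Gamma (Re \<sigma> - real N + 1)"
  have L1: "norm (Laplace_exp (\<sigma> - of_nat N + 1) (\<lambda>_. 1) (K_rem (N - l) \<beta>) x y) \<le> a_hat (N - l) \<beta> * ?G" for l
  proof -
    have "norm (Laplace_exp (\<sigma> - of_nat N + 1) (\<lambda>_. 1) (K_rem (N - l) \<beta>) x y)
        \<le> 1 * a_hat (N - l) \<beta> * Gamma (Re (\<sigma> - of_nat N + 1))"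
      by (rule norm_Laplace_exp_le[OF s one K_rem_holomorphic[OF \<beta>k] norm_K_rem_le_a_hat[OF _ \<beta>k] xy])
    then show ?thesis by simp
  qed
  have L2: "norm (Laplace_exp (\<sigma> - of_nat N + 1) (K_rem N \<alpha>) (K_rem 0 \<beta>) x y) \<le> a_hat N \<alpha> * a_hat 0 \<beta> * ?G"
  proof -
    have "norm (Laplace_exp (\<sigma> - of_nat N + 1) (K_rem N \<alpha>) (K_rem 0 \<beta>) x y)
        \<le> a_hat N \<alpha> * a_hat 0 \<beta> * Gamma (Re (\<sigma> - of_nat N + 1))"
      by (rule norm_Laplace_exp_le[OF s K_rem_holomorphic[OF \<alpha>] norm_K_rem_le_a_hat[OF _ \<alpha>]
            K_rem_holomorphic[OF \<beta>k] norm_K_rem_le_a_hat[OF _ \<beta>k] xy])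
    then show ?thesis by simp
  qed
  have "norm (R_xy N \<sigma> \<alpha> \<beta> x y) \<le>
     (\<Sum>l<N. norm (a_coeff l \<alpha> / (x ^ l * y ^ (N - l)) * Laplace_exp (\<sigma> - of_nat N + 1) (\<lambda>_. 1) (K_rem (N - l) \<beta>) x y)) +
     norm (Laplace_exp (\<sigma> - of_nat N + 1) (K_rem N \<alpha>) (K_rem 0 \<beta>) x y / x ^ N)"
    unfolding R_xy_def by (rule order.trans[OF norm_triangle_ineq add_right_mono[OF norm_sum]])
  also have "\<dots> \<le> (\<Sum>l<N. norm (a_coeff l \<alpha>) * a_hat (N - l) \<beta> * norm (1 / x) ^ l * norm (1 / y) ^ (N - l) * ?G) +
     a_hat N \<alpha> * a_hat 0 \<beta> * norm (1 / x) ^ N * ?G"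
  proof (intro add_mono sum_mono)
    fix l
    have "norm (a_coeff l \<alpha> / (x ^ l * y ^ (N - l)) * Laplace_exp (\<sigma> - of_nat N + 1) (\<lambda>_. 1) (K_rem (N - l) \<beta>) x y) =
      norm (a_coeff l \<alpha>) * norm (1 / x) ^ l * norm (1 / y) ^ (N - l) * norm (Laplace_exp (\<sigma> - of_nat N + 1) (\<lambda>_. 1) (K_rem (N - l) \<beta>) x y)"
      by (simp add: norm_mult norm_divide norm_power power_one_over)
    also have "\<dots> \<le> norm (a_coeff l \<alpha>) * norm (1 / x) ^ l * norm (1 / y) ^ (N - l) * (a_hat (N - l) \<beta> * ?G)"
      by (intro mult_left_mono L1) simp
    finally show "norm (a_coeff l \<alpha> / (x ^ l * y ^ (N - l)) * Laplace_exp (\<sigma> - of_nat N + 1) (\<lambda>_. 1) (K_rem (N - l) \<beta>) x y) \<le>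
        norm (a_coeff l \<alpha>) * a_hat (N - l) \<beta> * norm (1 / x) ^ l * norm (1 / y) ^ (N - l) * ?G"
      by (simp only: mult_ac)
  next
    have "norm (Laplace_exp (\<sigma> - of_nat N + 1) (K_rem N \<alpha>) (K_rem 0 \<beta>) x y / x ^ N) =
      norm (1 / x) ^ N * norm (Laplace_exp (\<sigma> - of_nat N + 1) (K_rem N \<alpha>) (K_rem 0 \<beta>) x y)"
      by (simp add: norm_divide norm_power power_one_over)
    also have "\<dots> \<le> norm (1 / x) ^ N * (a_hat N \<alpha> * a_hat 0 \<beta> * ?G)"
      by (intro mult_left_mono L2) simp
    finally show "norm (Laplace_exp (\<sigma> - of_nat N + 1) (K_rem N \<alpha>) (K_rem 0 \<beta>) x y / x ^ N) \<le>
        a_hat N \<alpha> * a_hat 0 \<beta> * norm (1 / x) ^ N * ?G"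
      by (simp only: mult_ac)
  qed
  finally show ?thesis
    by (simp only: distrib_right sum_distrib_right add.commute)
qed

lemma x_of_y_of_of_real:
  "x_of (of_real t) = of_real (sinh t * exp (- t))" "y_of (of_real t) = of_real (cosh t * exp (- t))"
  unfolding x_of_def y_of_def by (simp_all add: sinh_cosh_of_real flip: exp_of_real)

text \<open>The given equation is compared with \<open>Q_lhs_expand\<close> and the prefactor
  cancelled. The second formula exchanges (\<alpha>, x) with (\<beta>, y), which leaves
  \<open>K_product_integral\<close> and \<open>g_xy\<close> unchanged.\<close>

lemma remainder_eq:
  assumes xi: "\<xi> \<in> domD" and N: "Re (2 * \<nu> + \<alpha> + \<beta> + 1) > real N" and \<sigma>: "\<sigma> = 2 * \<nu> + \<alpha> + \<beta>"
    and R: "Q_lhs \<nu> \<alpha> \<beta> \<xi> = Q_prefix \<nu> \<alpha> \<beta> \<xi> *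
      ((\<Sum>n<N. g_coeff n \<xi> \<alpha> \<beta> * Gamma (\<sigma> - of_nat n + 1) / Gamma (\<sigma> + 2)) + R)"
  shows "\<bar>Re \<alpha>\<bar> < real N + 1/2 \<Longrightarrow> \<bar>Re \<beta>\<bar> < 1/2 \<Longrightarrow> R = R_xy N \<sigma> \<alpha> \<beta> (x_of \<xi>) (y_of \<xi>) / Gamma (\<sigma> + 2)"
    and "\<bar>Re \<alpha>\<bar> < 1/2 \<Longrightarrow> \<bar>Re \<beta>\<bar> < real N + 1/2 \<Longrightarrow> R = R_xy N \<sigma> \<beta> \<alpha> (y_of \<xi>) (x_of \<xi>) / Gamma (\<sigma> + 2)"
proof -
  have s: "Re \<sigma> + 1 > real N" using N by (simp add: \<sigma>)
  have xy: "sinh t * exp (- t) > 0" "cosh t * exp (- t) > 0" if "t > 0" for t :: real using that by simp_all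
  have cancel: "R = T \<xi> / Gamma (\<sigma> + 2)"
    if ab: "\<bar>Re \<alpha>\<bar> + \<bar>Re \<beta>\<bar> < real N + 1" and T: "T holomorphic_on domD"
      and J: "\<And>t::real. t > 0 \<Longrightarrow> K_product_integral \<sigma> \<alpha> \<beta> (sinh t * exp (- t)) (cosh t * exp (- t)) =
       (\<Sum>n<N. g_xy n \<alpha> \<beta> (x_of (of_real t)) (y_of (of_real t)) * Gamma (\<sigma> - of_nat n + 1)) + T (of_real t)" for T
    using R Q_lhs_expand[OF Re_order_bounds[OF N ab] T J \<sigma> xi] Q_prefix_nonzero[of \<nu> \<alpha> \<beta> \<xi>]
    by (simp only: mult_cancel_left add_left_cancel simp_thms)
  show "R = R_xy N \<sigma> \<alpha> \<beta> (x_of \<xi>) (y_of \<xi>) / Gamma (\<sigma> + 2)" if ab: "\<bar>Re \<alpha>\<bar> < real N + 1/2" "\<bar>Re \<beta>\<bar> < 1/2"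
  proof (rule cancel[of "\<lambda>\<xi>. R_xy N \<sigma> \<alpha> \<beta> (x_of \<xi>) (y_of \<xi>)"])
    show "\<bar>Re \<alpha>\<bar> + \<bar>Re \<beta>\<bar> < real N + 1" using ab by simp
    show "(\<lambda>\<xi>. R_xy N \<sigma> \<alpha> \<beta> (x_of \<xi>) (y_of \<xi>)) holomorphic_on domD"
      by (rule R_xy_holomorphic[OF ab s open_domD x_of_y_of_holomorphic(1) Re_x_of_pos x_of_y_of_holomorphic(2) Re_y_of_pos])
    fix t :: real assume t: "t > 0"
    show "K_product_integral \<sigma> \<alpha> \<beta> (sinh t * exp (- t)) (cosh t * exp (- t)) =
       (\<Sum>n<N. g_xy n \<alpha> \<beta> (x_of (of_real t)) (y_of (of_real t)) * Gamma (\<sigma> - of_nat n + 1)) +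
       R_xy N \<sigma> \<alpha> \<beta> (x_of (of_real t)) (y_of (of_real t))"
      unfolding x_of_y_of_of_real K_product_integral_def by (rule integral_K_product_expand[OF xy[OF t] ab s])
  qed
  show "R = R_xy N \<sigma> \<beta> \<alpha> (y_of \<xi>) (x_of \<xi>) / Gamma (\<sigma> + 2)" if ab: "\<bar>Re \<alpha>\<bar> < 1/2" "\<bar>Re \<beta>\<bar> < real N + 1/2"
  proof (rule cancel[of "\<lambda>\<xi>. R_xy N \<sigma> \<beta> \<alpha> (y_of \<xi>) (x_of \<xi>)"])
    show "\<bar>Re \<alpha>\<bar> + \<bar>Re \<beta>\<bar> < real N + 1" using ab by simp
    show "(\<lambda>\<xi>. R_xy N \<sigma> \<beta> \<alpha> (y_of \<xi>) (x_of \<xi>)) holomorphic_on domD"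
      by (rule R_xy_holomorphic[OF ab(2,1) s open_domD x_of_y_of_holomorphic(2) Re_y_of_pos x_of_y_of_holomorphic(1) Re_x_of_pos])
    fix t :: real assume t: "t > 0"
    show "K_product_integral \<sigma> \<alpha> \<beta> (sinh t * exp (- t)) (cosh t * exp (- t)) =
       (\<Sum>n<N. g_xy n \<alpha> \<beta> (x_of (of_real t)) (y_of (of_real t)) * Gamma (\<sigma> - of_nat n + 1)) +
       R_xy N \<sigma> \<beta> \<alpha> (y_of (of_real t)) (x_of (of_real t))"
      unfolding x_of_y_of_of_real K_product_integral_swap[of \<sigma> \<alpha> \<beta>] g_xy_swap[of _ \<alpha> \<beta>]
      unfolding K_product_integral_def
      by (rule integral_K_product_expand[OF xy(2)[OF t] xy(1)[OF t] ab(2,1) s])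
  qed
qed

section \<open>Signs for real parameters\<close>

text \<open>For |a| < 1/2 both Pochhammer products are positive, so the sign is that of
  (-2)^l.\<close>

lemma a_coeff_sign:
  fixes a :: real
  assumes a: "\<bar>a\<bar> < 1/2"
  shows "\<exists>A>0. a_coeff l (of_real a) = of_real ((-1) ^ l * A)"
proof (intro exI conjI)
  define A where "A = pochhammer (1/2 + a) l * pochhammer (1/2 - a) l / (2 ^ l * fact l)"
  show "A > 0" unfolding A_def using a by (intro divide_pos_pos mult_pos_pos pochhammer_pos) auto
  have "pochhammer (1/2 + complex_of_real a) l = of_real (pochhammer (1/2 + a) l)"
    "pochhammer (1/2 - complex_of_real a) l = of_real (pochhammer (1/2 - a) l)"
    by (simp_all flip: pochhammer_of_real)
  moreover have "(- 2 :: complex) ^ l = (- 1) ^ l * 2 ^ l" by (rule power_minus)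
  moreover have "1 / (- 1 :: complex) ^ l = (- 1) ^ l" by (simp flip: power_one_over)
  ultimately show "a_coeff l (of_real a) = of_real ((-1) ^ l * A)"
    unfolding a_coeff_def A_def by (simp add: divide_simps)
qed

lemma cos_pi_mult_pos:
  fixes a :: real
  assumes "\<bar>a\<bar> < 1/2"
  shows "cos (pi * a) > 0"
proof (rule cos_gt_zero_pi)
  have "pi * - (1/2) < pi * a" "pi * a < pi * (1/2)"
    using assms by (intro mult_strict_left_mono; simp add: abs_less_iff)+
  then show "- (pi / 2) < pi * a" "pi * a < pi / 2" by simp_all
qed

lemma a_hat_real:
  fixes a :: real
  assumes a: "\<bar>a\<bar> < 1/2"
  shows "a_hat k (of_real a) = norm (a_coeff k (of_real a))"
proof -
  have "\<not> (\<exists>j::int. odd j \<and> 2 * a = of_int j)"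
  proof
    assume "\<exists>j::int. odd j \<and> 2 * a = of_int j"
    then obtain j :: int where j: "odd j" "2 * a = of_int j" by blast
    have "\<bar>2 * a\<bar> < 1" using a by (simp add: abs_mult)
    then have "\<bar>j\<bar> < 1" unfolding j(2) by linarith
    then show False using j(1) by simp
  qed
  moreover have "cos (of_real pi * complex_of_real a) = of_real (cos (pi * a))"
    by (simp flip: cos_of_real)
  moreover have "cos (pi * a) \<noteq> 0" using cos_pi_mult_pos[OF a] by simp
  ultimately show ?thesis by (auto simp: a_hat_def)
qed

text \<open>The cosine is positive and the integrand non-negative. The integral cannot vanish, since
  the weight would then be zero almost everywhere, against the nonzero total mass in
  \<open>integral_K_wt\<close>.\<close>

lemma K_rem_sign:
  fixes a z :: real
  assumes a: "\<bar>a\<bar> < 1/2" and z: "z > 0"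
  shows "\<exists>h>0. K_rem k (of_real a) (of_real z) = of_real ((-1) ^ k * h)"
proof -
  have ak: "\<bar>Re (complex_of_real a)\<bar> < real k + 1/2" using a by simp
  define W where "W p = Re (K_wt k (of_real a) p)" for p
  have W: "K_wt k (of_real a) p = of_real (W p)" "W p \<ge> 0" for p
  proof -
    have "exp (complex_of_real a * of_real (fst p)) = of_real (exp (a * fst p))" by (simp flip: exp_of_real)
    then have "K_wt k (of_real a) p = of_real (exp (a * fst p) * (snd p ^ (2 * k) * exp (- (cosh (fst p / 2) * snd p)\<^sup>2)))"
      unfolding K_wt_def by (simp only: of_real_mult)
    then show "K_wt k (of_real a) p = of_real (W p)" "W p \<ge> 0"
      unfolding W_def by (simp_all add: power_mult)
  qed
  define f where "f p = W p / (1 + (snd p)\<^sup>2 / (2 * z))" for p :: "real \<times> real"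
  have den: "1 + y\<^sup>2 / (2 * z) > 0" for y using z by (simp add: add_pos_nonneg)
  have fK: "K_wt k (of_real a) p / (1 + of_real ((snd p)\<^sup>2) / (2 * of_real z)) = of_real (f p)" for p
    unfolding f_def W(1) by simp
  have "integrable (lborel \<Otimes>\<^sub>M lborel) (\<lambda>p. complex_of_real (f p))"
    using integrable_K_integrand[OF _ ak, of "of_real z"] z unfolding fK by simp
  from integrable_Re[OF this] have fi: "integrable (lborel \<Otimes>\<^sub>M lborel) f" by simp
  have fpos: "f p \<ge> 0" for p unfolding f_def using W(2) den by (simp add: less_imp_le)
  define I where "I = integral\<^sup>L (lborel \<Otimes>\<^sub>M lborel) f"
  have "I \<ge> 0" unfolding I_def using fpos by simp
  moreover have "I \<noteq> 0"
  proof
    assume "I = 0"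
    then have "AE p in lborel \<Otimes>\<^sub>M lborel. f p = 0"
      unfolding I_def using integral_nonneg_eq_0_iff_AE[OF fi] fpos by simp
    then have "AE p in lborel \<Otimes>\<^sub>M lborel. K_wt k (of_real a) p = 0"
      using den by (auto simp: f_def W(1) less_le)
    then have "integral\<^sup>L (lborel \<Otimes>\<^sub>M lborel) (K_wt k (of_real a)) = 0"
      by (rule integral_eq_zero_AE)
    then show False
      unfolding integral_K_wt[OF ak] using ak Gamma_nonzero_Re_pos[of "of_nat k + 1/2 + of_real a"]
        Gamma_nonzero_Re_pos[of "of_nat k + 1/2 - of_real a"] by (simp add: abs_less_iff)
  qed
  ultimately have I: "I > 0" by simp
  have cos: "cos (pi * a) > 0" by (rule cos_pi_mult_pos[OF a])
  define h where "h = cos (pi * a) / (2 * pi * sqrt pi) * (1 / 2) ^ k * I"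
  have "h > 0" unfolding h_def using I cos by simp
  moreover have "K_rem k (of_real a) (of_real z) = of_real ((-1) ^ k * h)"
  proof -
    have "cos (of_real pi * complex_of_real a) = of_real (cos (pi * a))" by (simp flip: cos_of_real)
    moreover have "(- 1 / 2 :: complex) ^ k = of_real ((- 1) ^ k * (1 / 2) ^ k)"
      by (simp flip: power_mult_distrib)
    ultimately have "K_rem k (of_real a) (of_real z) =
       of_real (cos (pi * a)) / of_real (2 * pi * sqrt pi) * of_real ((- 1) ^ k * (1 / 2) ^ k) * of_real I"
      unfolding K_rem_def fK I_def integral_complex_of_real by (simp only:)
    also have "\<dots> = of_real ((-1) ^ k * h)" unfolding h_def by simp
    finally show ?thesis .
  qed
  ultimately show ?thesis by blast
qed

lemma Laplace_exp_sign:
  fixes s x y :: real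
  assumes int: "integrable lborel (\<lambda>w. exp (of_real s * of_real w - of_real (exp w)) *
      (\<phi> (of_real (exp w) * of_real x) * \<psi> (of_real (exp w) * of_real y)))"
    and sgn: "\<And>w::real. \<exists>h>0. \<phi> (of_real (exp w) * of_real x) * \<psi> (of_real (exp w) * of_real y) = of_real ((-1) ^ k * h)"
  shows "\<exists>H>0. Laplace_exp (of_real s) \<phi> \<psi> (of_real x) (of_real y) = of_real ((-1) ^ k * H)"
proof -
  obtain h where h: "\<And>w. h w > 0"
    "\<And>w. \<phi> (of_real (exp w) * of_real x) * \<psi> (of_real (exp w) * of_real y) = of_real ((-1) ^ k * h w)"
    using sgn by metis
  define F where "F w = exp (s * w - exp w) * h w" for w
  have F: "exp (of_real s * of_real w - of_real (exp w)) *
      (\<phi> (of_real (exp w) * of_real x) * \<psi> (of_real (exp w) * of_real y)) = of_real ((-1) ^ k * F w)" for w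
  proof -
    have "of_real s * of_real w - of_real (exp w) = complex_of_real (s * w - exp w)" by simp
    then show ?thesis unfolding h(2) F_def by (simp only: exp_of_real) simp
  qed
  have "integrable lborel (\<lambda>w. (-1) ^ k * Re (complex_of_real ((-1) ^ k * F w)))"
    using integrable_Re[OF int] unfolding F by (rule integrable_mult_right)
  then have Fi: "integrable lborel F"
    by (simp only: Re_complex_of_real mult.assoc[symmetric] power_mult_distrib[symmetric]) simp
  have Fpos: "F w > 0" for w using h(1) by (simp add: F_def)
  have "(\<integral>w. F w \<partial>lborel) \<noteq> 0"
  proof
    assume "(\<integral>w. F w \<partial>lborel) = 0"
    then have "AE w in lborel. F w = 0"
      using integral_nonneg_eq_0_iff_AE[OF Fi] Fpos by (simp add: less_imp_le)
    then have "AE w in (lborel :: real measure). False"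
      using Fpos by (simp add: less_imp_neq[symmetric])
    then show False by (simp add: eventually_False ae_filter_eq_bot_iff)
  qed
  moreover have "(\<integral>w. F w \<partial>lborel) \<ge> 0"
    using Fpos by (intro Bochner_Integration.integral_nonneg) (simp add: less_imp_le)
  ultimately have "(\<integral>w. F w \<partial>lborel) > 0" by simp
  moreover have "Laplace_exp (of_real s) \<phi> \<psi> (of_real x) (of_real y) = of_real ((-1) ^ k * (\<integral>w. F w \<partial>lborel))"
    unfolding Laplace_exp_def F integral_complex_of_real by simp
  ultimately show ?thesis by blast
qed

text \<open>The sign (-1)^l of the coefficient and the sign (-1)^(N-l) of the remainder multiply to
  (-1)^N for every l, so no cancellation occurs.\<close>

lemma R_xy_sign:
  fixes s a b x y :: real
  assumes a: "\<bar>a\<bar> < 1/2" and b: "\<bar>b\<bar> < 1/2" and s: "s + 1 > real N" and xy: "x > 0" "y > 0"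
  shows "\<exists>r>0. R_xy N (of_real s) (of_real a) (of_real b) (of_real x) (of_real y) = of_real ((-1) ^ N * r)"
proof -
  have ak: "\<bar>Re (complex_of_real a)\<bar> < real k + 1/2" and bk: "\<bar>Re (complex_of_real b)\<bar> < real k + 1/2" for k
    using a b by simp_all
  have s': "Re (complex_of_real (s - real N + 1)) > 0" using s by simp
  have xy': "Re (complex_of_real x) > 0" "Re (complex_of_real y) > 0" using xy by simp_all
  have one: "(\<lambda>_. 1 :: complex) holomorphic_on {z. Re z > 0}" "\<And>z. Re z > 0 \<Longrightarrow> norm (1::complex) \<le> 1" by simp_all
  have arg: "complex_of_real (exp w) * of_real z = of_real (exp w * z)" for w z by simp
  have L1: "\<exists>H>0. Laplace_exp (of_real (s - real N + 1)) (\<lambda>_. 1) (K_rem m (of_real b)) (of_real x) (of_real y) = of_real ((-1) ^ m * H)" for m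
  proof (rule Laplace_exp_sign)
    show "\<exists>h>0. 1 * K_rem m (of_real b) (of_real (exp w) * of_real y) = of_real ((-1) ^ m * h)" for w
      unfolding arg mult_1_left using xy by (intro K_rem_sign b) simp
  qed (rule Laplace_exp_integrable[OF s' one K_rem_holomorphic[OF bk] norm_K_rem_le[OF _ bk] xy'])
  have L2: "\<exists>H>0. Laplace_exp (of_real (s - real N + 1)) (K_rem N (of_real a)) (K_rem 0 (of_real b)) (of_real x) (of_real y) = of_real ((-1) ^ N * H)"
  proof (rule Laplace_exp_sign)
    fix w :: real
    obtain h1 where h1: "h1 > 0" "K_rem N (of_real a) (of_real (exp w * x)) = of_real ((-1) ^ N * h1)"
      using K_rem_sign[OF a, of "exp w * x" N] xy by auto
    obtain h2 where h2: "h2 > 0" "K_rem 0 (of_real b) (of_real (exp w * y)) = of_real ((-1) ^ 0 * h2)"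
      using K_rem_sign[OF b, of "exp w * y" 0] xy by auto
    show "\<exists>h>0. K_rem N (of_real a) (of_real (exp w) * of_real x) * K_rem 0 (of_real b) (of_real (exp w) * of_real y) = of_real ((-1) ^ N * h)"
      unfolding arg h1 h2 using h1 h2 by (intro exI[of _ "h1 * h2"]) simp
  qed (rule Laplace_exp_integrable[OF s' K_rem_holomorphic[OF ak] norm_K_rem_le[OF _ ak] K_rem_holomorphic[OF bk] norm_K_rem_le[OF _ bk] xy'])
  obtain A where A: "\<And>l. A l > 0" "\<And>l. a_coeff l (of_real a) = of_real ((-1) ^ l * A l)"
    using a_coeff_sign[OF a] by metis
  obtain H where H: "\<And>m. H m > 0"
    "\<And>m. Laplace_exp (of_real (s - real N + 1)) (\<lambda>_. 1) (K_rem m (of_real b)) (of_real x) (of_real y) = of_real ((-1) ^ m * H m)"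
    using L1 by metis
  obtain H' where H': "H' > 0"
    "Laplace_exp (of_real (s - real N + 1)) (K_rem N (of_real a)) (K_rem 0 (of_real b)) (of_real x) (of_real y) = of_real ((-1) ^ N * H')"
    using L2 by blast
  define r where "r = (\<Sum>l<N. A l / (x ^ l * y ^ (N - l)) * H (N - l)) + H' / x ^ N"
  have "r > 0"
    unfolding r_def using A(1) H(1) H'(1) xy
    by (intro add_nonneg_pos sum_nonneg mult_nonneg_nonneg divide_nonneg_pos divide_pos_pos) (simp_all add: less_imp_le)
  moreover have "R_xy N (of_real s) (of_real a) (of_real b) (of_real x) (of_real y) = of_real ((-1) ^ N * r)"
  proof -
    have e: "complex_of_real s - of_nat N + 1 = of_real (s - real N + 1)" by simp
    have summand: "complex_of_real ((-1) ^ l * A l) / (of_real x ^ l * of_real y ^ (N - l)) * of_real ((-1) ^ (N - l) * H (N - l)) =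
      of_real ((-1) ^ N * (A l / (x ^ l * y ^ (N - l)) * H (N - l)))" if "l \<in> {..<N}" for l
    proof -
      have "(-1 :: real) ^ N = (-1) ^ l * (-1) ^ (N - l)" using that by (simp flip: power_add)
      then have "(-1) ^ l * A l / (x ^ l * y ^ (N - l)) * ((-1) ^ (N - l) * H (N - l)) = (-1) ^ N * (A l / (x ^ l * y ^ (N - l)) * H (N - l))"
        by (simp only:) simp
      then show ?thesis by (simp only: of_real_mult[symmetric] of_real_divide[symmetric] of_real_power[symmetric])
    qed
    have "R_xy N (of_real s) (of_real a) (of_real b) (of_real x) (of_real y) =
      (\<Sum>l<N. of_real ((-1) ^ N * (A l / (x ^ l * y ^ (N - l)) * H (N - l)))) + of_real ((-1) ^ N * H') / of_real x ^ N"
      unfolding R_xy_def e A(2) H(2) H'(2)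
      by (rule arg_cong2[where f="(+)", OF sum.cong[OF refl summand] refl])
    also have "\<dots> = of_real ((-1) ^ N * r)"
      unfolding r_def by (simp add: distrib_left sum_distrib_left)
    finally show ?thesis .
  qed
  ultimately show ?thesis by blast
qed

text \<open>All summands have the sign (-1)^n, so the modulus of the coefficient is the sum of the
  moduli; for real orders that is the sum bounding the remainder in (iii).\<close>

lemma g_xy_sign:
  fixes a b x y :: real
  assumes a: "\<bar>a\<bar> < 1/2" and b: "\<bar>b\<bar> < 1/2" and xy: "x > 0" "y > 0"
  shows "\<exists>g>0. g_xy n (of_real a) (of_real b) (of_real x) (of_real y) = of_real ((-1) ^ n * g) \<and>
     g = (\<Sum>l\<le>n. norm (a_coeff l (of_real a)) * norm (a_coeff (n - l) (of_real b)) * (1 / x) ^ l * (1 / y) ^ (n - l))"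
proof -
  obtain A where A: "\<And>l. A l > 0" "\<And>l. a_coeff l (of_real a) = of_real ((-1) ^ l * A l)"
    using a_coeff_sign[OF a] by metis
  obtain B where B: "\<And>l. B l > 0" "\<And>l. a_coeff l (of_real b) = of_real ((-1) ^ l * B l)"
    using a_coeff_sign[OF b] by metis
  define g where "g = (\<Sum>l\<le>n. A l * B (n - l) * (1 / x) ^ l * (1 / y) ^ (n - l))"
  have "g > 0" unfolding g_def using A(1) B(1) xy by (intro sum_pos mult_pos_pos) auto
  moreover have "norm (complex_of_real ((-1) ^ l * A l)) = A l" "norm (complex_of_real ((-1) ^ l * B l)) = B l" for l
    unfolding norm_of_real using A(1)[of l] B(1)[of l] by (simp_all add: abs_mult power_abs)
  then have "g = (\<Sum>l\<le>n. norm (a_coeff l (of_real a)) * norm (a_coeff (n - l) (of_real b)) * (1 / x) ^ l * (1 / y) ^ (n - l))"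
    unfolding g_def A(2) B(2) by simp
  moreover have "g_xy n (of_real a) (of_real b) (of_real x) (of_real y) = of_real ((-1) ^ n * g)"
    unfolding g_xy_def g_def sum_distrib_left of_real_sum
  proof (rule sum.cong[OF refl])
    fix l assume "l \<in> {..n}"
    then have "(-1 :: real) ^ n = (-1) ^ l * (-1) ^ (n - l)" by (simp flip: power_add)
    then have "(-1) ^ l * A l * ((-1) ^ (n - l) * B (n - l)) / (x ^ l * y ^ (n - l)) =
        (-1) ^ n * (A l * B (n - l) * (1 / x) ^ l * (1 / y) ^ (n - l))"
      by (simp only:) (simp add: power_one_over)
    then show "a_coeff l (of_real a) * a_coeff (n - l) (of_real b) / (of_real x ^ l * of_real y ^ (n - l)) =
        complex_of_real ((-1) ^ n * (A l * B (n - l) * (1 / x) ^ l * (1 / y) ^ (n - l)))"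
      unfolding A(2) B(2) by (simp only: of_real_mult[symmetric] of_real_divide[symmetric] of_real_power[symmetric])
  qed
  ultimately show ?thesis by blast
qed

theorem theorem2p2:
  fixes \<xi> \<nu> \<alpha> \<beta> \<sigma> R :: complex and N :: nat
  assumes xi: "\<xi> \<in> domD"
    and N: "Re (2 * \<nu> + \<alpha> + \<beta> + 1) > real N"
    and sigma: "\<sigma> = 2 * \<nu> + \<alpha> + \<beta>"
    and R: "2 powr (\<sigma> + 1) / of_real pi * Beta (\<nu> + 1) (\<nu> + \<alpha> + \<beta> + 1)
              * jacobi_Q \<nu> \<alpha> \<beta> (cosh (2 * \<xi>))
            = pow_D Xm (\<alpha> + 1/2) \<xi> * pow_D Ym (\<beta> + 1/2) \<xi> * exp (- 2 * \<nu> * \<xi>)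
              * ((\<Sum>n<N. g_coeff n \<xi> \<alpha> \<beta> * Gamma (\<sigma> - of_nat n + 1) / Gamma (\<sigma> + 2)) + R)"
  shows "(\<bar>Re \<alpha>\<bar> < real N + 1/2 \<and> \<bar>Re \<beta>\<bar> < 1/2 \<longrightarrow>
           norm R \<le> (a_hat N \<alpha> * a_hat 0 \<beta> * norm (Xp \<xi>) ^ N
             + (\<Sum>l<N. norm (a_coeff l \<alpha>) * a_hat (N - l) \<beta>
                  * norm (Xp \<xi>) ^ l * norm (Yp \<xi>) ^ (N - l))) * G_fac N \<sigma>) \<and>
         (\<bar>Re \<alpha>\<bar> < 1/2 \<and> \<bar>Re \<beta>\<bar> < real N + 1/2 \<longrightarrow>
           norm R \<le> (a_hat 0 \<alpha> * a_hat N \<beta> * norm (Yp \<xi>) ^ N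
             + (\<Sum>l=1..N. a_hat l \<alpha> * norm (a_coeff (N - l) \<beta>)
                  * norm (Xp \<xi>) ^ l * norm (Yp \<xi>) ^ (N - l))) * G_fac N \<sigma>) \<and>
         (\<bar>Re \<alpha>\<bar> < 1/2 \<and> \<bar>Re \<beta>\<bar> < 1/2 \<longrightarrow>
           norm R \<le> (\<Sum>l\<le>N. a_hat l \<alpha> * a_hat (N - l) \<beta>
             * norm (Xp \<xi>) ^ l * norm (Yp \<xi>) ^ (N - l)) * G_fac N \<sigma>) \<and>
         (\<xi> \<in> \<real> \<and> Re \<xi> > 0 \<and> \<nu> \<in> \<real> \<and> \<alpha> \<in> \<real> \<and> \<beta> \<in> \<real> \<and> \<bar>Re \<alpha>\<bar> < 1/2 \<and> \<bar>Re \<beta>\<bar> < 1/2 \<longrightarrow>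
           (let T = g_coeff N \<xi> \<alpha> \<beta> * Gamma (\<sigma> - of_nat N + 1) / Gamma (\<sigma> + 2)
            in R \<in> \<real> \<and> T \<in> \<real> \<and> norm R \<le> norm T \<and> sgn (Re R) = sgn (Re T)))"
proof -
  define X Y where "X = norm (Xp \<xi>)" and "Y = norm (Yp \<xi>)"
  define G where "G = norm (Gamma (\<sigma> + 2))"
  have XY: "X = norm (1 / x_of \<xi>)" "Y = norm (1 / y_of \<xi>)" by (simp_all only: X_def Y_def Xp_Yp_eq)
  have s: "Re \<sigma> + 1 > real N" using N by (simp add: sigma)
  have R': "Q_lhs \<nu> \<alpha> \<beta> \<xi> = Q_prefix \<nu> \<alpha> \<beta> \<xi> *
      ((\<Sum>n<N. g_coeff n \<xi> \<alpha> \<beta> * Gamma (\<sigma> - of_nat n + 1) / Gamma (\<sigma> + 2)) + R)"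
    using R unfolding Q_lhs_def Q_prefix_def sigma .
  note Req = remainder_eq[OF xi N sigma R']
  have bound1: "norm R \<le> (a_hat N \<alpha> * a_hat 0 \<beta> * X ^ N +
      (\<Sum>l<N. norm (a_coeff l \<alpha>) * a_hat (N - l) \<beta> * X ^ l * Y ^ (N - l))) * G_fac N \<sigma>"
    if "\<bar>Re \<alpha>\<bar> < real N + 1/2" "\<bar>Re \<beta>\<bar> < 1/2"
    unfolding Req(1)[OF that] norm_divide[of "R_xy _ _ _ _ _ _"] G_fac_def XY times_divide_eq_right
    by (intro divide_right_mono norm_R_xy_le that s Re_x_of_pos Re_y_of_pos xi norm_ge_zero)
  have bound2: "norm R \<le> (a_hat 0 \<alpha> * a_hat N \<beta> * Y ^ N +
      (\<Sum>l=1..N. a_hat l \<alpha> * norm (a_coeff (N - l) \<beta>) * X ^ l * Y ^ (N - l))) * G_fac N \<sigma>"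
    if "\<bar>Re \<alpha>\<bar> < 1/2" "\<bar>Re \<beta>\<bar> < real N + 1/2"
  proof -
    have "norm R \<le> (a_hat N \<beta> * a_hat 0 \<alpha> * Y ^ N +
      (\<Sum>l<N. norm (a_coeff l \<beta>) * a_hat (N - l) \<alpha> * Y ^ l * X ^ (N - l))) * G_fac N \<sigma>"
      unfolding Req(2)[OF that] norm_divide[of "R_xy _ _ _ _ _ _"] G_fac_def XY times_divide_eq_right
      by (intro divide_right_mono norm_R_xy_le that s Re_x_of_pos Re_y_of_pos xi norm_ge_zero)
    \<comment> \<open>Reversing the index moves the excluded value from l = N to l = 0.\<close>
    also have "(\<Sum>l<N. norm (a_coeff l \<beta>) * a_hat (N - l) \<alpha> * Y ^ l * X ^ (N - l)) =
        (\<Sum>l=1..N. a_hat l \<alpha> * norm (a_coeff (N - l) \<beta>) * X ^ l * Y ^ (N - l))"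
      by (rule sum.reindex_bij_witness[of _ "\<lambda>l. N - l" "\<lambda>l. N - l"]) auto
    finally show ?thesis by (simp only: mult.commute[of "a_hat N \<beta>"])
  qed
  have bound3: "norm R \<le> (\<Sum>l\<le>N. a_hat l \<alpha> * a_hat (N - l) \<beta> * X ^ l * Y ^ (N - l)) * G_fac N \<sigma>"
    if ab: "\<bar>Re \<alpha>\<bar> < 1/2" "\<bar>Re \<beta>\<bar> < 1/2"
  proof -
    \<comment> \<open>The bound (i) with |a_l(\<alpha>)| enlarged to
      \<open>a_hat l \<alpha>\<close>; the separate term is then the summand l = N.\<close>
    have "a_hat N \<alpha> * a_hat 0 \<beta> * X ^ N + (\<Sum>l<N. norm (a_coeff l \<alpha>) * a_hat (N - l) \<beta> * X ^ l * Y ^ (N - l))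
      \<le> a_hat N \<alpha> * a_hat 0 \<beta> * X ^ N + (\<Sum>l<N. a_hat l \<alpha> * a_hat (N - l) \<beta> * X ^ l * Y ^ (N - l))"
      using ab(1)
      by (intro add_left_mono sum_mono mult_right_mono norm_a_coeff_le_a_hat a_hat_nonneg zero_le_power)
         (simp_all add: X_def Y_def)
    also have "\<dots> = (\<Sum>l\<le>N. a_hat l \<alpha> * a_hat (N - l) \<beta> * X ^ l * Y ^ (N - l))"
      by (simp flip: lessThan_Suc_atMost)
    finally have "(a_hat N \<alpha> * a_hat 0 \<beta> * X ^ N + (\<Sum>l<N. norm (a_coeff l \<alpha>) * a_hat (N - l) \<beta> * X ^ l * Y ^ (N - l))) * G_fac N \<sigma>
       \<le> (\<Sum>l\<le>N. a_hat l \<alpha> * a_hat (N - l) \<beta> * X ^ l * Y ^ (N - l)) * G_fac N \<sigma>"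
      using s by (intro mult_right_mono) (simp_all add: G_fac_def Gamma_real_nonneg)
    moreover have "\<bar>Re \<alpha>\<bar> < real N + 1/2" using ab by simp
    ultimately show ?thesis using bound1 ab(2) order.trans by blast
  qed
  have real_case: "let T = g_coeff N \<xi> \<alpha> \<beta> * Gamma (\<sigma> - of_nat N + 1) / Gamma (\<sigma> + 2)
            in R \<in> \<real> \<and> T \<in> \<real> \<and> norm R \<le> norm T \<and> sgn (Re R) = sgn (Re T)"
    if real: "\<xi> \<in> \<real>" "Re \<xi> > 0" "\<nu> \<in> \<real>" "\<alpha> \<in> \<real>" "\<beta> \<in> \<real>" and ab: "\<bar>Re \<alpha>\<bar> < 1/2" "\<bar>Re \<beta>\<bar> < 1/2"
  proof -
    define t a b s where "t = Re \<xi>" and "a = Re \<alpha>" and "b = Re \<beta>" and "s = Re \<sigma>"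
    have "\<sigma> \<in> \<real>" unfolding sigma using real by (intro Reals_add Reals_mult) auto
    then have of: "\<xi> = of_real t" "\<alpha> = of_real a" "\<beta> = of_real b" "\<sigma> = of_real s"
      using real by (simp_all add: t_def a_def b_def s_def)
    have a: "\<bar>a\<bar> < 1/2" and b: "\<bar>b\<bar> < 1/2" using ab by (simp_all add: a_def b_def)
    have s': "s + 1 > real N" using s by (simp add: s_def)
    define x y where "x = sinh t * exp (- t)" and "y = cosh t * exp (- t)"
    have xy: "x > 0" "y > 0" using real(2) by (simp_all add: x_def y_def t_def)
    have xyo: "x_of \<xi> = of_real x" "y_of \<xi> = of_real y"
      unfolding of x_of_y_of_of_real x_def y_def by simp_all
    have G2: "Gamma (\<sigma> + 2) = of_real (Gamma (s + 2))" "Gamma (\<sigma> - of_nat N + 1) = of_real (Gamma (s - real N + 1))"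
      unfolding of using Gamma_complex_of_real[of "s + 2"] Gamma_complex_of_real[of "s - real N + 1"] by simp_all
    have Gpos: "Gamma (s + 2) > 0" "Gamma (s - real N + 1) > 0" using s' by (simp_all add: Gamma_real_pos)
    have "\<exists>r>0. R_xy N \<sigma> \<alpha> \<beta> (x_of \<xi>) (y_of \<xi>) = of_real ((-1) ^ N * r)"
      unfolding xyo unfolding of by (rule R_xy_sign[OF a b s' xy])
    then obtain r where r: "r > 0" "R_xy N \<sigma> \<alpha> \<beta> (x_of \<xi>) (y_of \<xi>) = of_real ((-1) ^ N * r)"
      by blast
    have "\<exists>g>0. g_coeff N \<xi> \<alpha> \<beta> = of_real ((-1) ^ N * g) \<and>
      g = (\<Sum>l\<le>N. norm (a_coeff l \<alpha>) * norm (a_coeff (N - l) \<beta>) * (1 / x) ^ l * (1 / y) ^ (N - l))"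
      unfolding g_coeff_eq xyo unfolding of by (rule g_xy_sign[OF a b xy])
    then obtain g where g: "g > 0" "g_coeff N \<xi> \<alpha> \<beta> = of_real ((-1) ^ N * g)"
      "g = (\<Sum>l\<le>N. norm (a_coeff l \<alpha>) * norm (a_coeff (N - l) \<beta>) * (1 / x) ^ l * (1 / y) ^ (N - l))"
      by blast
    have XYr: "X = 1 / x" "Y = 1 / y" using xy unfolding XY xyo by (simp_all add: norm_divide)
    have aN: "\<bar>Re \<alpha>\<bar> < real N + 1/2" using ab by simp
    have Rr: "R = of_real ((-1) ^ N * (r / Gamma (s + 2)))"
      using Req(1)[OF aN ab(2)] unfolding r(2) G2 by simp
    define T where "T = g_coeff N \<xi> \<alpha> \<beta> * Gamma (\<sigma> - of_nat N + 1) / Gamma (\<sigma> + 2)"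
    have Tr: "T = of_real ((-1) ^ N * (g * Gamma (s - real N + 1) / Gamma (s + 2)))"
      unfolding T_def g(2) G2 by simp
    have "norm R \<le> norm T"
    proof -
      have "G_fac N \<sigma> = Gamma (s - real N + 1) / Gamma (s + 2)"
        unfolding G_fac_def G2 norm_of_real using Gpos by (simp add: s_def)
      \<comment> \<open>For real orders \<open>a_hat\<close> is the modulus of the coefficient, so
        the bound (iii) is exactly the modulus of the first neglected term.\<close>
      moreover have "(\<Sum>l\<le>N. a_hat l \<alpha> * a_hat (N - l) \<beta> * X ^ l * Y ^ (N - l)) = g"
        unfolding g(3) XYr of a_hat_real[OF a] a_hat_real[OF b] by simp
      moreover have "norm T = g * Gamma (s - real N + 1) / Gamma (s + 2)"
        unfolding Tr norm_of_real using g(1) Gpos by (simp add: abs_mult power_abs)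
      ultimately show ?thesis using bound3[OF ab] by simp
    qed
    moreover have "sgn (Re R) = sgn (Re T)"
      unfolding Rr Tr Re_complex_of_real sgn_mult using r(1) g(1) Gpos by simp
    moreover have "R \<in> \<real>" "T \<in> \<real>" unfolding Rr Tr by (rule Reals_of_real)+
    ultimately show ?thesis unfolding T_def[symmetric] Let_def by blast
  qed
  show ?thesis
    using bound1 bound2 bound3 real_case unfolding X_def Y_def by blast
qed

end
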